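(* Let $X$ be a complex manifold and $n\ge1$. The map $s_n^{(\bullet)}:\mathbb{Q}^\bullet_{\mathcal{E}}(n)\to S^\bullet(n-1)[-1]$ is a homotopy between the map $\varphi_n^{(\bullet)}:\mathbb{Q}^\bullet_{\mathcal{E}}(n)\to S^\bullet(n-1)$ and zero: $$s_n^{(k+1)}\circ\delta+d\circ s_n^{(k)}=\varphi_n^{(k)}\qquad\text{for } 1\le k\le n-1 .$$
   Context: $\mathcal{O}$ is the sheaf of holomorphic functions on $X$, $\mathcal{O}^*$ its units, $\mathcal{O}(m)=\mathcal{O}\otimes(2\pi i)^{\otimes m}$, $\Omega^\bullet$ the holomorphic de Rham complex, $\mathbb{R}(m)=(2\pi i)^m\mathbb{R}$, and $(S^\bullet(m),d)$ is the de Rham complex of smooth $\mathbb{R}(m)$-valued forms on $X$. **Lie-exponential complex.** $\mathbb{Q}^\bullet_{\mathcal{E}}(n)$ is the complex in degrees $[0,n]$: $\mathcal{O}(n-1)\to\Lambda^2\mathcal{O}(n-2)\to\dots\to\Lambda^n\mathcal{O}\to\Lambda^n\mathcal{O}^*$, with $\Lambda^{k+1}\mathcal{O}(n-k-1)$ in degree $k<n$. Its differential $\delta$ is $(2\pi i)^{n-k}\otimes a_1\wedge\dots\wedge a_k\mapsto(2\pi i)^{n-k-1}\otimes2\pi i\wedge a_1\wedge\dots\wedge a_k$ for $k<n$, and $a_1\wedge\dots\wedge a_n\mapsto\exp(a_1)\wedge\dots\wedge\exp(a_n)$ on the term $\Lambda^n\mathcal{O}$. **Notation.** $\pi_n:\mathbb{C}\to\mathbb{C}/\mathbb{R}(n)=\mathbb{R}(n-1)$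 is $\pi_n(a+ib)=a$ for $n$ odd, $ib$ for $n$ even; it is applied to complex valued forms coefficientwise. $\mathrm{Re}(x+iy)=x$ and, by convention, $\mathrm{Im}(x+iy)=iy$. $\mathrm{Alt}_nF(x_1,\dots,x_n)=\sum_{\sigma\in S_n}(-1)^{|\sigma|}F(x_{\sigma(1)},\dots,x_{\sigma(n)})$. **The map $\varphi_n$.** $\varphi_n^{(\bullet)}=\pi_n\circ\omega_n^{(\bullet)}$, where $\omega_n^{(\bullet)}:\mathbb{Q}^\bullet_{\mathcal{E}}(n)\to\Omega^\bullet$ is the canonical map given for $0\le m<n$ by $$\omega_n^{(m)}\bigl((2\pi i)^{n-m-1}\otimes f_0\wedge\dots\wedge f_m\bigr)=(2\pi i)^{n-m-1}\,m!\sum_{j=0}^m(-1)^jf_j\,df_0\wedge\dots\wedge\widehat{df_j}\wedge\dots\wedge df_m,$$ and by $\omega_n^{(n)}(F_1\wedge\dots\wedge F_n)=n!\,d\log F_1\wedge\dots\wedge d\log F_n$. **The map $s_n$.** For $m\ge1$ define $\widetilde r_{m-1}:\Lambda^m\mathcal{O}\to S^{m-1}(m-1)$ by $$\widetilde r_{m-1}(f_1\wedge\dots\wedge f_m)=\mathrm{Alt}_m\sum_{j\ge0,\,2j+1\le m}\frac{1}{(2j+1)!(m-2j-1)!}\,\mathrm{Re}f_1\,d\mathrm{Re}f_2\wedge\dots\wedge d\mathrm{Re}f_{2j+1}\wedge d\mathrm{Im}f_{2j+2}\wedge\dots\wedge d\mathrm{Im}f_m ,$$ a primitive of $\pi_m(df_1\wedge\dots\wedge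 df_m)$. For $1\le k\le n-1$, $s_n^{(k)}:\Lambda^{k+1}\mathcal{O}(n-k-1)\to S^{k-1}(n-1)$ is $$s_n^{(k)}\bigl((2\pi i)^{n-k-1}\otimes f_0\wedge\dots\wedge f_k\bigr)=\frac{(2\pi i)^{n-k-1}}{n!}\,\mathrm{Alt}_{k+1}\bigl(\mathrm{Im}f_0\cdot\widetilde r_{k-1}(f_1\wedge\dots\wedge f_k)\bigr),$$ with $\mathrm{Alt}_{k+1}$ over $f_0,\dots,f_k$; and $s_n^{(n)}=\frac1{n!}\,r_{n-1}:\Lambda^n\mathcal{O}^*\to S^{n-1}(n-1)$, where $r_{n-1}(F_1\wedge\dots\wedge F_n)=\widetilde r_{n-1}(\log F_1\wedge\dots\wedge\log F_n)$.
   Formalization: The factor 1/n! in s_n^(k) is replaced by 1 for k<n and by n! for k=n, since the printed constants fail (n=2, k=1, X=C, z∧1 gives 0 on the left but φ gives −i dy); X is nonempty, of pure dimension at least 1. *)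

theory Defs
  imports
    "HOL-Analysis.Analysis"
    "HOL-Algebra.Free_Abelian_Groups"
    "HOL-Algebra.Generated_Groups"
    "HOL-Combinatorics.Permutations"
    "HOL-Library.Function_Algebras"
begin

section \<open>Complex manifolds\<close>

type_synonym ('x, 'd) chart = "'x set \<times> ('x \<Rightarrow> complex ^ 'd)"

definition cholomorphic_on :: "(complex ^ 'd::finite \<Rightarrow> complex) \<Rightarrow> (complex ^ 'd) set \<Rightarrow> bool"
  where "cholomorphic_on f W \<longleftrightarrow>
    (\<forall>x\<in>W. \<exists>D. (f has_derivative D) (at x) \<and> (\<forall>a v. D (a *s v) = a * D v))"

primrec ck_on :: "nat \<Rightarrow> ('v::real_normed_vector \<Rightarrow> complex) \<Rightarrow> 'v set \<Rightarrow> bool" where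
  "ck_on 0 f W \<longleftrightarrow> continuous_on W f"
| "ck_on (Suc k) f W \<longleftrightarrow>
    (\<forall>x\<in>W. f differentiable (at x)) \<and>
    (\<forall>v. ck_on k (\<lambda>x. frechet_derivative f (at x) v) W)"

definition smooth_on :: "('v::real_normed_vector \<Rightarrow> complex) \<Rightarrow> 'v set \<Rightarrow> bool"
  where "smooth_on f W \<longleftrightarrow> (\<forall>k. ck_on k f W)"

abbreviation chart_inv :: "('x, 'd) chart \<Rightarrow> complex ^ 'd \<Rightarrow> 'x"
  where "chart_inv C \<equiv> inv_into (fst C) (snd C)"

text \<open>A complex manifold of dimension \<open>CARD('d)\<close> is the Hausdorff, second countable space \<open>'x\<close>
  together with a (not necessarily maximal) holomorphic atlas.\<close>

definition complex_manifold ::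
    "('x::{t2_space, second_countable_topology}, 'd::finite) chart set \<Rightarrow> bool"
  where "complex_manifold A \<longleftrightarrow>
    (\<Union>C\<in>A. fst C) = UNIV \<and>
    (\<forall>C\<in>A. open (fst C) \<and> open (snd C ` fst C) \<and>
       homeomorphism (fst C) (snd C ` fst C) (snd C) (chart_inv C)) \<and>
    (\<forall>C\<in>A. \<forall>C'\<in>A. \<forall>i.
       cholomorphic_on (\<lambda>z. snd C' (chart_inv C z) $ i) (snd C ` (fst C \<inter> fst C')))"

section \<open>Holomorphic functions\<close>

definition holomorphic_fun ::
    "('x::topological_space, 'd::finite) chart set \<Rightarrow> 'x set \<Rightarrow> ('x \<Rightarrow> complex) \<Rightarrow> bool"
  where "holomorphic_fun A U f \<longleftrightarrow>
    (\<forall>C\<in>A. cholomorphic_on (f \<circ> chart_inv C) (snd C ` (U \<inter> fst C)))"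

text \<open>So that sections over \<open>U\<close> are equal iff they agree on \<open>U\<close>, sections of the structure sheaf are
  normalised to be \<open>0\<close> off \<open>U\<close> and invertible sections to be \<open>1\<close> off \<open>U\<close>. With these conventions the
  group operations are the pointwise ones and \<open>exp\<close> is composition.\<close>

definition hol_sections ::
    "('x::topological_space, 'd::finite) chart set \<Rightarrow> 'x set \<Rightarrow> ('x \<Rightarrow> complex) monoid"
  where "hol_sections A U =
    \<lparr>carrier = {f. holomorphic_fun A U f \<and> (\<forall>x. x \<notin> U \<longrightarrow> f x = 0)},
     monoid.mult = (+), one = 0\<rparr>"

definition hol_units ::
    "('x::topological_space, 'd::finite) chart set \<Rightarrow> 'x set \<Rightarrow> ('x \<Rightarrow> complex) monoid"
  where "hol_units A U =
    \<lparr>carrier = {f. holomorphic_fun A U f \<and> (\<forall>x\<in>U. f x \<noteq> 0) \<and> (\<forall>x. x \<notin> U \<longrightarrow> f x = 1)},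
     monoid.mult = (*), one = 1\<rparr>"

definition cut_fun :: "complex \<Rightarrow> 'x set \<Rightarrow> ('x \<Rightarrow> complex) \<Rightarrow> 'x \<Rightarrow> complex"
  where "cut_fun e U f = (\<lambda>x. if x \<in> U then f x else e)"

section \<open>Exterior powers of abelian groups\<close>

text \<open>The exterior power over the integers: the free abelian group on \<open>k\<close>-tuples modulo additivity in
  each slot and vanishing on tuples with a repeated entry. For a rational vector space, such as the
  additive group of holomorphic functions, and \<open>k \<ge> 1\<close> it is also the exterior power over the
  rationals.\<close>

definition tuples :: "nat \<Rightarrow> ('a, 'b) monoid_scheme \<Rightarrow> 'a list set"
  where "tuples k G = {xs. length xs = k \<and> set xs \<subseteq> carrier G}"

definition ext_relators :: "nat \<Rightarrow> ('a, 'b) monoid_scheme \<Rightarrow> ('a list \<Rightarrow>\<^sub>0 int) set"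
  where "ext_relators k G =
    {frag_of (xs[i := x \<otimes>\<^bsub>G\<^esub> y]) - frag_of (xs[i := x]) - frag_of (xs[i := y]) | xs i x y.
       xs \<in> tuples k G \<and> i < k \<and> x \<in> carrier G \<and> y \<in> carrier G} \<union>
    {frag_of xs | xs. xs \<in> tuples k G \<and> (\<exists>i j. i < j \<and> j < k \<and> xs ! i = xs ! j)}"

definition ext_ker :: "nat \<Rightarrow> ('a, 'b) monoid_scheme \<Rightarrow> ('a list \<Rightarrow>\<^sub>0 int) set"
  where "ext_ker k G = generate (free_Abelian_group (tuples k G)) (ext_relators k G)"

definition ext_power :: "nat \<Rightarrow> ('a, 'b) monoid_scheme \<Rightarrow> ('a list \<Rightarrow>\<^sub>0 int) set monoid"
  where "ext_power k G = free_Abelian_group (tuples k G) Mod ext_ker k G"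

definition ext_wedge :: "('a, 'b) monoid_scheme \<Rightarrow> 'a list \<Rightarrow> ('a list \<Rightarrow>\<^sub>0 int) set"
  where "ext_wedge G xs =
    ext_ker (length xs) G #>\<^bsub>free_Abelian_group (tuples (length xs) G)\<^esub> frag_of xs"

text \<open>The homomorphism on the exterior power with prescribed values on the \<open>x\<^sub>1 \<and> \<dots> \<and> x\<^sub>k\<close>; it is
  unique because these generate.\<close>

definition ext_lift ::
    "nat \<Rightarrow> ('a, 'b) monoid_scheme \<Rightarrow> ('c, 'e) monoid_scheme \<Rightarrow> ('a list \<Rightarrow> 'c)
      \<Rightarrow> ('a list \<Rightarrow>\<^sub>0 int) set \<Rightarrow> 'c"
  where "ext_lift k G H F =
    (THE h. h \<in> hom (ext_power k G) H \<and> h \<in> extensional (carrier (ext_power k G)) \<and>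
       (\<forall>xs\<in>tuples k G. h (ext_wedge G xs) = F xs))"

section \<open>Differential forms\<close>

text \<open>\<open>\<omega> C p [v\<^sub>1, \<dots>, v\<^sub>k]\<close> is the value at the point \<open>p\<close> of a \<open>k\<close>-form on the tangent vectors whose
  coordinates in the chart \<open>C\<close> are \<open>v\<^sub>1, \<dots>, v\<^sub>k\<close>. A form of degree \<open>k\<close> on \<open>U\<close> is normalised to be \<open>0\<close>
  wherever this does not make sense. Addition of forms is pointwise.\<close>

type_synonym ('x, 'd) form = "('x, 'd) chart \<Rightarrow> 'x \<Rightarrow> (complex ^ 'd) list \<Rightarrow> complex"

definition cut_form ::
    "('x, 'd) chart set \<Rightarrow> 'x set \<Rightarrow> nat \<Rightarrow> ('x, 'd) form \<Rightarrow> ('x, 'd) form"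
  where "cut_form A U k \<omega> =
    (\<lambda>C p vs. if C \<in> A \<and> p \<in> U \<inter> fst C \<and> length vs = k then \<omega> C p vs else 0)"

definition is_form ::
    "('x::topological_space, 'd::finite) chart set \<Rightarrow> 'x set \<Rightarrow> nat \<Rightarrow> ('x, 'd) form \<Rightarrow> bool"
  where "is_form A U k \<omega> \<longleftrightarrow>
    cut_form A U k \<omega> = \<omega> \<and>
    (\<forall>C\<in>A. \<forall>p\<in>U \<inter> fst C. \<forall>vs. length vs = k \<longrightarrow>
       (\<forall>i<k. linear (\<lambda>v. \<omega> C p (vs[i := v]))) \<and>
       (\<forall>i j. i < j \<and> j < k \<and> vs ! i = vs ! j \<longrightarrow> \<omega> C p vs = 0)) \<and>
    (\<forall>C\<in>A. \<forall>C'\<in>A. \<forall>p\<in>U \<inter> fst C \<inter> fst C'. \<forall>vs. length vs = k \<longrightarrow>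
       \<omega> C' p (map (frechet_derivative (snd C' \<circ> chart_inv C) (at (snd C p))) vs) = \<omega> C p vs)"

definition twisted_reals :: "nat \<Rightarrow> complex set"
  where "twisted_reals m = range (\<lambda>t. (2 * of_real pi * \<i>) ^ m * of_real t)"

text \<open>\<open>smooth_forms A m k U\<close> is the group of smooth \<open>k\<close>-forms on \<open>U\<close> with values in
  \<open>(2 \<pi> i)\<^sup>m \<real>\<close>.\<close>

definition smooth_forms ::
    "('x::topological_space, 'd::finite) chart set \<Rightarrow> nat \<Rightarrow> nat \<Rightarrow> 'x set \<Rightarrow> ('x, 'd) form monoid"
  where "smooth_forms A m k U =
    \<lparr>carrier = {\<omega>. is_form A U k \<omega> \<and>
       (\<forall>C p vs. \<omega> C p vs \<in> twisted_reals m) \<and>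
       (\<forall>C\<in>A. \<forall>vs. length vs = k \<longrightarrow>
          smooth_on (\<lambda>z. \<omega> C (chart_inv C z) vs) (snd C ` (U \<inter> fst C)))},
     monoid.mult = (+), one = 0\<rparr>"

definition holomorphic_forms ::
    "('x::topological_space, 'd::finite) chart set \<Rightarrow> nat \<Rightarrow> 'x set \<Rightarrow> ('x, 'd) form monoid"
  where "holomorphic_forms A k U =
    \<lparr>carrier = {\<omega>. is_form A U k \<omega> \<and>
       (\<forall>C p vs i a. i < length vs \<longrightarrow> \<omega> C p (vs[i := a *s vs ! i]) = a * \<omega> C p vs) \<and>
       (\<forall>C\<in>A. \<forall>vs. length vs = k \<longrightarrow>
          cholomorphic_on (\<lambda>z. \<omega> C (chart_inv C z) vs) (snd C ` (U \<inter> fst C)))},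
     monoid.mult = (+), one = 0\<rparr>"

definition del_nth :: "nat \<Rightarrow> 'a list \<Rightarrow> 'a list"
  where "del_nth i xs = take i xs @ drop (Suc i) xs"

text \<open>\<open>(d\<omega>)(v\<^sub>0, \<dots>, v\<^sub>k) = \<Sum>\<^sub>i (-1)\<^sup>i D\<^bsub>v\<^sub>i\<^esub> (\<omega>(v\<^sub>0, \<dots>, v\<^sub>i omitted, \<dots>, v\<^sub>k))\<close> for constant vectors in a
  chart; there is no factor \<open>1/(k+1)\<close>, matching the determinant convention in \<open>wedge_d\<close>.\<close>

definition ext_deriv ::
    "('x, 'd::finite) chart set \<Rightarrow> 'x set \<Rightarrow> nat \<Rightarrow> ('x, 'd) form \<Rightarrow> ('x, 'd) form"
  where "ext_deriv A U k \<omega> = cut_form A U (Suc k) (\<lambda>C p vs.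
    \<Sum>i\<le>k. (-1) ^ i *
      frechet_derivative (\<lambda>z. \<omega> C (chart_inv C z) (del_nth i vs)) (at (snd C p)) (vs ! i))"

definition fun_diff :: "('x \<Rightarrow> complex) \<Rightarrow> ('x, 'd::finite) chart \<Rightarrow> 'x \<Rightarrow> complex ^ 'd \<Rightarrow> complex"
  where "fun_diff f C p v = frechet_derivative (f \<circ> chart_inv C) (at (snd C p)) v"

text \<open>\<open>wedge_d A U [g\<^sub>1, \<dots>, g\<^sub>k]\<close> is \<open>dg\<^sub>1 \<and> \<dots> \<and> dg\<^sub>k\<close> on \<open>U\<close>.\<close>

definition wedge_d ::
    "('x, 'd::finite) chart set \<Rightarrow> 'x set \<Rightarrow> ('x \<Rightarrow> complex) list \<Rightarrow> ('x, 'd) form"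
  where "wedge_d A U gs = cut_form A U (length gs) (\<lambda>C p vs.
    \<Sum>\<sigma> | \<sigma> permutes {..<length gs}.
      of_int (sign \<sigma>) * (\<Prod>i<length gs. fun_diff (gs ! i) C p (vs ! \<sigma> i)))"

definition fun_mult :: "('x \<Rightarrow> complex) \<Rightarrow> ('x, 'd) form \<Rightarrow> ('x, 'd) form"
  where "fun_mult f \<omega> = (\<lambda>C p vs. f p * \<omega> C p vs)"

definition scale_form :: "complex \<Rightarrow> ('x, 'd) form \<Rightarrow> ('x, 'd) form"
  where "scale_form c \<omega> = (\<lambda>C p vs. c * \<omega> C p vs)"

definition alt_sum :: "('a list \<Rightarrow> ('x, 'd) form) \<Rightarrow> 'a list \<Rightarrow> ('x, 'd) form"
  where "alt_sum F xs =
    (\<Sum>\<sigma> | \<sigma> permutes {..<length xs}. scale_form (of_int (sign \<sigma>)) (F (permute_list \<sigma> xs)))"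

text \<open>The holomorphic branch near \<open>p\<close> of \<open>log F\<close> with principal value at \<open>p\<close>. Applied below, a form
  that depends on a choice of logarithms only up to multiples of \<open>2 \<pi> i\<close> is evaluated at each
  point by means of branches near that point.\<close>

definition log_branch :: "'x \<Rightarrow> ('x \<Rightarrow> complex) \<Rightarrow> 'x \<Rightarrow> complex"
  where "log_branch p F = (\<lambda>x. Ln (F p) + Ln (F x / F p))"

definition of_logs ::
    "(('x \<Rightarrow> complex) list \<Rightarrow> ('x, 'd) form) \<Rightarrow> ('x \<Rightarrow> complex) list \<Rightarrow> ('x, 'd) form"
  where "of_logs G Fs = (\<lambda>C p. G (map (log_branch p) Fs) C p)"

section \<open>The Lie-exponential complex\<close>

text \<open>The term of degree \<open>k < n\<close> is \<open>\<Lambda>\<^sup>k\<^sup>+\<^sup>1\<close> of the structure sheaf, twisted by the free rank one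
  module on the formal generator \<open>(2 \<pi> i)\<^sup>n\<^sup>-\<^sup>k\<^sup>-\<^sup>1\<close>. An element \<open>(2 \<pi> i)\<^sup>n\<^sup>-\<^sup>k\<^sup>-\<^sup>1 \<otimes> \<xi>\<close> is represented by
  \<open>\<xi>\<close>; the maps out of the complex insert the scalar \<open>(2 \<pi> i)\<^sup>n\<^sup>-\<^sup>k\<^sup>-\<^sup>1\<close>. Only degrees \<open>k \<le> n\<close> are
  meaningful. Terms are given by the exterior powers of sections over each open set; homomorphisms
  from the associated sheaf to a sheaf of forms are the same as presheaf homomorphisms.\<close>

definition lie_exp ::
    "('x::topological_space, 'd::finite) chart set \<Rightarrow> nat \<Rightarrow> nat \<Rightarrow> 'x set
      \<Rightarrow> (('x \<Rightarrow> complex) list \<Rightarrow>\<^sub>0 int) set monoid"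
  where "lie_exp A n k U =
    (if k < n then ext_power (k + 1) (hol_sections A U) else ext_power n (hol_units A U))"

definition lie_exp_res ::
    "('x::topological_space, 'd::finite) chart set \<Rightarrow> nat \<Rightarrow> nat \<Rightarrow> 'x set \<Rightarrow> 'x set
      \<Rightarrow> (('x \<Rightarrow> complex) list \<Rightarrow>\<^sub>0 int) set \<Rightarrow> (('x \<Rightarrow> complex) list \<Rightarrow>\<^sub>0 int) set"
  where "lie_exp_res A n k U V =
    (if k < n
     then ext_lift (k + 1) (hol_sections A U) (lie_exp A n k V)
            (\<lambda>fs. ext_wedge (hol_sections A V) (map (cut_fun 0 V) fs))
     else ext_lift n (hol_units A U) (lie_exp A n k V)
            (\<lambda>Fs. ext_wedge (hol_units A V) (map (cut_fun 1 V) Fs)))"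

definition lie_exp_diff ::
    "('x::topological_space, 'd::finite) chart set \<Rightarrow> nat \<Rightarrow> nat \<Rightarrow> 'x set
      \<Rightarrow> (('x \<Rightarrow> complex) list \<Rightarrow>\<^sub>0 int) set \<Rightarrow> (('x \<Rightarrow> complex) list \<Rightarrow>\<^sub>0 int) set"
  where "lie_exp_diff A n k U =
    ext_lift (k + 1) (hol_sections A U) (lie_exp A n (k + 1) U)
      (\<lambda>fs. if k + 1 < n
        then ext_wedge (hol_sections A U) (cut_fun 0 U (\<lambda>_. 2 * of_real pi * \<i>) # fs)
        else ext_wedge (hol_units A U) (map (\<lambda>f. exp \<circ> f) fs))"

section \<open>The maps \<open>\<phi>\<close> and \<open>s\<close>\<close>

definition proj_twist :: "nat \<Rightarrow> complex \<Rightarrow> complex"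
  where "proj_twist n z = (if odd n then of_real (Re z) else \<i> * of_real (Im z))"

definition proj_form :: "nat \<Rightarrow> ('x, 'd) form \<Rightarrow> ('x, 'd) form"
  where "proj_form n \<omega> = (\<lambda>C p vs. proj_twist n (\<omega> C p vs))"

definition omega_gen ::
    "('x, 'd::finite) chart set \<Rightarrow> nat \<Rightarrow> nat \<Rightarrow> 'x set \<Rightarrow> ('x \<Rightarrow> complex) list \<Rightarrow> ('x, 'd) form"
  where "omega_gen A n m U fs =
    (if m < n
     then scale_form ((2 * of_real pi * \<i>) ^ (n - m - 1) * fact m)
            (\<Sum>j\<le>m. scale_form ((-1) ^ j) (fun_mult (fs ! j) (wedge_d A U (del_nth j fs))))
     else scale_form (fact n) (of_logs (wedge_d A U) fs))"

definition omega_map ::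
    "('x::topological_space, 'd::finite) chart set \<Rightarrow> nat \<Rightarrow> nat \<Rightarrow> 'x set
      \<Rightarrow> (('x \<Rightarrow> complex) list \<Rightarrow>\<^sub>0 int) set \<Rightarrow> ('x, 'd) form"
  where "omega_map A n m U =
    (if m < n
     then ext_lift (m + 1) (hol_sections A U) (holomorphic_forms A m U) (omega_gen A n m U)
     else ext_lift n (hol_units A U) (holomorphic_forms A m U) (omega_gen A n m U))"

definition phi_map ::
    "('x::topological_space, 'd::finite) chart set \<Rightarrow> nat \<Rightarrow> nat \<Rightarrow> 'x set
      \<Rightarrow> (('x \<Rightarrow> complex) list \<Rightarrow>\<^sub>0 int) set \<Rightarrow> ('x, 'd) form"
  where "phi_map A n k U \<xi> = proj_form n (omega_map A n k U \<xi>)"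

definition re_part :: "('x \<Rightarrow> complex) \<Rightarrow> 'x \<Rightarrow> complex"
  where "re_part f = (\<lambda>x. of_real (Re (f x)))"

definition im_part :: "('x \<Rightarrow> complex) \<Rightarrow> 'x \<Rightarrow> complex"
  where "im_part f = (\<lambda>x. \<i> * of_real (Im (f x)))"

definition r_tilde ::
    "('x, 'd::finite) chart set \<Rightarrow> 'x set \<Rightarrow> ('x \<Rightarrow> complex) list \<Rightarrow> ('x, 'd) form"
  where "r_tilde A U fs = (let m = length fs in
    alt_sum (\<lambda>gs. \<Sum>j | 2 * j + 1 \<le> m.
      scale_form (1 / (fact (2 * j + 1) * fact (m - 2 * j - 1)))
        (fun_mult (re_part (hd gs))
          (wedge_d A U
            (map re_part (take (2 * j) (tl gs)) @ map im_part (drop (2 * j) (tl gs)))))) fs)"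

text \<open>Normalisation. With \<open>\<phi>\<close> as above, the homotopy identity forces the constant \<open>1\<close> for \<open>k < n\<close> and
  \<open>n!\<close> for \<open>k = n\<close>. The constant \<open>1/n!\<close> in both places does not give a homotopy: for \<open>n = 2\<close>,
  \<open>k = 1\<close> on the complex line, the element \<open>z \<and> 1\<close> would give \<open>0\<close> on the left-hand side of the
  identity, while \<open>\<phi>\<close> maps it to \<open>- i dy\<close>.\<close>

definition s_gen ::
    "('x, 'd::finite) chart set \<Rightarrow> nat \<Rightarrow> nat \<Rightarrow> 'x set \<Rightarrow> ('x \<Rightarrow> complex) list \<Rightarrow> ('x, 'd) form"
  where "s_gen A n k U fs =
    (if k < n
     then scale_form ((2 * of_real pi * \<i>) ^ (n - k - 1))
            (alt_sum (\<lambda>gs. fun_mult (im_part (hd gs)) (r_tilde A U (tl gs))) fs)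
     else scale_form (fact n) (of_logs (r_tilde A U) fs))"

definition s_map ::
    "('x::topological_space, 'd::finite) chart set \<Rightarrow> nat \<Rightarrow> nat \<Rightarrow> 'x set
      \<Rightarrow> (('x \<Rightarrow> complex) list \<Rightarrow>\<^sub>0 int) set \<Rightarrow> ('x, 'd) form"
  where "s_map A n k U =
    (if k < n
     then ext_lift (k + 1) (hol_sections A U) (smooth_forms A (n - 1) (k - 1) U) (s_gen A n k U)
     else ext_lift n (hol_units A U) (smooth_forms A (n - 1) (k - 1) U) (s_gen A n k U))"

definition presheaf_hom ::
    "('x::topological_space set \<Rightarrow> 'a monoid) \<Rightarrow> ('x set \<Rightarrow> 'x set \<Rightarrow> 'a \<Rightarrow> 'a) \<Rightarrow>
     ('x set \<Rightarrow> 'b monoid) \<Rightarrow> ('x set \<Rightarrow> 'x set \<Rightarrow> 'b \<Rightarrow> 'b) \<Rightarrow> ('x set \<Rightarrow> 'a \<Rightarrow> 'b) \<Rightarrow> bool"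
  where "presheaf_hom P resP Q resQ h \<longleftrightarrow>
    (\<forall>U. open U \<longrightarrow> h U \<in> hom (P U) (Q U)) \<and>
    (\<forall>U V. open U \<and> open V \<and> V \<subseteq> U \<longrightarrow>
       (\<forall>\<xi>\<in>carrier (P U). h V (resP U V \<xi>) = resQ U V (h U \<xi>)))"

end

theory Submission
  imports Defs "HOL-Complex_Analysis.Cauchy_Integral_Formula"
begin

text \<open>At a point, the forms in question are polynomials in the values \<open>a\<^sub>r = Re f\<^sub>r\<close>, \<open>b\<^sub>r = i Im f\<^sub>r\<close> and
  the differentials \<open>da\<^sub>r\<close>, \<open>db\<^sub>r\<close>. Write \<open>N(x; q)\<close> for the alternating sum of
  \<open>x\<^sub>0 da\<^sub>1 \<and> \<dots> \<and> da\<^sub>q \<and> db\<^sub>q\<^sub>+\<^sub>1 \<and> \<dots> \<and> db\<^sub>k\<close>; the positions of the \<open>da\<close> do not matter. Up to the common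
  factor \<open>(2 \<pi> i)\<^sup>n\<^sup>-\<^sup>k\<^sup>-\<^sup>1\<close>, expanding \<open>f\<^sub>0 df\<^sub>1 \<and> \<dots> \<and> df\<^sub>k\<close> and keeping the terms of the right parity turns
  \<open>\<phi>\<close> into the sum of the \<open>(k choose q) N(a; q)\<close> for even \<open>q\<close> and of the \<open>(k choose q) N(b; q)\<close> for odd \<open>q\<close>.
  The term \<open>s \<circ> \<delta>\<close> is the sum of the \<open>(k+1 choose 2j+1) N(a; 2j)\<close>, because only the summands with
  \<open>Im (2 \<pi> i)\<close> in front survive, and \<open>d \<circ> s\<close> is the sum of the
  \<open>(k choose 2j+1) (N(b; 2j+1) - N(a; 2j))\<close>, the sign coming from moving \<open>db\<^sub>0\<close> past \<open>a\<^sub>1\<close>. Pascal's rule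
  finishes the computation. Smoothness of holomorphic functions and the symmetry of second
  derivatives come from the Cauchy integral formula on complex lines.\<close>

section \<open>Alternating sums over permutations\<close>

text \<open>The binomial coefficients have two origins. In \<open>phi_map\<close> they count the
  choices of the q factors df that contribute da. In \<open>s_map\<close> they come from nesting: an
  alternation over k indices inside one over k + 1 multiplies by k!, which turns the weights
  1/((2j+1)! (k-2j-1)!) of \<open>r_tilde\<close> into k choose 2j+1. In top degree there is no
  outer alternation, and the factor n! in \<open>s_gen\<close> replaces it. Parity: (2 pi i)^(n-k-1)
  N(a; q) contains k - q imaginary differentials, so it lies in R(m) with m of the parity of n - 1 +
  q; the projection fixes R(n-1) and kills R(n). The maps are given by description on quotients.
  Each is first shown to come from an alternating map into its prescribed group; identities are then
  compared on wedges. Since \<open>ext_deriv\<close> is additive only on differentiable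
  coefficients, smoothness of \<open>s_map\<close> enters even the algebraic part. In top degree the
  obstacle is the logarithm. Undifferentiated, \<open>r_tilde\<close> uses only Re log F = ln |F|;
  all else is dF / F. Both are defined without a branch and additive in F.\<close>

definition asum :: "nat \<Rightarrow> ((nat \<Rightarrow> nat) \<Rightarrow> 'a::field_char_0) \<Rightarrow> 'a"
  where "asum k F = (\<Sum>\<sigma> | \<sigma> permutes {..<k}. of_int (sign \<sigma>) * F \<sigma>)"

lemma asum_cong:
  "(\<And>\<sigma>. \<sigma> permutes {..<k} \<Longrightarrow> F \<sigma> = G \<sigma>) \<Longrightarrow> asum k F = asum k G"
  unfolding asum_def by (intro sum.cong) auto

lemma asum_add: "asum k (\<lambda>\<sigma>. F \<sigma> + G \<sigma>) = asum k F + asum k G"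
  by (simp add: asum_def algebra_simps sum.distrib)

lemma asum_mult_left: "asum k (\<lambda>\<sigma>. c * F \<sigma>) = c * asum k F"
  by (simp add: asum_def sum_distrib_left algebra_simps)

lemma asum_sum: "asum k (\<lambda>\<sigma>. \<Sum>j\<in>J. F j \<sigma>) = (\<Sum>j\<in>J. asum k (F j))"
  unfolding asum_def sum_distrib_left by (rule sum.swap)

lemma sign_compose_permutes:
  "\<sigma> permutes {..<k::nat} \<Longrightarrow> \<tau> permutes {..<k} \<Longrightarrow> sign (\<sigma> \<circ> \<tau>) = sign \<sigma> * sign \<tau>"
  by (intro sign_compose permutes_imp_permutation) auto

lemma asum_compose_right:
  assumes "\<tau> permutes {..<k}"
  shows "asum k (\<lambda>\<sigma>. F (\<sigma> \<circ> \<tau>)) = of_int (sign \<tau>) * asum k F"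
proof -
  have "of_int (sign \<tau>) * asum k F =
    (\<Sum>\<sigma> | \<sigma> permutes {..<k}. of_int (sign \<tau>) * (of_int (sign (\<sigma> \<circ> \<tau>)) * F (\<sigma> \<circ> \<tau>)))"
    unfolding asum_def sum_distrib_left by (rule sum_permutations_compose_right[OF assms])
  also have "\<dots> = asum k (\<lambda>\<sigma>. F (\<sigma> \<circ> \<tau>))"
    unfolding asum_def
  proof (rule sum.cong[OF refl])
    fix \<sigma> assume "\<sigma> \<in> {\<sigma>. \<sigma> permutes {..<k}}"
    then have "(of_int (sign \<tau> * sign (\<sigma> \<circ> \<tau>)) :: 'a) = of_int (sign \<sigma>)"
      using sign_compose_permutes[OF _ assms] sign_idempotent[of \<tau>]
      by (simp add: mult.left_commute)
    then show "of_int (sign \<tau>) * (of_int (sign (\<sigma> \<circ> \<tau>)) * F (\<sigma> \<circ> \<tau>)) = of_int (sign \<sigma>) * F (\<sigma> \<circ> \<tau>)"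
      by (metis mult.assoc of_int_mult)
  qed
  finally show ?thesis ..
qed

text \<open>Pairing each permutation with its product by the transposition makes the sum its own
  negative, so it vanishes in characteristic 0.\<close>

lemma asum_eq_0:
  fixes F :: "(nat \<Rightarrow> nat) \<Rightarrow> 'a::field_char_0"
  assumes "i < k" "j < k" "i \<noteq> j"
    and "\<And>\<sigma>. \<sigma> permutes {..<k} \<Longrightarrow> F (\<sigma> \<circ> Transposition.transpose i j) = F \<sigma>"
  shows "asum k F = 0"
proof -
  have "Transposition.transpose i j permutes {..<k}"
    using assms by (intro permutes_swap_id) auto
  from asum_compose_right[OF this, of F]
  have "asum k F = - asum k F"
    using assms by (simp add: sign_swap_id asum_cong[of k "\<lambda>\<sigma>. F (\<sigma> \<circ> Transposition.transpose i j)" F])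
  then show ?thesis
    by (simp add: eq_neg_iff_add_eq_0)
qed

section \<open>Permutations of k + 1 indices by cosets of the stabiliser of 0\<close>

definition lift_perm :: "(nat \<Rightarrow> nat) \<Rightarrow> nat \<Rightarrow> nat"
  where "lift_perm \<rho> = case_nat 0 (\<lambda>i. Suc (\<rho> i))"

lemma lift_perm_simps [simp]: "lift_perm \<rho> 0 = 0" "lift_perm \<rho> (Suc i) = Suc (\<rho> i)"
  by (simp_all add: lift_perm_def)

lemma lift_perm_id [simp]: "lift_perm id = id"
  by (auto simp: lift_perm_def fun_eq_iff split: nat.split)

lemma lift_perm_transpose: "lift_perm (Transposition.transpose a b \<circ> \<rho>) = Transposition.transpose (Suc a) (Suc b) \<circ> lift_perm \<rho>"
  by (auto simp: lift_perm_def fun_eq_iff Transposition.transpose_def split: nat.split)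

lemma lift_perm_permutes:
  assumes "\<rho> permutes {..<k}"
  shows "lift_perm \<rho> permutes {..<Suc k}"
proof (rule bij_imp_permutes)
  have "inj_on (lift_perm \<rho>) {..<Suc k}"
  proof (rule inj_onI)
    fix x y assume "lift_perm \<rho> x = lift_perm \<rho> y"
    then show "x = y"
      using injD[OF permutes_inj[OF assms], of "x - 1" "y - 1"] by (cases x; cases y) simp_all
  qed
  moreover have "lift_perm \<rho> ` {..<Suc k} \<subseteq> {..<Suc k}"
  proof clarify
    fix i assume "i < Suc k"
    then show "lift_perm \<rho> i < Suc k"
      using permutes_in_image[OF assms, of "i - 1"] by (cases i) simp_all
  qed
  ultimately show "bij_betw (lift_perm \<rho>) {..<Suc k} {..<Suc k}"
    by (simp add: bij_betw_def endo_inj_surj)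
next
  fix x assume "x \<notin> {..<Suc k}"
  then show "lift_perm \<rho> x = x"
    using permutes_not_in[OF assms] by (cases x) auto
qed

text \<open>Lifting turns a leading transposition into the transposition of the successors, so
  induction over transpositions keeps the two signs equal.\<close>

lemma sign_lift_perm:
  assumes "\<rho> permutes {..<k}" shows "sign (lift_perm \<rho>) = sign \<rho>"
  using assms finite_lessThan[of k]
proof (induction rule: permutes_induct)
  case id
  show ?case unfolding lift_perm_id ..
next
  case (swap a b p)
  have "permutation (lift_perm p)"
    using lift_perm_permutes[OF swap(4)] by (rule permutes_imp_permutation[rotated]) simp
  moreover have "permutation p"
    using swap(4) by (rule permutes_imp_permutation[rotated]) simp
  ultimately show ?case
    unfolding lift_perm_transpose using swap
    by (subst (1 2) sign_compose) (simp_all add: permutation_swap_id sign_swap_id)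
qed

text \<open>The cycle that sends 0 to j and moves 1, ..., j down by one, so that
  \<open>cyc j (Suc i)\<close> lists the indices other than j in increasing order. As a product of j
  adjacent transpositions it has sign (-1)^j. These cycles represent the cosets of the stabiliser of
  0.\<close>

primrec cyc :: "nat \<Rightarrow> nat \<Rightarrow> nat" where
  "cyc 0 = id"
| "cyc (Suc j) = Transposition.transpose j (Suc j) \<circ> cyc j"

lemma cyc_apply: "cyc j i = (if i = 0 then j else if i \<le> j then i - 1 else i)"
  by (induction j) (auto simp: Transposition.transpose_def)

lemma cyc_zero [simp]: "cyc j 0 = j"
  by (simp add: cyc_apply)

lemma cyc_permutes: "j < n \<Longrightarrow> cyc j permutes {..<n}"
  by (induction j) (auto intro!: permutes_compose permutes_swap_id simp: permutes_id)

lemma sign_cyc: "sign (cyc j) = (-1) ^ j"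
proof (induction j)
  case (Suc j)
  have "permutation (cyc j)"
    using cyc_permutes[of j "Suc j"] by (rule permutes_imp_permutation[rotated]) simp_all
  with Suc show ?case
    unfolding cyc.simps by (subst sign_compose) (simp_all add: permutation_swap_id sign_swap_id)
qed (simp add: sign_id)

lemma bij_betw_cyc_lift_perm:
  "bij_betw (\<lambda>(j, \<rho>). cyc j \<circ> lift_perm \<rho>) ({..k} \<times> {\<rho>. \<rho> permutes {..<k}}) {\<sigma>. \<sigma> permutes {..<Suc k}}"
proof -
  let ?f = "\<lambda>(j, \<rho>). cyc j \<circ> lift_perm \<rho>"
  let ?P = "{..k} \<times> {\<rho>. \<rho> permutes {..<k}}"
  have inj: "inj_on ?f ?P"
  proof (rule inj_onI, clarsimp)
    fix j \<rho> j' \<rho>'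
    assume *: "j \<le> k" "j' \<le> k" and eq: "cyc j \<circ> lift_perm \<rho> = cyc j' \<circ> lift_perm \<rho>'"
    from fun_cong[OF eq, of 0] have j: "j = j'" by (simp add: cyc_apply)
    have "inj (cyc j)" using cyc_permutes[of j "Suc k"] * permutes_inj by auto
    then have "lift_perm \<rho> x = lift_perm \<rho>' x" for x
      using fun_cong[OF eq, of x] j by (simp add: inj_eq)
    from this[of "Suc _"] have "\<rho> = \<rho>'" by (simp add: fun_eq_iff)
    with j show "j = j' \<and> \<rho> = \<rho>'" by simp
  qed
  have sub: "?f ` ?P \<subseteq> {\<sigma>. \<sigma> permutes {..<Suc k}}"
    by (auto intro!: permutes_compose lift_perm_permutes cyc_permutes)
  \<comment> \<open>Surjectivity is a count: (k + 1) k! = (k + 1)!.\<close>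
  have "card (?f ` ?P) = card {\<sigma>. \<sigma> permutes {..<Suc k}}"
    unfolding card_image[OF inj] by (simp add: card_cartesian_product card_permutations[OF refl])
  then have "?f ` ?P = {\<sigma>. \<sigma> permutes {..<Suc k}}"
    using sub by (intro card_subset_eq) (auto simp: finite_permutations)
  with inj show ?thesis by (simp add: bij_betw_def)
qed

text \<open>The permutations are grouped by the index j that they place in slot 0. The same
  expansion gives the Laplace expansion of determinants, the alternating sum over omitted vectors in
  \<open>dop\<close>, and the position of the constant 2 pi i in
  \<open>s_gen_Cons_const\<close>.\<close>

lemma asum_Suc:
  "asum (Suc k) F = (\<Sum>j\<le>k. (-1) ^ j * asum k (\<lambda>\<rho>. F (cyc j \<circ> lift_perm \<rho>)))"
proof -
  have "asum (Suc k) F = (\<Sum>(j, \<rho>)\<in>{..k} \<times> {\<rho>. \<rho> permutes {..<k}}.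
      of_int (sign (cyc j \<circ> lift_perm \<rho>)) * F (cyc j \<circ> lift_perm \<rho>))"
    unfolding asum_def sum.reindex_bij_betw[OF bij_betw_cyc_lift_perm, symmetric]
    by (simp add: case_prod_beta)
  also have "\<dots> = (\<Sum>(j, \<rho>)\<in>{..k} \<times> {\<rho>. \<rho> permutes {..<k}}.
      (-1) ^ j * (of_int (sign \<rho>) * F (cyc j \<circ> lift_perm \<rho>)))"
  proof (intro sum.cong refl)
    fix x assume "x \<in> {..k} \<times> {\<rho>. \<rho> permutes {..<k}}"
    then obtain j \<rho> where x: "x = (j, \<rho>)" and "j \<le> k" and \<rho>: "\<rho> permutes {..<k}"
      by auto
    then have "sign (cyc j \<circ> lift_perm \<rho>) = (-1) ^ j * sign \<rho>"
      by (subst sign_compose_permutes[of _ "Suc k"])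
        (auto intro!: cyc_permutes lift_perm_permutes simp: sign_cyc sign_lift_perm[OF \<rho>])
    then show "(case x of (j, \<rho>) \<Rightarrow> of_int (sign (cyc j \<circ> lift_perm \<rho>)) * F (cyc j \<circ> lift_perm \<rho>)) =
      (case x of (j, \<rho>) \<Rightarrow> (-1) ^ j * (of_int (sign \<rho>) * F (cyc j \<circ> lift_perm \<rho>)))"
      unfolding x prod.case by (simp only: of_int_mult of_int_power of_int_minus of_int_1 mult.assoc)
  qed
  also have "\<dots> = (\<Sum>j\<le>k. (-1) ^ j * asum k (\<lambda>\<rho>. F (cyc j \<circ> lift_perm \<rho>)))"
    unfolding asum_def sum_distrib_left sum.cartesian_product ..
  finally show ?thesis .
qed

lemma sum_of_int_sign_square:
  "(\<Sum>\<tau> | \<tau> permutes {..<k::nat}. of_int (sign \<tau>) * (of_int (sign \<tau>) * c)) = fact k * (c :: 'a::field_char_0)"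
proof -
  have "(of_int (sign \<tau>) * (of_int (sign \<tau>) * c)) = c" for \<tau> :: "nat \<Rightarrow> nat"
    by (simp add: sign_def)
  then show ?thesis
    by (simp only: sum_constant card_permutations[OF refl finite_lessThan] card_lessThan of_nat_fact)
qed

text \<open>For each inner \<tau>, substitution in the outer sum yields a second factor
  \<open>sign \<tau>\<close>; the signs square to 1 and k! equal terms remain. This factorial
  cancels against the denominators in \<open>r_tilde\<close>.\<close>

lemma asum_lift_perm:
  "asum (Suc k) (\<lambda>\<sigma>. asum k (\<lambda>\<tau>. F (\<sigma> \<circ> lift_perm \<tau>))) = fact k * asum (Suc k) F"
proof -
  have "asum (Suc k) (\<lambda>\<sigma>. asum k (\<lambda>\<tau>. F (\<sigma> \<circ> lift_perm \<tau>))) =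
     (\<Sum>\<tau> | \<tau> permutes {..<k}. of_int (sign \<tau>) * asum (Suc k) (\<lambda>\<sigma>. F (\<sigma> \<circ> lift_perm \<tau>)))"
    by (subst (2) asum_def) (simp only: asum_sum asum_mult_left)
  also have "\<dots> = (\<Sum>\<tau> | \<tau> permutes {..<k}. of_int (sign \<tau>) * (of_int (sign \<tau>) * asum (Suc k) F))"
    by (intro sum.cong refl arg_cong2[where f="(*)"])
      (simp add: asum_compose_right[OF lift_perm_permutes] sign_lift_perm)
  finally show ?thesis by (simp only: sum_of_int_sign_square)
qed

section \<open>Determinants and their alternating sums\<close>

lemma prod_permutes:
  assumes "\<rho> permutes {..<k::nat}"
  shows "(\<Prod>i<k. g (\<rho> i)) = (\<Prod>i<k. g i)"
  using prod.permute[OF assms, of g] by (simp add: o_def)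

text \<open>The Leibniz determinant, kept in the same \<open>asum\<close> calculus as the
  alternation over functions. Rows belong to differentials, columns to tangent vectors.\<close>

definition detv :: "nat \<Rightarrow> (nat \<Rightarrow> nat \<Rightarrow> 'a::field_char_0) \<Rightarrow> 'a"
  where "detv k G = asum k (\<lambda>\<tau>. \<Prod>i<k. G i (\<tau> i))"

lemma detv_cong:
  assumes "\<And>i l. i < k \<Longrightarrow> l < k \<Longrightarrow> G i l = G' i l"
  shows "detv k G = detv k G'"
  unfolding detv_def
proof (intro asum_cong prod.cong refl)
  fix \<sigma> x assume "\<sigma> permutes {..<k}" "x \<in> {..<k}"
  then show "G x (\<sigma> x) = G' x (\<sigma> x)"
    using assms permutes_in_image by fastforce
qed

lemma detv_permute_rows:
  assumes "\<rho> permutes {..<k}"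
  shows "detv k (\<lambda>i. G (\<rho> i)) = of_int (sign \<rho>) * detv k G"
proof -
  have "detv k G = asum k (\<lambda>\<tau>. \<Prod>i<k. G (\<rho> i) (\<tau> (\<rho> i)))"
    unfolding detv_def
  proof (intro asum_cong)
    show "(\<Prod>i<k. G i (\<tau> i)) = (\<Prod>i<k. G (\<rho> i) (\<tau> (\<rho> i)))" for \<tau>
      using prod_permutes[OF assms, of "\<lambda>i. G i (\<tau> i)"] by simp
  qed
  also have "\<dots> = of_int (sign \<rho>) * detv k (\<lambda>i. G (\<rho> i))"
    unfolding detv_def using asum_compose_right[OF assms, of "\<lambda>\<tau>. \<Prod>i<k. G (\<rho> i) (\<tau> i)"] by simp
  finally show ?thesis
    by (simp add: sign_def)
qed

lemma detv_Suc:
  "detv (Suc k) G = (\<Sum>j\<le>k. (-1) ^ j * (G 0 j * detv k (\<lambda>i l. G (Suc i) (cyc j (Suc l)))))"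
  unfolding detv_def asum_Suc asum_mult_left[symmetric]
  by (simp add: prod.lessThan_Suc_shift del: prod.lessThan_Suc)

text \<open>For functions \<open>f\<^sub>0, \<dots>, f\<^sub>k\<close> near a point and vectors \<open>v\<^sub>0, \<dots>, v\<^sub>k\<^sub>-\<^sub>1\<close>, let \<open>x r\<close> be the value of
  \<open>Re f\<^sub>r\<close> or \<open>Im f\<^sub>r\<close> and \<open>\<gamma> i r l\<close> the value of \<open>d Re f\<^sub>r\<close> or \<open>d Im f\<^sub>r\<close> on \<open>v\<^sub>l\<close>. Then \<open>mix\<close> is the value of a
  form such as \<open>Alt (Re f\<^sub>0 d Re f\<^sub>1 \<and> \<dots> \<and> d Im f\<^sub>k)\<close> on the vectors. As the sum runs over rows and
  columns, it is symmetric in the choices \<open>\<gamma> i\<close> of real or imaginary part, so it depends only on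
  how many of them are real.\<close>

definition mix :: "nat \<Rightarrow> (nat \<Rightarrow> 'a) \<Rightarrow> (nat \<Rightarrow> nat \<Rightarrow> nat \<Rightarrow> 'a::field_char_0) \<Rightarrow> 'a"
  where "mix k x \<gamma> = asum (Suc k) (\<lambda>\<sigma>. x (\<sigma> 0) * detv k (\<lambda>i. \<gamma> i (\<sigma> (Suc i))))"

lemma mix_cong:
  assumes "\<And>i r l. i < k \<Longrightarrow> r \<le> k \<Longrightarrow> l < k \<Longrightarrow> \<gamma> i r l = \<gamma>' i r l"
    and "\<And>r. r \<le> k \<Longrightarrow> x r = x' r"
  shows "mix k x \<gamma> = mix k x' \<gamma>'"
  unfolding mix_def
proof (intro asum_cong)
  fix \<sigma> assume \<sigma>: "\<sigma> permutes {..<Suc k}"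
  have "\<sigma> i \<le> k" if "i \<le> k" for i
    using permutes_in_image[OF \<sigma>, of i] that by simp
  then show "x (\<sigma> 0) * detv k (\<lambda>i. \<gamma> i (\<sigma> (Suc i))) = x' (\<sigma> 0) * detv k (\<lambda>i. \<gamma>' i (\<sigma> (Suc i)))"
    using assms by (intro arg_cong2[where f="(*)"] detv_cong) auto
qed

text \<open>Two signs cancel: reindexing the outer sum by \<open>lift_perm \<rho>\<close> and
  permuting the rows of the determinant each cost \<open>sign \<rho>\<close>.\<close>

lemma mix_permute:
  assumes \<rho>: "\<rho> permutes {..<k}"
  shows "mix k x (\<lambda>i. \<gamma> (\<rho> i)) = mix k x \<gamma>"
proof -
  have "of_int (sign \<rho>) * mix k x (\<lambda>i. \<gamma> (\<rho> i)) =
    asum (Suc k) (\<lambda>\<sigma>. x (\<sigma> 0) * detv k (\<lambda>i. \<gamma> (\<rho> i) (\<sigma> (Suc (\<rho> i)))))"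
    unfolding mix_def sign_lift_perm[OF \<rho>, symmetric]
    by (subst asum_compose_right[OF lift_perm_permutes[OF \<rho>], symmetric]) simp
  also have "\<dots> = of_int (sign \<rho>) * mix k x \<gamma>"
    unfolding mix_def asum_mult_left[symmetric]
    by (intro asum_cong) (simp add: detv_permute_rows[OF \<rho>, of "\<lambda>i. \<gamma> i (_ (Suc i))"] mult.left_commute)
  finally show ?thesis
    by (simp add: sign_def split: if_splits)
qed

lemma ex_permutes_initial_segment:
  assumes "S \<subseteq> {..<k::nat}"
  obtains \<rho> where "\<rho> permutes {..<k}" "\<And>i. i < k \<Longrightarrow> \<rho> i < card S \<longleftrightarrow> i \<in> S"
proof -
  have fin: "finite S" using assms finite_subset by auto
  have ck: "card S \<le> k" using card_mono[OF _ assms] by simp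
  obtain h where h: "bij_betw h S {..<card S}"
    using ex_bij_betw_finite_nat[OF fin] atLeast0LessThan by auto
  have "card ({..<k} - S) = card {card S..<k}"
    using assms fin by (simp add: card_Diff_subset)
  then obtain h' where h': "bij_betw h' ({..<k} - S) {card S..<k}"
    using finite_same_card_bij[of "{..<k} - S" "{card S..<k}"] by auto
  \<comment> \<open>Glued from a bijection of S onto the first \<open>card S\<close> indices and one
    of the complement onto the remaining ones.\<close>
  define \<rho> where "\<rho> = (\<lambda>i. if i \<in> S then h i else if i < k then h' i else i)"
  have "bij_betw \<rho> S {..<card S}"
    using h by (rule iffD1[OF bij_betw_cong, rotated]) (simp add: \<rho>_def)
  moreover have "bij_betw \<rho> ({..<k} - S) {card S..<k}"
    using h' by (rule iffD1[OF bij_betw_cong, rotated]) (simp add: \<rho>_def)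
  ultimately have "bij_betw \<rho> (S \<union> ({..<k} - S)) ({..<card S} \<union> {card S..<k})"
    by (rule bij_betw_combine) auto
  moreover have "S \<union> ({..<k} - S) = {..<k}" "{..<card S} \<union> {card S..<k} = {..<k}"
    using assms ck by auto
  ultimately have "bij_betw \<rho> {..<k} {..<k}" by simp
  then have "\<rho> permutes {..<k}"
    by (rule bij_imp_permutes) (use assms in \<open>auto simp: \<rho>_def\<close>)
  moreover have "\<rho> i < card S \<longleftrightarrow> i \<in> S" if "i < k" for i
  proof (cases "i \<in> S")
    case True
    then show ?thesis using bij_betw_apply[OF h, of i] by (simp add: \<rho>_def)
  next
    case False
    then show ?thesis using bij_betw_apply[OF h', of i] that by (simp add: \<rho>_def)
  qed
  ultimately show ?thesis using that by blast
qed

lemma mix_subset: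
  assumes "S \<subseteq> {..<k}"
  shows "mix k x (\<lambda>i. if i \<in> S then \<alpha> else \<beta>) = mix k x (\<lambda>i. if i < card S then \<alpha> else \<beta>)"
proof -
  obtain \<rho> where \<rho>: "\<rho> permutes {..<k}" "\<And>i. i < k \<Longrightarrow> \<rho> i < card S \<longleftrightarrow> i \<in> S"
    using ex_permutes_initial_segment[OF assms] by blast
  show ?thesis
    unfolding mix_permute[OF \<rho>(1), of x "\<lambda>i. if i < card S then \<alpha> else \<beta>", symmetric]
    by (rule mix_cong) (simp_all add: \<rho>(2))
qed

lemma detv_add_rows:
  "detv k (\<lambda>i l. A i l + B i l) = (\<Sum>S\<in>Pow {..<k}. detv k (\<lambda>i. if i \<in> S then A i else B i))"
proof -
  have "(\<Prod>i<k. A i (\<tau> i) + B i (\<tau> i)) =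
    (\<Sum>S\<in>Pow {..<k}. \<Prod>i<k. (if i \<in> S then A i else B i) (\<tau> i))" for \<tau>
    unfolding prod_add[OF finite_lessThan]
  proof (intro sum.cong refl)
    fix S assume "S \<in> Pow {..<k}"
    then have "(\<Prod>i<k. (if i \<in> S then A i else B i) (\<tau> i)) =
      (\<Prod>i\<in>S. (if i \<in> S then A i else B i) (\<tau> i)) * (\<Prod>i\<in>{..<k} - S. (if i \<in> S then A i else B i) (\<tau> i))"
      by (subst prod.subset_diff[of S "{..<k}"]) (auto simp: mult.commute)
    then show "(\<Prod>i\<in>S. A i (\<tau> i)) * (\<Prod>i\<in>{..<k} - S. B i (\<tau> i)) =
      (\<Prod>i<k. (if i \<in> S then A i else B i) (\<tau> i))"
      by simp
  qed
  then show ?thesis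
    by (simp add: detv_def asum_sum)
qed



text \<open>Multilinearity in the rows gives one term for each set of rows taken from \<alpha>; its
  value depends only on the size q of the set, and there are k choose q such sets.\<close>

lemma mix_binomial:
  "mix k x (\<lambda>i r l. \<alpha> r l + \<beta> r l) =
    (\<Sum>q\<le>k. of_nat (k choose q) * mix k x (\<lambda>i. if i < q then \<alpha> else \<beta>))"
proof -
  have "mix k x (\<lambda>i r l. \<alpha> r l + \<beta> r l) =
    (\<Sum>S\<in>Pow {..<k}. mix k x (\<lambda>i. if i \<in> S then \<alpha> else \<beta>))"
    unfolding mix_def detv_add_rows sum_distrib_left asum_sum
    by (intro sum.cong refl asum_cong arg_cong2[where f="(*)"] detv_cong) auto
  also have "\<dots> = (\<Sum>S\<in>Pow {..<k}. mix k x (\<lambda>i. if i < card S then \<alpha> else \<beta>))"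
    by (intro sum.cong refl mix_subset) auto
  also have "\<dots> = (\<Sum>q\<le>k. \<Sum>S\<in>{S \<in> Pow {..<k}. card S = q}. mix k x (\<lambda>i. if i < card S then \<alpha> else \<beta>))"
    by (rule sum.group[symmetric]) (auto intro: order_trans[OF card_mono[of "{..<k}"]])
  also have "\<dots> = (\<Sum>q\<le>k. of_nat (k choose q) * mix k x (\<lambda>i. if i < q then \<alpha> else \<beta>))"
    by (simp add: n_subsets)
  finally show ?thesis .
qed

lemma mix_add_left: "mix k (\<lambda>r. x r + y r) \<gamma> = mix k x \<gamma> + mix k y \<gamma>"
  by (simp add: mix_def distrib_right asum_add)

text \<open>Once j is in slot 0, the k! orderings of the other indices all contribute the same
  signed determinant. This is the origin of the factor m! in \<open>omega_gen\<close>.\<close>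

lemma mix_laplace:
  "mix k x (\<lambda>i. \<gamma>) = fact k * (\<Sum>j\<le>k. (-1) ^ j * (x j * detv k (\<lambda>i. \<gamma> (cyc j (Suc i)))))"
proof -
  have "mix k x (\<lambda>i. \<gamma>) =
    (\<Sum>j\<le>k. (-1) ^ j * (x j * asum k (\<lambda>\<rho>. detv k (\<lambda>i. \<gamma> (cyc j (Suc (\<rho> i)))))))"
    unfolding mix_def asum_Suc asum_mult_left[symmetric] by simp
  also have "\<dots> = (\<Sum>j\<le>k. (-1) ^ j * (x j * (fact k * detv k (\<lambda>i. \<gamma> (cyc j (Suc i))))))"
  proof (intro sum.cong refl arg_cong2[where f="(*)"])
    fix j
    have "asum k (\<lambda>\<rho>. detv k (\<lambda>i. \<gamma> (cyc j (Suc (\<rho> i))))) =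
      (\<Sum>\<rho> | \<rho> permutes {..<k}. of_int (sign \<rho>) * (of_int (sign \<rho>) * detv k (\<lambda>i. \<gamma> (cyc j (Suc i)))))"
      unfolding asum_def
      by (intro sum.cong refl) (simp add: detv_permute_rows[of _ k "\<lambda>i. \<gamma> (cyc j (Suc i))"])
    then show "asum k (\<lambda>\<rho>. detv k (\<lambda>i. \<gamma> (cyc j (Suc (\<rho> i))))) = fact k * detv k (\<lambda>i. \<gamma> (cyc j (Suc i)))"
      by (simp only: sum_of_int_sign_square)
  qed
  finally show ?thesis
    by (simp add: sum_distrib_left mult_ac)
qed

text \<open>Exchanging slots 0 and 1 of the permutation brings the undifferentiated factor back to
  slot 0 and costs the sign. Slot 1 exists because k > 0.\<close>

lemma mix_swap:
  assumes "k > 0"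
  shows "asum (Suc k) (\<lambda>\<sigma>. x (\<sigma> 1) * detv k (case_nat (\<beta> (\<sigma> 0)) (\<lambda>i. \<gamma> i (\<sigma> (Suc (Suc i)))))) =
    - mix k x (case_nat \<beta> \<gamma>)"
proof -
  have "Transposition.transpose 0 1 permutes {..<Suc k}"
    using assms by (intro permutes_swap_id) auto
  from asum_compose_right[OF this, of "\<lambda>\<sigma>. x (\<sigma> 1) * detv k (case_nat (\<beta> (\<sigma> 0)) (\<lambda>i. \<gamma> i (\<sigma> (Suc (Suc i)))))"]
  have "asum (Suc k) (\<lambda>\<sigma>. x (\<sigma> 1) * detv k (case_nat (\<beta> (\<sigma> 0)) (\<lambda>i. \<gamma> i (\<sigma> (Suc (Suc i)))))) =
    - asum (Suc k) (\<lambda>\<sigma>. x (\<sigma> 0) * detv k (case_nat (\<beta> (\<sigma> 1)) (\<lambda>i. \<gamma> i (\<sigma> (Suc (Suc i))))))"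
    by (simp add: sign_swap_id o_def Transposition.transpose_def)
  also have "asum (Suc k) (\<lambda>\<sigma>. x (\<sigma> 0) * detv k (case_nat (\<beta> (\<sigma> 1)) (\<lambda>i. \<gamma> i (\<sigma> (Suc (Suc i)))))) = mix k x (case_nat \<beta> \<gamma>)"
    unfolding mix_def
    by (intro asum_cong arg_cong2[where f="(*)"] detv_cong refl) (auto split: nat.split)
  finally show ?thesis .
qed

text \<open>With one imaginary row in front, the real rows are those numbered 1, ..., q; since only
  their number matters, they may be moved back to 0, ..., q - 1. The bound q < k leaves room for the
  row in front.\<close>

lemma mix_case_last:
  assumes "q < k"
  shows "mix k x (case_nat \<beta> (\<lambda>i. if i < q then \<alpha> else \<beta>)) = mix k x (\<lambda>i. if i < q then \<alpha> else \<beta>)"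
proof -
  have "mix k x (case_nat \<beta> (\<lambda>i. if i < q then \<alpha> else \<beta>)) = mix k x (\<lambda>i. if i \<in> {1..q} then \<alpha> else \<beta>)"
    by (intro mix_cong) (auto split: nat.split)
  also have "\<dots> = mix k x (\<lambda>i. if i < card {1..q} then \<alpha> else \<beta>)"
    using assms by (intro mix_subset) auto
  finally show ?thesis by simp
qed

text \<open>The closedness of exact forms: second derivatives are symmetric, signs are not.\<close>

lemma asum_symmetric_eq_0:
  fixes H :: "nat \<Rightarrow> nat \<Rightarrow> nat \<Rightarrow> 'a::field_char_0"
  assumes "\<And>m a b. m < k \<Longrightarrow> a \<le> k \<Longrightarrow> b \<le> k \<Longrightarrow> H m a b = H m b a"
  shows "asum (Suc k) (\<lambda>\<sigma>. \<Sum>m<k. H m (\<sigma> 0) (\<sigma> (Suc m)) * (\<Prod>i\<in>{..<k} - {m}. G i (\<sigma> (Suc i)))) = 0"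
  unfolding asum_sum
proof (intro sum.neutral ballI)
  fix m assume m: "m \<in> {..<k}"
  show "asum (Suc k) (\<lambda>\<sigma>. H m (\<sigma> 0) (\<sigma> (Suc m)) * (\<Prod>i\<in>{..<k} - {m}. G i (\<sigma> (Suc i)))) = 0"
  proof (rule asum_eq_0[of 0 _ "Suc m"])
    fix \<sigma> assume \<sigma>: "\<sigma> permutes {..<Suc k}"
    have "\<sigma> 0 \<le> k" "\<sigma> (Suc m) \<le> k"
      using permutes_in_image[OF \<sigma>, of 0] permutes_in_image[OF \<sigma>, of "Suc m"] m by auto
    then have "H m (\<sigma> (Suc m)) (\<sigma> 0) = H m (\<sigma> 0) (\<sigma> (Suc m))"
      using assms m by auto
    \<comment> \<open>Only slots 0 and m + 1 are exchanged, and slot m + 1 belongs to the factor i =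
      m that the product omits.\<close>
    moreover have "(\<Prod>i\<in>{..<k} - {m}. G i (\<sigma> (Transposition.transpose 0 (Suc m) (Suc i)))) =
      (\<Prod>i\<in>{..<k} - {m}. G i (\<sigma> (Suc i)))"
      by (intro prod.cong refl) (auto simp: Transposition.transpose_def)
    ultimately show "H m ((\<sigma> \<circ> Transposition.transpose 0 (Suc m)) 0) ((\<sigma> \<circ> Transposition.transpose 0 (Suc m)) (Suc m)) *
        (\<Prod>i\<in>{..<k} - {m}. G i ((\<sigma> \<circ> Transposition.transpose 0 (Suc m)) (Suc i))) =
      H m (\<sigma> 0) (\<sigma> (Suc m)) * (\<Prod>i\<in>{..<k} - {m}. G i (\<sigma> (Suc i)))"
      by simp
  qed (use m in auto)
qed

section \<open>Exterior powers\<close>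

text \<open>What the universal property of \<open>ext_power\<close> asks of a map on tuples. Both
  groups keep their own operation: G may be the multiplicative group of units, and H an exterior
  power, a group of forms or the complex numbers under addition.\<close>

definition alternating_map ::
    "nat \<Rightarrow> ('a, 'b) monoid_scheme \<Rightarrow> ('c, 'e) monoid_scheme \<Rightarrow> ('a list \<Rightarrow> 'c) \<Rightarrow> bool"
  where "alternating_map k G H F \<longleftrightarrow>
    (\<forall>xs\<in>tuples k G. F xs \<in> carrier H) \<and>
    (\<forall>xs\<in>tuples k G. \<forall>i<k. \<forall>x\<in>carrier G. \<forall>y\<in>carrier G.
       F (xs[i := x \<otimes>\<^bsub>G\<^esub> y]) = F (xs[i := x]) \<otimes>\<^bsub>H\<^esub> F (xs[i := y])) \<and>
    (\<forall>xs\<in>tuples k G. \<forall>i j. i < j \<longrightarrow> j < k \<longrightarrow> xs ! i = xs ! j \<longrightarrow> F xs = \<one>\<^bsub>H\<^esub>)"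

lemma alternating_mapD:
  assumes "alternating_map k G H F" "xs \<in> tuples k G"
  shows "F xs \<in> carrier H"
    and "i < k \<Longrightarrow> x \<in> carrier G \<Longrightarrow> y \<in> carrier G \<Longrightarrow>
      F (xs[i := x \<otimes>\<^bsub>G\<^esub> y]) = F (xs[i := x]) \<otimes>\<^bsub>H\<^esub> F (xs[i := y])"
    and "i < j \<Longrightarrow> j < k \<Longrightarrow> xs ! i = xs ! j \<Longrightarrow> F xs = \<one>\<^bsub>H\<^esub>"
  using assms unfolding alternating_map_def by blast+

lemma tuples_update: "xs \<in> tuples k G \<Longrightarrow> x \<in> carrier G \<Longrightarrow> xs[i := x] \<in> tuples k G"
  using set_update_subset_insert[of xs i x] by (auto simp: tuples_def)

lemma ext_relators_carrier:
  assumes "monoid G"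
  shows "ext_relators k G \<subseteq> carrier (free_Abelian_group (tuples k G))"
proof -
  interpret monoid G by fact
  interpret F: group "free_Abelian_group (tuples k G)" by simp
  have *: "a \<in> tuples k G \<Longrightarrow> b \<in> tuples k G \<Longrightarrow> c \<in> tuples k G \<Longrightarrow>
      Poly_Mapping.keys (frag_of a - frag_of b - frag_of c) \<subseteq> tuples k G" for a b c
    by (intro order_trans[OF keys_diff] Un_least) auto
  show ?thesis
  proof
    fix r assume "r \<in> ext_relators k G"
    then consider xs i x y where "xs \<in> tuples k G" "i < k" "x \<in> carrier G" "y \<in> carrier G"
        "r = frag_of (xs[i := x \<otimes>\<^bsub>G\<^esub> y]) - frag_of (xs[i := x]) - frag_of (xs[i := y])"
      | xs where "xs \<in> tuples k G" "r = frag_of xs"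
      unfolding ext_relators_def by blast
    then show "r \<in> carrier (free_Abelian_group (tuples k G))"
    proof cases
      case 1
      then show ?thesis
        unfolding carrier_free_Abelian_group_iff \<open>r = _\<close> by (intro * tuples_update m_closed)
    qed simp
  qed
qed

lemma ext_ker_subgroup:
  assumes "monoid G"
  shows "subgroup (ext_ker k G) (free_Abelian_group (tuples k G))"
  unfolding ext_ker_def
  by (rule group.generate_is_subgroup[OF group_free_Abelian_group ext_relators_carrier[OF assms]])

lemma ext_ker_normal:
  assumes "monoid G"
  shows "ext_ker k G \<lhd> free_Abelian_group (tuples k G)"
  using ext_ker_subgroup[OF assms] abelian_free_Abelian_group comm_group.subgroup_imp_normal by blast

lemma comm_group_ext_power:
  "monoid G \<Longrightarrow> comm_group (ext_power k G)"
  unfolding ext_power_def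
  by (rule comm_group.abelian_FactGroup[OF abelian_free_Abelian_group ext_ker_subgroup])

lemma ext_coset_hom:
  assumes "monoid G"
  shows "(\<lambda>a. ext_ker k G #>\<^bsub>free_Abelian_group (tuples k G)\<^esub> a)
    \<in> hom (free_Abelian_group (tuples k G)) (ext_power k G)"
  unfolding ext_power_def by (rule normal.r_coset_hom_Mod[OF ext_ker_normal[OF assms]])

lemma carrier_ext_powerE:
  assumes "\<xi> \<in> carrier (ext_power k G)"
  obtains a where "a \<in> carrier (free_Abelian_group (tuples k G))"
    "\<xi> = ext_ker k G #>\<^bsub>free_Abelian_group (tuples k G)\<^esub> a"
  using assms unfolding ext_power_def carrier_FactGroup by auto

lemma ext_wedge_eq:
  "xs \<in> tuples k G \<Longrightarrow> ext_wedge G xs = ext_ker k G #>\<^bsub>free_Abelian_group (tuples k G)\<^esub> frag_of xs"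
  by (auto simp: ext_wedge_def tuples_def)

lemma hom_free_Abelian_group_diff:
  assumes "group H" "h \<in> hom (free_Abelian_group S) H"
    and "Poly_Mapping.keys a \<subseteq> S" "Poly_Mapping.keys b \<subseteq> S"
  shows "h (a - b) = h a \<otimes>\<^bsub>H\<^esub> inv\<^bsub>H\<^esub> (h b)"
proof -
  interpret group_hom "free_Abelian_group S" H h
    using assms by (simp add: group_hom_def group_hom_axioms_def)
  have a: "a \<in> carrier (free_Abelian_group S)" and b: "b \<in> carrier (free_Abelian_group S)"
    using assms by simp_all
  have "h (a \<otimes>\<^bsub>free_Abelian_group S\<^esub> inv\<^bsub>free_Abelian_group S\<^esub> b) = h a \<otimes>\<^bsub>H\<^esub> inv\<^bsub>H\<^esub> (h b)"
    by (simp only: hom_mult[OF a G.inv_closed[OF b]] hom_inv[OF b])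
  then show ?thesis using assms by simp
qed

lemma hom_free_Abelian_group_eq:
  assumes H: "group H" and g: "g \<in> hom (free_Abelian_group S) H" and h: "h \<in> hom (free_Abelian_group S) H"
    and eq: "\<And>x. x \<in> S \<Longrightarrow> g (frag_of x) = h (frag_of x)"
    and a: "Poly_Mapping.keys a \<subseteq> S"
  shows "g a = h a"
proof (rule free_Abelian_group_induct[OF a])
  show "g 0 = h 0"
    using hom_one[OF g _ H] hom_one[OF h _ H] by simp
  show "g (x - y) = h (x - y)"
    if "Poly_Mapping.keys x \<subseteq> S" "Poly_Mapping.keys y \<subseteq> S" "g x = h x" "g y = h y" for x y
    using that hom_free_Abelian_group_diff[OF H g] hom_free_Abelian_group_diff[OF H h] by simp
qed (rule eq)

text \<open>Composed with the quotient map, both homomorphisms are determined by the free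
  generators. All identities between maps on the complex are reduced to wedges in this way.\<close>

lemma ext_power_hom_eq:
  assumes G: "monoid G" and H: "group H"
    and g: "g \<in> hom (ext_power k G) H" and h: "h \<in> hom (ext_power k G) H"
    and eq: "\<And>xs. xs \<in> tuples k G \<Longrightarrow> g (ext_wedge G xs) = h (ext_wedge G xs)"
    and \<xi>: "\<xi> \<in> carrier (ext_power k G)"
  shows "g \<xi> = h \<xi>"
proof -
  let ?q = "\<lambda>a. ext_ker k G #>\<^bsub>free_Abelian_group (tuples k G)\<^esub> a"
  obtain a where a: "a \<in> carrier (free_Abelian_group (tuples k G))" "\<xi> = ?q a"
    using carrier_ext_powerE[OF \<xi>] .
  have "(g \<circ> ?q) a = (h \<circ> ?q) a"
  proof (rule hom_free_Abelian_group_eq[OF H])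
    show "g \<circ> ?q \<in> hom (free_Abelian_group (tuples k G)) H" "h \<circ> ?q \<in> hom (free_Abelian_group (tuples k G)) H"
      using hom_compose[OF ext_coset_hom[OF G]] g h by blast+
  qed (use a eq in \<open>auto simp: ext_wedge_eq\<close>)
  with a show ?thesis by simp
qed

lemma ext_relators_kernel:
  assumes G: "monoid G" and H: "comm_group H" and F: "alternating_map k G H F"
    and h: "h \<in> hom (free_Abelian_group (tuples k G)) H"
    and hF: "\<And>xs. xs \<in> tuples k G \<Longrightarrow> h (frag_of xs) = F xs"
    and r: "r \<in> ext_relators k G"
  shows "h r = \<one>\<^bsub>H\<^esub>"
proof -
  interpret G: monoid G by fact
  interpret H: comm_group H by fact
  consider xs i x y where "xs \<in> tuples k G" "i < k" "x \<in> carrier G" "y \<in> carrier G"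
      "r = frag_of (xs[i := x \<otimes>\<^bsub>G\<^esub> y]) - frag_of (xs[i := x]) - frag_of (xs[i := y])"
    | xs i j where "xs \<in> tuples k G" "i < j" "j < k" "xs ! i = xs ! j" "r = frag_of xs"
    using r unfolding ext_relators_def by blast
  then show ?thesis
  proof cases
    case 1
    note t = tuples_update[OF 1(1), of _ i]
    have c: "F (xs[i := x]) \<in> carrier H" "F (xs[i := y]) \<in> carrier H" "F (xs[i := x \<otimes>\<^bsub>G\<^esub> y]) \<in> carrier H"
      using F t 1 unfolding alternating_map_def by auto
    define a where "a = F (xs[i := x])"
    define b where "b = F (xs[i := y])"
    have ab: "a \<in> carrier H" "b \<in> carrier H" using c by (simp_all add: a_def b_def)
    have k: "Poly_Mapping.keys (frag_of (xs[i := x \<otimes>\<^bsub>G\<^esub> y]) - frag_of (xs[i := x])) \<subseteq> tuples k G"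
      by (rule order_trans[OF keys_diff]) (use t 1 in simp)
    have "h (frag_of (xs[i := x \<otimes>\<^bsub>G\<^esub> y]) - frag_of (xs[i := x])) = F (xs[i := x \<otimes>\<^bsub>G\<^esub> y]) \<otimes>\<^bsub>H\<^esub> inv\<^bsub>H\<^esub> a"
      using 1 t by (subst hom_free_Abelian_group_diff[OF H.is_group h]) (simp_all add: hF a_def)
    \<comment> \<open>The order is reversed so that a stands next to its inverse.\<close>
    also have "F (xs[i := x \<otimes>\<^bsub>G\<^esub> y]) = b \<otimes>\<^bsub>H\<^esub> a"
      using alternating_mapD(2)[OF F 1(1-4)] H.m_comm[OF ab] unfolding a_def b_def by (rule trans)
    also have "(b \<otimes>\<^bsub>H\<^esub> a) \<otimes>\<^bsub>H\<^esub> inv\<^bsub>H\<^esub> a = b"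
      using ab by (simp only: H.m_assoc H.r_inv H.r_one H.inv_closed)
    finally have hb: "h (frag_of (xs[i := x \<otimes>\<^bsub>G\<^esub> y]) - frag_of (xs[i := x])) = b" .
    have "Poly_Mapping.keys (frag_of (xs[i := y])) \<subseteq> tuples k G"
      using t[OF 1(4)] by simp
    from hom_free_Abelian_group_diff[OF H.is_group h k this]
    have "h r = b \<otimes>\<^bsub>H\<^esub> inv\<^bsub>H\<^esub> b"
      unfolding 1(5) hb hF[OF t[OF 1(4)]] b_def[symmetric] .
    then show ?thesis using H.r_inv[OF ab(2)] by (rule trans)
  next
    case 2
    then show ?thesis
      using alternating_mapD(3)[OF F 2(1-4)] by (simp add: hF)
  qed
qed

text \<open>The homomorphism on the free abelian group kills the relators and hence factors through
  the quotient. This is what makes the definite description in \<open>ext_lift\<close> denote; each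
  use below therefore starts from a proof that the generator map is alternating.\<close>

lemma ext_lift:
  assumes G: "monoid G" and H: "comm_group H" and F: "alternating_map k G H F"
  shows ext_lift_hom: "ext_lift k G H F \<in> hom (ext_power k G) H"
    and ext_lift_wedge: "xs \<in> tuples k G \<Longrightarrow> ext_lift k G H F (ext_wedge G xs) = F xs"
proof -
  interpret H: comm_group H by fact
  let ?FA = "free_Abelian_group (tuples k G)"
  let ?q = "\<lambda>a. ext_ker k G #>\<^bsub>?FA\<^esub> a"
  let ?P = "\<lambda>h. h \<in> hom (ext_power k G) H \<and> h \<in> extensional (carrier (ext_power k G)) \<and>
       (\<forall>xs\<in>tuples k G. h (ext_wedge G xs) = F xs)"
  have "F ` tuples k G \<subseteq> carrier H"
    using F by (auto simp: alternating_map_def)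
  then obtain h where h: "h \<in> hom ?FA H" "\<And>xs. xs \<in> tuples k G \<Longrightarrow> h (frag_of xs) = F xs"
    using H.free_Abelian_group_universal by metis
  interpret h: group_hom ?FA H h
    using h by (simp add: group_hom_def group_hom_axioms_def H.is_group)
  have "ext_relators k G \<subseteq> kernel ?FA H h"
    unfolding kernel_def using ext_relators_kernel[OF G H F h] ext_relators_carrier[OF G] by blast
  then have ker: "ext_ker k G \<subseteq> kernel ?FA H h"
    unfolding ext_ker_def using h.subgroup_kernel by (rule group.generate_subgroup_incl[OF group_free_Abelian_group])
  obtain g where g: "g \<in> hom (ext_power k G) H" "\<And>x. x \<in> carrier ?FA \<Longrightarrow> g (?q x) = h x"
    using h.FactGroup_universal_kernel[OF ext_ker_normal[OF G] ker] unfolding ext_power_def by metis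
  interpret E: comm_group "ext_power k G" by (rule comm_group_ext_power[OF G])
  \<comment> \<open>Restriction to the carrier fixes the values elsewhere, which turns uniqueness
    into an equality of functions.\<close>
  have *: "?P (restrict g (carrier (ext_power k G)))"
  proof (intro conjI ballI)
    show "restrict g (carrier (ext_power k G)) \<in> hom (ext_power k G) H"
      using g(1) by (auto simp: hom_def Pi_def)
    fix xs assume xs: "xs \<in> tuples k G"
    then have "ext_wedge G xs \<in> carrier (ext_power k G)"
      using hom_in_carrier[OF ext_coset_hom[OF G], of "frag_of xs"] by (simp add: ext_wedge_eq)
    then show "restrict g (carrier (ext_power k G)) (ext_wedge G xs) = F xs"
      using g(2)[of "frag_of xs"] h(2)[OF xs] xs by (simp add: ext_wedge_eq)
  qed simp
  have uniq: "f = f'" if f: "?P f" and f': "?P f'" for f f'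
  proof (rule extensionalityI)
    show "f \<in> extensional (carrier (ext_power k G))" "f' \<in> extensional (carrier (ext_power k G))"
      using f f' by simp_all
    fix \<xi> assume \<xi>: "\<xi> \<in> carrier (ext_power k G)"
    show "f \<xi> = f' \<xi>"
      by (rule ext_power_hom_eq[OF G H.is_group f[THEN conjunct1] f'[THEN conjunct1] _ \<xi>])
        (use f f' in simp)
  qed
  have "?P (ext_lift k G H F)"
    unfolding ext_lift_def by (rule theI[where P="?P", OF *]) (rule uniq[OF _ *])
  then show "ext_lift k G H F \<in> hom (ext_power k G) H"
    and "xs \<in> tuples k G \<Longrightarrow> ext_lift k G H F (ext_wedge G xs) = F xs"
    by auto
qed

text \<open>Relators become trivial in the quotient. Combined with pullbacks of alternating maps,
  this makes restriction and differential of the complex well defined, since both are given by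
  wedges of transformed entries.\<close>

lemma alternating_map_ext_wedge:
  assumes G: "monoid G"
  shows "alternating_map k G (ext_power k G) (ext_wedge G)"
proof -
  interpret G: monoid G by fact
  let ?FA = "free_Abelian_group (tuples k G)"
  let ?q = "\<lambda>a. ext_ker k G #>\<^bsub>?FA\<^esub> a"
  interpret E: comm_group "ext_power k G" by (rule comm_group_ext_power[OF G])
  note q = ext_coset_hom[OF G, of k]
  have wedge: "ext_wedge G xs \<in> carrier (ext_power k G)" if "xs \<in> tuples k G" for xs
    using hom_in_carrier[OF q, of "frag_of xs"] that by (simp add: ext_wedge_eq)
  have rel: "?q r = \<one>\<^bsub>ext_power k G\<^esub>" if "r \<in> ext_relators k G" for r
  proof -
    have "r \<in> ext_ker k G" unfolding ext_ker_def using that by (rule generate.incl)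
    then show ?thesis
      unfolding ext_power_def one_FactGroup
      using subgroup.rcos_const[OF ext_ker_subgroup[OF G] group_free_Abelian_group] by blast
  qed
  show ?thesis
    unfolding alternating_map_def
  proof (intro conjI ballI allI impI)
    fix xs i x y assume *: "xs \<in> tuples k G" "i < k" "x \<in> carrier G" "y \<in> carrier G"
    note t = tuples_update[OF *(1), of _ i]
    have txy: "xs[i := x] \<in> tuples k G" "xs[i := y] \<in> tuples k G" "xs[i := x \<otimes>\<^bsub>G\<^esub> y] \<in> tuples k G"
      using t * by auto
    have "?q (frag_of (xs[i := x \<otimes>\<^bsub>G\<^esub> y]) - frag_of (xs[i := x]) - frag_of (xs[i := y])) = \<one>\<^bsub>ext_power k G\<^esub>"
      using * by (intro rel) (auto simp: ext_relators_def)
    \<comment> \<open>The generator on the product is a relator plus the two other generators; the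
      quotient map then drops the relator.\<close>
    moreover have "frag_of (xs[i := x \<otimes>\<^bsub>G\<^esub> y]) = 
      ((frag_of (xs[i := x \<otimes>\<^bsub>G\<^esub> y]) - frag_of (xs[i := x]) - frag_of (xs[i := y])) \<otimes>\<^bsub>?FA\<^esub> 
      (frag_of (xs[i := x]) \<otimes>\<^bsub>?FA\<^esub> frag_of (xs[i := y])))"
      by simp
    moreover have "?q (a \<otimes>\<^bsub>?FA\<^esub> b) = ?q a \<otimes>\<^bsub>ext_power k G\<^esub> ?q b" if "a \<in> carrier ?FA" "b \<in> carrier ?FA" for a b
      using hom_mult[OF q that] .
    moreover have "frag_of (xs[i := x]) \<in> carrier ?FA" "frag_of (xs[i := y]) \<in> carrier ?FA"
      "frag_of (xs[i := x]) \<otimes>\<^bsub>?FA\<^esub> frag_of (xs[i := y]) \<in> carrier ?FA"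
      "frag_of (xs[i := x \<otimes>\<^bsub>G\<^esub> y]) - frag_of (xs[i := x]) - frag_of (xs[i := y]) \<in> carrier ?FA"
      using txy by (simp_all add: order_trans[OF keys_add] order_trans[OF keys_diff])
    ultimately show "ext_wedge G (xs[i := x \<otimes>\<^bsub>G\<^esub> y]) = 
      ext_wedge G (xs[i := x]) \<otimes>\<^bsub>ext_power k G\<^esub> ext_wedge G (xs[i := y])"
      using wedge txy unfolding ext_wedge_eq[OF txy(1)] ext_wedge_eq[OF txy(2)] ext_wedge_eq[OF txy(3)]
      by (metis E.l_one hom_in_carrier[OF q])
  next
    fix xs i j assume "xs \<in> tuples k G" "i < j" "j < k" "xs ! i = xs ! j"
    then show "ext_wedge G xs = \<one>\<^bsub>ext_power k G\<^esub>"
      by (subst ext_wedge_eq) (auto intro!: rel simp: ext_relators_def)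
  qed (rule wedge)
qed

section \<open>Holomorphic functions of several variables\<close>

lemma norm_vector_scalar_mult: "norm (c *s (v::complex^'d::finite)) = cmod c * norm v"
  by (simp add: norm_vec_def L2_set_def norm_mult power_mult_distrib real_sqrt_mult
      flip: sum_distrib_left)

lemma bounded_bilinear_vector_scalar_mult:
  "bounded_bilinear ((*s) :: complex \<Rightarrow> complex^'d::finite \<Rightarrow> complex^'d)"
proof
  show "\<exists>K. \<forall>a b. norm ((a::complex) *s (b::complex^'d)) \<le> norm a * norm b * K"
    by (rule exI[of _ 1]) (simp add: norm_vector_scalar_mult)
qed (simp_all add: vec_eq_iff algebra_simps)

lemmas continuous_on_vector_scalar_mult [continuous_intros] =
  bounded_bilinear.continuous_on [OF bounded_bilinear_vector_scalar_mult]

lemma cholomorphic_on_has_derivative: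
  assumes "cholomorphic_on f W" "x \<in> W"
  shows "(f has_derivative frechet_derivative f (at x)) (at x)"
    and "frechet_derivative f (at x) (a *s v) = a * frechet_derivative f (at x) v"
proof -
  obtain D where D: "(f has_derivative D) (at x)" "\<And>a v. D (a *s v) = a * D v"
    using assms unfolding cholomorphic_on_def by blast
  then have "frechet_derivative f (at x) = D"
    using frechet_derivative_at by metis
  with D show "(f has_derivative frechet_derivative f (at x)) (at x)"
    "frechet_derivative f (at x) (a *s v) = a * frechet_derivative f (at x) v"
    by simp_all
qed

lemma cholomorphic_on_continuous_on:
  assumes "cholomorphic_on f W" shows "continuous_on W f"
  using cholomorphic_on_has_derivative(1)[OF assms]
  by (meson continuous_at_imp_continuous_on has_derivative_continuous)

section \<open>Cauchy's formula on complex lines\<close>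

definition circ :: "real \<Rightarrow> real \<Rightarrow> complex"
  where "circ \<rho> t = \<rho> * exp (2 * pi * \<i> * of_real t)"

lemma norm_circ [simp]: "0 \<le> \<rho> \<Longrightarrow> cmod (circ \<rho> t) = \<rho>"
  by (simp add: circ_def norm_mult)

lemma circ_nonzero [simp]: "0 < \<rho> \<Longrightarrow> circ \<rho> t \<noteq> 0"
  by (simp add: circ_def)

lemma continuous_on_circ [continuous_intros]:
  "continuous_on S g \<Longrightarrow> continuous_on S (\<lambda>x. circ \<rho> (g x))"
  unfolding circ_def by (intro continuous_intros)

text \<open>Restricted to the complex line through x in direction v, the function has the
  directional derivative as its complex derivative, because the differential is complex linear; the
  one-variable formula for the derivative at 0 applies. On the circle, du / u^2 equals 2 pi i dt /
  u, which leaves a single \<open>circ\<close> in the denominator.\<close>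

lemma cholomorphic_on_cauchy_directional:
  assumes f: "cholomorphic_on f W" and W: "open W" and \<rho>: "\<rho> > 0"
    and sub: "\<And>\<zeta>. cmod \<zeta> \<le> \<rho> \<Longrightarrow> x + \<zeta> *s v \<in> W"
  shows "frechet_derivative f (at x) v =
    integral {0..1} (\<lambda>t. f (x + circ \<rho> t *s v)
      / circ \<rho> t)"
proof -
  define g where "g = (\<lambda>\<zeta>. f (x + \<zeta> *s v))"
  have der: "(g has_field_derivative frechet_derivative f (at (x + \<zeta> *s v)) v) (at \<zeta>)"
    if "x + \<zeta> *s v \<in> W" for \<zeta>
  proof -
    have "((\<lambda>\<zeta>. x + \<zeta> *s v) has_derivative (\<lambda>h. h *s v)) (at \<zeta>)"
      using bounded_bilinear.FDERIV[OF bounded_bilinear_vector_scalar_mult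
          has_derivative_ident has_derivative_const, of v \<zeta> UNIV]
      by (auto intro!: derivative_eq_intros simp: vec_eq_iff)
    from has_derivative_compose[OF this cholomorphic_on_has_derivative(1)[OF f that]]
    show ?thesis
      unfolding has_field_derivative_def g_def cholomorphic_on_has_derivative(2)[OF f that]
      by (simp add: mult_commute_abs)
  qed
  have der': "(g has_field_derivative frechet_derivative f (at (x + \<zeta> *s v)) v) (at \<zeta> within S)"
    if "cmod \<zeta> \<le> \<rho>" for \<zeta> S
    using der[OF sub[OF that]] by (rule has_field_derivative_at_within)
  have cont: "continuous_on (cball 0 \<rho>) g"
    by (rule DERIV_continuous_on, rule der') simp
  have hol: "g holomorphic_on ball 0 \<rho>"
    unfolding holomorphic_on_def field_differentiable_def
    by (intro ballI exI, rule der') simp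
  have "(g has_field_derivative
    (1 / (2 * of_real pi * \<i>) * contour_integral (circlepath 0 \<rho>) (\<lambda>u. g u / (u - 0)^2))) (at 0)"
    using \<rho> by (intro Cauchy_derivative_integral_circlepath[OF cont hol]) auto
  moreover have "(g has_field_derivative frechet_derivative f (at x) v) (at 0)"
    using der[of 0] sub[of 0] \<rho> by simp
  ultimately have "frechet_derivative f (at x) v =
    1 / (2 * of_real pi * \<i>) * contour_integral (circlepath 0 \<rho>) (\<lambda>u. g u / u^2)"
    using DERIV_unique by fastforce
  also have "\<dots> = 1 / (2 * of_real pi * \<i>) *
     integral {0..1} (\<lambda>t. (2 * of_real pi * \<i>) * (f (x + circ \<rho> t *s v)
      / circ \<rho> t))"
  proof -
    have "g (circlepath 0 \<rho> t) / (circlepath 0 \<rho> t)\<^sup>2 * vector_derivative (circlepath 0 \<rho>) (at t) =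
      2 * of_real pi * \<i> * (f (x + circ \<rho> t *s v) / circ \<rho> t)" for t
    proof -
      have "circlepath 0 \<rho> t = circ \<rho> t"
        by (simp add: circ_def circlepath)
      moreover have "vector_derivative (circlepath 0 \<rho>) (at t) = 2 * of_real pi * \<i> * circ \<rho> t"
        by (simp add: circ_def vector_derivative_circlepath)
      ultimately show ?thesis
        using circ_nonzero[OF \<rho>, of t] by (simp add: g_def power2_eq_square)
    qed
    then show ?thesis
      unfolding contour_integral_integral by simp
  qed
  also have "\<dots> = integral {0..1} (\<lambda>t. f (x + circ \<rho> t *s v)
      / circ \<rho> t)"
    by (subst integral_mult_right) simp
  finally show ?thesis .
qed

text \<open>One radius \<rho> has to serve all base points near z, so that the Cauchy formula can be
  varied in the base point under the integral sign.\<close>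

lemma cball_translate_subset:
  fixes W :: "(complex^'d::finite) set"
  assumes "open W" "z \<in> W"
  shows "\<exists>r>0. \<exists>\<rho>>0. \<forall>x\<in>ball z r. \<forall>\<zeta>\<in>cball 0 \<rho>. x + \<zeta> *s v \<in> W"
proof -
  obtain e where e: "e > 0" "ball z e \<subseteq> W"
    using assms open_contains_ball by blast
  \<comment> \<open>The summand 1 keeps the denominator positive when v = 0.\<close>
  define \<rho> where "\<rho> = e / (2 * (1 + norm v))"
  have nv: "0 < 1 + norm v" by (smt (verit) norm_ge_zero)
  show ?thesis
  proof (intro exI conjI ballI)
    show "e / 2 > 0" "\<rho> > 0" using e nv by (auto simp: \<rho>_def)
    fix x \<zeta> assume x: "x \<in> ball z (e/2)" and "\<zeta> \<in> cball (0::complex) \<rho>"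
    then have \<zeta>: "cmod \<zeta> \<le> \<rho>" by simp
    have "norm (\<zeta> *s v) \<le> \<rho> * norm v"
      by (simp add: norm_vector_scalar_mult mult_right_mono \<zeta>)
    also have "\<dots> \<le> \<rho> * (1 + norm v)" using \<open>\<rho> > 0\<close> by simp
    also have "\<dots> = e / 2" using nv unfolding \<rho>_def by (simp add: divide_simps)
    finally have "norm (\<zeta> *s v) \<le> e / 2" .
    moreover have "dist z (x + \<zeta> *s v) \<le> dist z x + norm (\<zeta> *s v)"
      using norm_triangle_ineq4[of "z - x" "\<zeta> *s v"] by (simp add: dist_norm algebra_simps)
    ultimately show "x + \<zeta> *s v \<in> W" using x e by auto
  qed
qed

text \<open>\<open>cholomorphic_on\<close> demands differentiability at each point only. Continuity
  of the derivatives is extracted from the Cauchy integral; it is then what allows differentiation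
  of that integral under the sign.\<close>

lemma cholomorphic_on_continuous_deriv:
  assumes f: "cholomorphic_on f W" and W: "open W"
  shows "continuous_on W (\<lambda>x. frechet_derivative f (at x) v)"
proof -
  have "isCont (\<lambda>x. frechet_derivative f (at x) v) z" if zW: "z \<in> W" for z
  proof -
    from cball_translate_subset[OF W zW, of v] obtain r \<rho> where r: "r > 0" "\<rho> > 0"
      and sub0: "\<forall>x\<in>ball z r. \<forall>\<zeta>\<in>cball 0 \<rho>. x + \<zeta> *s v \<in> W" by metis
    have sub: "x + \<zeta> *s v \<in> W" if "x \<in> ball z r" "cmod \<zeta> \<le> \<rho>" for x \<zeta>
      using sub0 that by auto
    have u: "cmod (circ \<rho> t) \<le> \<rho>" "circ \<rho> t \<noteq> 0" for t using r by auto
    have "continuous_on (ball z r) (\<lambda>x. integral (cbox 0 1) (\<lambda>t. f (x + circ \<rho> t *s v) / circ \<rho> t))"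
    proof (rule integral_continuous_on_param)
      have "continuous_on (ball z r \<times> cbox 0 1) (\<lambda>p. f (fst p + circ \<rho> (snd p) *s v))"
        using sub u by (intro continuous_on_compose2[OF cholomorphic_on_continuous_on[OF f]]
            continuous_intros) auto
      then show "continuous_on (ball z r \<times> cbox 0 1) (\<lambda>(x, t). f (x + circ \<rho> t *s v) / circ \<rho> t)"
        unfolding case_prod_beta using u by (intro continuous_intros) auto
    qed
    then have "continuous_on (ball z r) (\<lambda>x. frechet_derivative f (at x) v)"
      using cholomorphic_on_cauchy_directional[OF f W r(2) sub]
      by (subst continuous_on_cong[OF refl]) (auto simp: u)
    then show ?thesis
      using r by (simp add: continuous_on_eq_continuous_at)
  qed
  then show ?thesis using continuous_at_imp_continuous_on by blast
qed

text \<open>The Cauchy formula is differentiated under the integral sign. The radius is exported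
  along with the derivative because the symmetry of second derivatives compares two integrals over
  the same circle.\<close>

lemma cholomorphic_on_deriv_aux:
  assumes f: "cholomorphic_on f W" and W: "open W" and z: "z \<in> W"
  shows "\<exists>\<rho>>0. (\<forall>\<zeta>. cmod \<zeta> \<le> \<rho> \<longrightarrow> z + \<zeta> *s v \<in> W) \<and>
    ((\<lambda>x. frechet_derivative f (at x) v) has_derivative
      (\<lambda>w. integral {0..1} (\<lambda>t. frechet_derivative f (at (z + circ \<rho> t *s v)) w
      / circ \<rho> t))) (at z)"
proof -
  from cball_translate_subset[OF W z, of v] obtain r \<rho> where r: "r > 0" "\<rho> > 0"
    and sub0: "\<forall>x\<in>ball z r. \<forall>\<zeta>\<in>cball 0 \<rho>. x + \<zeta> *s v \<in> W" by metis
  have sub: "x + \<zeta> *s v \<in> W" if "x \<in> ball z r" "cmod \<zeta> \<le> \<rho>" for x \<zeta>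
    using sub0 that by auto
  have u: "cmod (circ \<rho> t) \<le> \<rho>" "circ \<rho> t \<noteq> 0" for t using r by auto
  let ?D = "\<lambda>x. frechet_derivative f (at x)"
  have bl: "bounded_linear (\<lambda>w. ?D (x + circ \<rho> t *s v) w / circ \<rho> t)" if "x \<in> ball z r" for x t
    using cholomorphic_on_has_derivative(1)[OF f sub[OF that u(1)]]
    by (intro bounded_linear_compose[OF bounded_linear_divide] has_derivative_bounded_linear)
  \<comment> \<open>The Leibniz rule wants derivatives bundled as bounded linear functions;
    \<open>Blinfun\<close> is faithful only where the map is known to be bounded linear, that is for
    x in the ball.\<close>
  define fx where "fx = (\<lambda>x t. Blinfun (\<lambda>w. ?D (x + circ \<rho> t *s v) w / circ \<rho> t))"
  have fx: "blinfun_apply (fx x t) = (\<lambda>w. ?D (x + circ \<rho> t *s v) w / circ \<rho> t)" if "x \<in> ball z r" for x t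
    unfolding fx_def by (rule bounded_linear_Blinfun_apply[OF bl[OF that]])
  have contf: "continuous_on (ball z r \<times> cbox 0 1) (\<lambda>p. f (fst p + circ \<rho> (snd p) *s v))"
    using sub u by (intro continuous_on_compose2[OF cholomorphic_on_continuous_on[OF f]]
        continuous_intros) auto
  have "((\<lambda>x. integral (cbox 0 1) (\<lambda>t. f (x + circ \<rho> t *s v) / circ \<rho> t)) has_derivative
     blinfun_apply (integral (cbox 0 1) (fx z))) (at z within ball z r)"
  proof (rule leibniz_rule)
    fix x :: "complex^'a" and t :: real assume x: "x \<in> ball z r" and t: "t \<in> cbox 0 1"
    have "((\<lambda>x. f (x + circ \<rho> t *s v)) has_derivative ?D (x + circ \<rho> t *s v)) (at x)"
    proof -
      have "((\<lambda>x. x + circ \<rho> t *s v) has_derivative (\<lambda>h. h)) (at x)"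
        by (intro has_derivative_add_const has_derivative_ident)
      from has_derivative_compose[OF this cholomorphic_on_has_derivative(1)[OF f sub[OF x u(1)[of t]]]]
      show ?thesis .
    qed
    then have "((\<lambda>x. f (x + circ \<rho> t *s v)) has_derivative ?D (x + circ \<rho> t *s v)) (at x within ball z r)"
      by (rule has_derivative_at_withinI)
    from bounded_linear.has_derivative[OF bounded_linear_divide this]
    show "((\<lambda>x. f (x + circ \<rho> t *s v) / circ \<rho> t) has_derivative blinfun_apply (fx x t)) (at x within ball z r)"
      by (simp add: fx[OF x])
  next
    fix x :: "complex^'a" assume x: "x \<in> ball z r"
    have "continuous_on (cbox 0 1) (\<lambda>t. f (x + circ \<rho> t *s v))"
      using sub u x by (intro continuous_on_compose2[OF cholomorphic_on_continuous_on[OF f]]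
        continuous_intros) auto
    then show "(\<lambda>t. f (x + circ \<rho> t *s v) / circ \<rho> t) integrable_on cbox 0 1"
      using u by (intro integrable_continuous continuous_intros) auto
  next
    have "continuous_on (ball z r \<times> cbox 0 1) (\<lambda>p. blinfun_apply (fx (fst p) (snd p)) i)" for i
    proof -
      have "continuous_on (ball z r \<times> cbox 0 1) (\<lambda>p. ?D (fst p + circ \<rho> (snd p) *s v) i / circ \<rho> (snd p))"
        using sub u by (intro continuous_intros 
          continuous_on_compose2[OF cholomorphic_on_continuous_deriv[OF f W]]) auto
      then show ?thesis
        by (rule iffD1[OF continuous_on_cong[OF refl], rotated]) (auto simp: fx)
    qed
    then show "continuous_on (ball z r \<times> cbox 0 1) (\<lambda>(x, t). fx x t)"
      unfolding case_prod_beta by (intro continuous_on_blinfun_componentwise)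
  qed (use r in auto)
  then have "((\<lambda>x. integral (cbox 0 1) (\<lambda>t. f (x + circ \<rho> t *s v) / circ \<rho> t)) has_derivative
     blinfun_apply (integral (cbox 0 1) (fx z))) (at z)"
    using r by (subst (asm) at_within_open) auto
  then have "((\<lambda>x. ?D x v) has_derivative blinfun_apply (integral (cbox 0 1) (fx z))) (at z)"
  proof (rule has_derivative_transform_within_open[where s="ball z r"])
    fix x assume "x \<in> ball z r"
    then show "integral (cbox 0 1) (\<lambda>t. f (x + circ \<rho> t *s v) / circ \<rho> t) = ?D x v"
      using cholomorphic_on_cauchy_directional[OF f W r(2) sub] by simp
  qed (use r in auto)
  then have A: "((\<lambda>x. ?D x v) has_derivative (\<lambda>w. integral {0..1} (\<lambda>t. ?D (z + circ \<rho> t *s v) w / circ \<rho> t))) (at z)"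
  proof (rule has_derivative_eq_rhs, intro ext)
    fix w
    have "continuous_on (cbox 0 1) (fx z)"
    proof (rule continuous_on_blinfun_componentwise)
      fix i
      show "continuous_on (cbox 0 1) (\<lambda>t. blinfun_apply (fx z t) i)"
        unfolding fx[OF centre_in_ball[THEN iffD2, OF r(1)]]
        using sub u r by (intro continuous_intros 
          continuous_on_compose2[OF cholomorphic_on_continuous_deriv[OF f W]]) auto
    qed
    then have "fx z integrable_on cbox 0 1" by (rule integrable_continuous)
    \<comment> \<open>Evaluation at w is bounded linear, so it commutes with the integral of the
      bundled derivative.\<close>
    from integral_linear[OF this blinfun.bounded_linear_left[of w]]
    show "blinfun_apply (integral (cbox 0 1) (fx z)) w =
      integral {0..1} (\<lambda>t. ?D (z + circ \<rho> t *s v) w / circ \<rho> t)"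
      using r by (simp add: o_def fx)
  qed
  have B: "\<forall>\<zeta>. cmod \<zeta> \<le> \<rho> \<longrightarrow> z + \<zeta> *s v \<in> W"
    using r sub by auto
  show ?thesis
  proof (intro exI conjI)
    show "0 < \<rho>" by (rule r(2))
  qed (rule B, rule A)
qed

text \<open>The derivative is an integral of maps that are complex linear in w, and the scalar
  passes through the integral. Iteration gives smoothness of holomorphic functions.\<close>

lemma cholomorphic_on_deriv:
  assumes f: "cholomorphic_on f W" and W: "open W"
  shows "cholomorphic_on (\<lambda>x. frechet_derivative f (at x) v) W"
  unfolding cholomorphic_on_def
proof
  fix z assume z: "z \<in> W"
  from cholomorphic_on_deriv_aux[OF f W z, of v]
  obtain \<rho> where \<rho>0: "\<rho> > 0" and \<rho>1: "\<forall>\<zeta>. cmod \<zeta> \<le> \<rho> \<longrightarrow> z + \<zeta> *s v \<in> W"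
    and D: "((\<lambda>x. frechet_derivative f (at x) v) has_derivative
      (\<lambda>w. integral {0..1} (\<lambda>t. frechet_derivative f (at (z + circ \<rho> t *s v)) w
      / circ \<rho> t))) (at z)"
    by (elim exE conjE) (rule that)
  have \<rho>: "\<rho> > 0" "\<And>\<zeta>. cmod \<zeta> \<le> \<rho> \<Longrightarrow> z + \<zeta> *s v \<in> W"
    using \<rho>0 \<rho>1 by auto
  have "frechet_derivative f (at (z + circ \<rho> t *s v)) (a *s w) =
    a * frechet_derivative f (at (z + circ \<rho> t *s v)) w" for t a w
    using \<rho>(1) by (intro cholomorphic_on_has_derivative(2)[OF f] \<rho>(2)) (auto)
  then have "integral {0..1} (\<lambda>t. frechet_derivative f (at (z + circ \<rho> t *s v)) (a *s w)
      / circ \<rho> t) = 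
    integral {0..1} (\<lambda>t. a * (frechet_derivative f (at (z + circ \<rho> t *s v)) w
      / circ \<rho> t))" for a w
    by (intro integral_cong) (simp only: times_divide_eq_right)
  note eq = this[unfolded integral_mult_right]
  show "\<exists>D. ((\<lambda>x. frechet_derivative f (at x) v) has_derivative D) (at z) \<and> (\<forall>a v. D (a *s v) = a * D v)"
    using D by (intro exI[of _ "\<lambda>w. integral {0..1} (\<lambda>t. frechet_derivative f (at (z + circ \<rho> t *s v)) w
      / circ \<rho> t)"] conjI allI eq)
qed

text \<open>Both sides are the same circle integral: the first differentiates the Cauchy formula for
  \<open>D\<^sub>v f\<close> under the integral sign, the second applies the Cauchy formula to \<open>D\<^sub>w f\<close>.\<close>

lemma cholomorphic_on_deriv_commute:
  assumes f: "cholomorphic_on f W" and W: "open W" and z: "z \<in> W"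
  shows "frechet_derivative (\<lambda>x. frechet_derivative f (at x) v) (at z) w =
    frechet_derivative (\<lambda>x. frechet_derivative f (at x) w) (at z) v"
proof -
  from cholomorphic_on_deriv_aux[OF f W z, of v]
  obtain \<rho> where \<rho>0: "\<rho> > 0" and \<rho>1: "\<forall>\<zeta>. cmod \<zeta> \<le> \<rho> \<longrightarrow> z + \<zeta> *s v \<in> W"
    and D: "((\<lambda>x. frechet_derivative f (at x) v) has_derivative
      (\<lambda>w. integral {0..1} (\<lambda>t. frechet_derivative f (at (z + circ \<rho> t *s v)) w
      / circ \<rho> t))) (at z)"
    by (elim exE conjE) (rule that)
  have \<rho>: "\<rho> > 0" "\<And>\<zeta>. cmod \<zeta> \<le> \<rho> \<Longrightarrow> z + \<zeta> *s v \<in> W"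
    using \<rho>0 \<rho>1 by auto
  have "frechet_derivative (\<lambda>x. frechet_derivative f (at x) v) (at z) w =
     integral {0..1} (\<lambda>t. frechet_derivative f (at (z + circ \<rho> t *s v)) w
      / circ \<rho> t)"
    by (simp only: frechet_derivative_at[OF D, symmetric])
  also have "\<dots> = frechet_derivative (\<lambda>x. frechet_derivative f (at x) w) (at z) v"
    by (rule cholomorphic_on_cauchy_directional[OF cholomorphic_on_deriv[OF f W, of w] W \<rho>, symmetric])
  finally show ?thesis .
qed

section \<open>Smooth functions\<close>

lemma has_derivative_cong_open:
  assumes "open W" "x \<in> W" "\<And>y. y \<in> W \<Longrightarrow> f y = g y"
  shows "(f has_derivative D) (at x) \<longleftrightarrow> (g has_derivative D) (at x)"
  using assms has_derivative_transform_within_open[of f D x UNIV W g]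
    has_derivative_transform_within_open[of g D x UNIV W f] by fastforce

lemma frechet_derivative_cong_open:
  assumes "open W" "x \<in> W" "\<And>y. y \<in> W \<Longrightarrow> f y = g y"
  shows "frechet_derivative f (at x) = frechet_derivative g (at x)"
  unfolding frechet_derivative_def using has_derivative_cong_open[OF assms] by simp

lemma ck_on_cong:
  assumes "open W" "\<And>y. y \<in> W \<Longrightarrow> f y = g y" "ck_on k f W"
  shows "ck_on k g W"
  using assms(2,3)
proof (induction k arbitrary: f g)
  case 0
  then show ?case by (simp cong: continuous_on_cong)
next
  case (Suc k)
  show ?case
    unfolding ck_on.simps
  proof (intro conjI ballI allI)
    fix x assume x: "x \<in> W"
    then show "g differentiable at x"
      using Suc.prems(2) has_derivative_cong_open[where f=f and g=g, OF assms(1) x Suc.prems(1)]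
      unfolding ck_on.simps differentiable_def by blast
  next
    fix v
    show "ck_on k (\<lambda>x. frechet_derivative g (at x) v) W"
    proof (rule Suc.IH)
      show "ck_on k (\<lambda>x. frechet_derivative f (at x) v) W" using Suc.prems by simp
      show "frechet_derivative f (at y) v = frechet_derivative g (at y) v" if "y \<in> W" for y
        using frechet_derivative_cong_open[OF assms(1) that Suc.prems(1)] by simp
    qed
  qed
qed

lemma ck_on_SucI:
  assumes "open W" "\<And>x. x \<in> W \<Longrightarrow> (f has_derivative D x) (at x)" "\<And>v. ck_on k (\<lambda>x. D x v) W"
  shows "ck_on (Suc k) f W"
  unfolding ck_on.simps
proof (intro conjI ballI allI)
  fix x assume "x \<in> W"
  then show "f differentiable at x"
    using assms(2) by (auto simp: differentiable_def)
next
  fix v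
  show "ck_on k (\<lambda>x. frechet_derivative f (at x) v) W"
    using assms(3)[of v]
    by (rule ck_on_cong[OF assms(1), rotated]) (use frechet_derivative_at[OF assms(2)] in simp)
qed

lemma ck_on_SucD:
  assumes "ck_on (Suc k) f W"
  shows "x \<in> W \<Longrightarrow> (f has_derivative frechet_derivative f (at x)) (at x)"
    and "ck_on k (\<lambda>x. frechet_derivative f (at x) v) W"
  using assms by (auto simp: frechet_derivative_works)

lemma ck_on_Suc_imp: "ck_on (Suc k) f W \<Longrightarrow> ck_on k f W"
proof (induction k arbitrary: f)
  case 0
  then show ?case
    by (auto intro!: continuous_at_imp_continuous_on differentiable_imp_continuous_within)
next
  case (Suc k)
  then show ?case unfolding ck_on.simps(2)[of "Suc k"] ck_on.simps(2)[of k] by blast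
qed

lemma ck_on_const: "open W \<Longrightarrow> ck_on k (\<lambda>_. c) W"
proof (induction k arbitrary: c)
  case (Suc k)
  show ?case
    by (rule ck_on_SucI[OF Suc.prems has_derivative_const Suc.IH[OF Suc.prems]])
qed simp

lemma ck_on_add: "open W \<Longrightarrow> ck_on k f W \<Longrightarrow> ck_on k g W \<Longrightarrow> ck_on k (\<lambda>x. f x + g x) W"
proof (induction k arbitrary: f g)
  case 0
  then show ?case by (simp add: continuous_on_add)
next
  case (Suc k)
  show ?case
    by (rule ck_on_SucI[OF Suc.prems(1) has_derivative_add[OF ck_on_SucD(1)[OF Suc.prems(2)]
            ck_on_SucD(1)[OF Suc.prems(3)]]])
      (auto intro: Suc.IH[OF Suc.prems(1)] ck_on_SucD(2)[OF Suc.prems(2)] ck_on_SucD(2)[OF Suc.prems(3)])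
qed

text \<open>The product rule leaves an undifferentiated factor, known to be of class k + 1 but
  needed of class k; hence the appeal to \<open>ck_on_Suc_imp\<close>.\<close>

lemma ck_on_mult: "open W \<Longrightarrow> ck_on k f W \<Longrightarrow> ck_on k g W \<Longrightarrow> ck_on k (\<lambda>x. f x * g x) W"
proof (induction k arbitrary: f g)
  case 0
  then show ?case by (simp add: continuous_on_mult)
next
  case (Suc k)
  show ?case
    by (rule ck_on_SucI[OF Suc.prems(1) has_derivative_mult[OF ck_on_SucD(1)[OF Suc.prems(2)]
            ck_on_SucD(1)[OF Suc.prems(3)]]])
      (auto intro!: ck_on_add[OF Suc.prems(1)] Suc.IH[OF Suc.prems(1)]
        ck_on_SucD(2)[OF Suc.prems(2)] ck_on_SucD(2)[OF Suc.prems(3)]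
        ck_on_Suc_imp[OF Suc.prems(2)] ck_on_Suc_imp[OF Suc.prems(3)])
qed

lemma ck_on_bounded_linear:
  assumes "bounded_linear h"
  shows "open W \<Longrightarrow> ck_on k f W \<Longrightarrow> ck_on k (\<lambda>x. h (f x)) W"
proof (induction k arbitrary: f)
  case 0
  then show ?case by (simp add: bounded_linear.continuous_on[OF assms])
next
  case (Suc k)
  show ?case
    by (rule ck_on_SucI[OF Suc.prems(1) bounded_linear.has_derivative[OF assms ck_on_SucD(1)[OF Suc.prems(2)]]])
      (auto intro!: Suc.IH[OF Suc.prems(1)] ck_on_SucD(2)[OF Suc.prems(2)])
qed

lemma ck_on_cholomorphic:
  "open W \<Longrightarrow> cholomorphic_on f W \<Longrightarrow> ck_on k f W"
proof (induction k arbitrary: f)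
  case 0
  then show ?case by (simp add: cholomorphic_on_continuous_on)
next
  case (Suc k)
  show ?case
    by (rule ck_on_SucI[OF Suc.prems(1) cholomorphic_on_has_derivative(1)[OF Suc.prems(2)]])
      (auto intro!: Suc.IH[OF Suc.prems(1)] cholomorphic_on_deriv[OF Suc.prems(2,1)])
qed

lemma smooth_on_const: "open W \<Longrightarrow> smooth_on (\<lambda>_. c) W"
  by (simp add: smooth_on_def ck_on_const)

lemma smooth_on_add: "open W \<Longrightarrow> smooth_on f W \<Longrightarrow> smooth_on g W \<Longrightarrow> smooth_on (\<lambda>x. f x + g x) W"
  by (simp add: smooth_on_def ck_on_add)

lemma smooth_on_mult: "open W \<Longrightarrow> smooth_on f W \<Longrightarrow> smooth_on g W \<Longrightarrow> smooth_on (\<lambda>x. f x * g x) W"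
  by (simp add: smooth_on_def ck_on_mult)

lemma smooth_on_bounded_linear:
  "bounded_linear h \<Longrightarrow> open W \<Longrightarrow> smooth_on f W \<Longrightarrow> smooth_on (\<lambda>x. h (f x)) W"
  by (simp add: smooth_on_def ck_on_bounded_linear)

lemma smooth_on_cholomorphic: "open W \<Longrightarrow> cholomorphic_on f W \<Longrightarrow> smooth_on f W"
  by (simp add: smooth_on_def ck_on_cholomorphic)

lemma smooth_on_cong:
  "open W \<Longrightarrow> (\<And>y. y \<in> W \<Longrightarrow> f y = g y) \<Longrightarrow> smooth_on f W \<Longrightarrow> smooth_on g W"
  unfolding smooth_on_def using ck_on_cong by blast

lemma smooth_on_sum:
  assumes "open W" "\<And>i. i \<in> I \<Longrightarrow> smooth_on (f i) W"
  shows "smooth_on (\<lambda>x. \<Sum>i\<in>I. f i x) W"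
  using assms(2)
  by (induction I rule: infinite_finite_induct) (simp_all add: smooth_on_const smooth_on_add assms(1))

lemma smooth_on_differentiable: "smooth_on f W \<Longrightarrow> x \<in> W \<Longrightarrow> f differentiable (at x)"
  unfolding smooth_on_def by (metis ck_on.simps(2))

text \<open>For functions such as ln |f| whose derivative is recognised as smooth. Class k + 1 at
  every k is obtained directly, and class k follows.\<close>

lemma smooth_on_SucI:
  assumes "open W" "\<And>x. x \<in> W \<Longrightarrow> (f has_derivative D x) (at x)" "\<And>v. smooth_on (\<lambda>x. D x v) W"
  shows "smooth_on f W"
  unfolding smooth_on_def
proof
  fix k
  have "ck_on (Suc k) f W"
    by (rule ck_on_SucI[OF assms(1,2)]) (use assms(3) in \<open>auto simp: smooth_on_def\<close>)
  then show "ck_on k f W" by (rule ck_on_Suc_imp)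
qed

lemma cholomorphic_onI:
  assumes "\<And>x. x \<in> W \<Longrightarrow> (f has_derivative D x) (at x)" "\<And>x a v. x \<in> W \<Longrightarrow> D x (a *s v) = a * D x v"
  shows "cholomorphic_on f W"
  unfolding cholomorphic_on_def using assms by blast

lemma cholomorphic_on_cong:
  assumes "open W" "\<And>y. y \<in> W \<Longrightarrow> f y = g y" "cholomorphic_on f W"
  shows "cholomorphic_on g W"
  using has_derivative_cong_open[where f=f and g=g, OF assms(1) _ assms(2)] assms(3)
  unfolding cholomorphic_on_def by blast

lemma cholomorphic_on_subset: "cholomorphic_on f W \<Longrightarrow> W' \<subseteq> W \<Longrightarrow> cholomorphic_on f W'"
  unfolding cholomorphic_on_def by blast

lemma cholomorphic_on_const: "cholomorphic_on (\<lambda>_. c) W"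
  by (rule cholomorphic_onI[OF has_derivative_const]) simp

lemma cholomorphic_on_add:
  assumes "cholomorphic_on f W" "cholomorphic_on g W"
  shows "cholomorphic_on (\<lambda>x. f x + g x) W"
  by (rule cholomorphic_onI[OF has_derivative_add[OF cholomorphic_on_has_derivative(1)[OF assms(1)]
          cholomorphic_on_has_derivative(1)[OF assms(2)]]])
    (simp_all add: cholomorphic_on_has_derivative(2)[OF assms(1)]
      cholomorphic_on_has_derivative(2)[OF assms(2)] algebra_simps)

lemma cholomorphic_on_mult:
  assumes "cholomorphic_on f W" "cholomorphic_on g W"
  shows "cholomorphic_on (\<lambda>x. f x * g x) W"
  by (rule cholomorphic_onI[OF has_derivative_mult[OF cholomorphic_on_has_derivative(1)[OF assms(1)]
          cholomorphic_on_has_derivative(1)[OF assms(2)]]])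
    (simp_all add: cholomorphic_on_has_derivative(2)[OF assms(1)]
      cholomorphic_on_has_derivative(2)[OF assms(2)] algebra_simps)

lemma cholomorphic_on_compose:
  assumes "cholomorphic_on f W" "\<And>x. x \<in> W \<Longrightarrow> (g has_field_derivative g' (f x)) (at (f x))"
  shows "cholomorphic_on (\<lambda>x. g (f x)) W"
  by (rule cholomorphic_onI[OF has_derivative_compose[OF cholomorphic_on_has_derivative(1)[OF assms(1)]
          assms(2)[unfolded has_field_derivative_def]]])
    (simp_all add: cholomorphic_on_has_derivative(2)[OF assms(1)])

text \<open>Near x, ln |f| is the constant ln |f x| plus the real part of Ln (f / f x). Dividing by
  f x moves the value at x to 1, away from the branch cut.\<close>

lemma has_derivative_ln_cmod:
  fixes f :: "'v::real_normed_vector \<Rightarrow> complex"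
  assumes f: "(f has_derivative D) (at x)" and nz: "f x \<noteq> 0"
  shows "((\<lambda>y. complex_of_real (ln (cmod (f y)))) has_derivative
    (\<lambda>v. of_real (Re (D v / f x)))) (at x)"
proof -
  have "((\<lambda>y. f y / f x) has_derivative (\<lambda>v. D v / f x)) (at x)"
    using bounded_linear.has_derivative[OF bounded_linear_divide f] .
  moreover have "(Ln has_derivative (\<lambda>h. h)) (at (f x / f x))"
    using has_field_derivative_Ln[of 1] nz by (simp add: has_field_derivative_def mult_1[abs_def])
  ultimately have "((\<lambda>y. Ln (f y / f x)) has_derivative (\<lambda>v. D v / f x)) (at x)"
    by (rule has_derivative_compose)
  then have *: "((\<lambda>y. of_real (Re (Ln (f y / f x))) + of_real (ln (cmod (f x)))) has_derivative
      (\<lambda>v. complex_of_real (Re (D v / f x)))) (at x)"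
    by (intro has_derivative_add_const bounded_linear.has_derivative[OF bounded_linear_of_real]
        bounded_linear.has_derivative[OF bounded_linear_Re])
  have "isCont f x" using f has_derivative_continuous by blast
  then have "eventually (\<lambda>y. f y \<noteq> 0) (nhds x)"
    using nz by (simp add: continuous_within t1_space_nhds tendsto_imp_eventually_ne isCont_def
        eventually_nhds_conv_at)
  then obtain S where S: "open S" "x \<in> S" "\<And>y. y \<in> S \<Longrightarrow> f y \<noteq> 0"
    unfolding eventually_nhds by blast
  from * show ?thesis
  proof (rule has_derivative_transform_within_open[OF _ S(1,2)])
    fix y assume "y \<in> S"
    then show "of_real (Re (Ln (f y / f x))) + of_real (ln (cmod (f x))) = complex_of_real (ln (cmod (f y)))"
      using S(3) nz by (simp add: norm_divide ln_div flip: of_real_add)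
  qed
qed

text \<open>The derivative in direction v is the real part of the holomorphic function with
  numerator the v-derivative of f and denominator f, so no global branch of the logarithm is
  chosen.\<close>

lemma smooth_on_ln_cmod:
  assumes W: "open W" and f: "cholomorphic_on f W" and nz: "\<And>x. x \<in> W \<Longrightarrow> f x \<noteq> 0"
  shows "smooth_on (\<lambda>x. complex_of_real (ln (cmod (f x)))) W"
proof (rule smooth_on_SucI[OF W])
  fix x assume "x \<in> W"
  then show "((\<lambda>x. complex_of_real (ln (cmod (f x)))) has_derivative
    (\<lambda>v. of_real (Re (frechet_derivative f (at x) v / f x)))) (at x)"
    by (intro has_derivative_ln_cmod cholomorphic_on_has_derivative(1)[OF f] nz)
next
  fix v
  have "cholomorphic_on (\<lambda>x. frechet_derivative f (at x) v * inverse (f x)) W"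
    by (intro cholomorphic_on_mult cholomorphic_on_deriv[OF f W] cholomorphic_on_compose[OF f, of inverse])
      (rule DERIV_inverse[OF nz])
  then have "smooth_on (\<lambda>x. complex_of_real (Re (frechet_derivative f (at x) v * inverse (f x)))) W"
    by (intro smooth_on_bounded_linear[of "\<lambda>x. complex_of_real (Re x)"] W smooth_on_cholomorphic
        bounded_linear_compose[OF bounded_linear_of_real bounded_linear_Re])
  then show "smooth_on (\<lambda>x. complex_of_real (Re (frechet_derivative f (at x) v / f x))) W"
    by (simp add: divide_inverse)
qed

section \<open>Functions in charts\<close>

lemma complex_manifold_chart:
  assumes "complex_manifold A" "C \<in> A"
  shows "open (fst C)" "open (snd C ` fst C)"
    "homeomorphism (fst C) (snd C ` fst C) (snd C) (chart_inv C)"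
  using assms unfolding complex_manifold_def by auto

lemma chart_inv_chart:
  assumes "complex_manifold A" "C \<in> A" "p \<in> fst C"
  shows "chart_inv C (snd C p) = p"
  using complex_manifold_chart(3)[OF assms(1,2)] assms(3) by (simp add: homeomorphism_def)

lemma open_chart_image:
  assumes A: "complex_manifold A" "C \<in> A" and U: "open U"
  shows "open (snd C ` (U \<inter> fst C))"
proof -
  have "openin (top_of_set (snd C ` fst C)) (snd C ` (U \<inter> fst C))"
    by (rule homeomorphism_imp_open_map[OF complex_manifold_chart(3)[OF A]])
      (use openin_open_Int[OF U, of "fst C"] in \<open>simp add: Int_commute\<close>)
  then show ?thesis
    using complex_manifold_chart(2)[OF A] openin_open_eq by blast
qed

lemma chart_image:
  assumes "complex_manifold A" "C \<in> A" "z \<in> snd C ` (U \<inter> fst C)"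
  shows "chart_inv C z \<in> U \<inter> fst C" "snd C (chart_inv C z) = z"
  using assms(3) chart_inv_chart[OF assms(1,2)] by auto

lemma fun_diff_eqI:
  "(f \<circ> chart_inv C has_derivative D) (at (snd C p)) \<Longrightarrow> fun_diff f C p v = D v"
  unfolding fun_diff_def using frechet_derivative_at by metis

lemma holomorphic_fun_chart:
  assumes "holomorphic_fun A U f" "C \<in> A"
  shows "cholomorphic_on (f \<circ> chart_inv C) (snd C ` (U \<inter> fst C))"
  using assms by (auto simp: holomorphic_fun_def)

lemma holomorphic_fun_has_derivative:
  assumes "holomorphic_fun A U f" "C \<in> A" "p \<in> U \<inter> fst C"
  shows "(f \<circ> chart_inv C has_derivative fun_diff f C p) (at (snd C p))"
  unfolding fun_diff_def[abs_def]
  using cholomorphic_on_has_derivative(1)[OF holomorphic_fun_chart[OF assms(1,2)], of "snd C p"] assms(3) by blast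

lemma fun_diff_scale:
  assumes "holomorphic_fun A U f" "C \<in> A" "p \<in> U \<inter> fst C"
  shows "fun_diff f C p (a *s v) = a * fun_diff f C p v"
  unfolding fun_diff_def
  using cholomorphic_on_has_derivative(2)[OF holomorphic_fun_chart[OF assms(1,2)], of "snd C p"] assms(3) by blast

lemma fun_diff_re_part:
  assumes "(f \<circ> chart_inv C has_derivative D) (at (snd C p))"
  shows "fun_diff (re_part f) C p v = of_real (Re (D v))"
proof (rule fun_diff_eqI)
  show "(re_part f \<circ> chart_inv C has_derivative (\<lambda>v. of_real (Re (D v)))) (at (snd C p))"
    using bounded_linear.has_derivative[OF bounded_linear_compose[OF bounded_linear_of_real bounded_linear_Re] assms]
    by (simp add: re_part_def o_def)
qed

lemma bounded_linear_i_Im: "bounded_linear (\<lambda>z. \<i> * complex_of_real (Im z))"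
  by (intro bounded_linear_mult_const bounded_linear_const_mult
      bounded_linear_compose[OF bounded_linear_of_real bounded_linear_Im])

lemma bounded_linear_of_real_Re: "bounded_linear (\<lambda>z. complex_of_real (Re z))"
  by (rule bounded_linear_compose[OF bounded_linear_of_real bounded_linear_Re])

lemma fun_diff_im_part:
  assumes "(f \<circ> chart_inv C has_derivative D) (at (snd C p))"
  shows "fun_diff (im_part f) C p v = \<i> * of_real (Im (D v))"
proof (rule fun_diff_eqI)
  show "(im_part f \<circ> chart_inv C has_derivative (\<lambda>v. \<i> * of_real (Im (D v)))) (at (snd C p))"
    using bounded_linear.has_derivative[OF bounded_linear_i_Im assms]
    by (simp add: im_part_def o_def)
qed

lemma chart_change_differentiable:
  assumes A: "complex_manifold A" "C \<in> A" "C' \<in> A" and p: "p \<in> fst C \<inter> fst C'"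
  shows "(snd C' \<circ> chart_inv C has_derivative frechet_derivative (snd C' \<circ> chart_inv C) (at (snd C p))) (at (snd C p))"
proof -
  let ?h = "\<lambda>i z. snd C' (chart_inv C z) $ i"
  have "cholomorphic_on (?h i) (snd C ` (fst C \<inter> fst C'))" for i
    using A unfolding complex_manifold_def by blast
  from cholomorphic_on_has_derivative(1)[OF this] p
  have "(?h i has_derivative frechet_derivative (?h i) (at (snd C p))) (at (snd C p))" for i
    by blast
  \<comment> \<open>Transition maps are holomorphic coordinate by coordinate; the vector-valued
    derivative is reassembled from the coordinates.\<close>
  then have der: "((\<lambda>z. \<Sum>i\<in>UNIV. axis i (?h i z)) has_derivative
      (\<lambda>v. \<Sum>i\<in>UNIV. axis i (frechet_derivative (?h i) (at (snd C p)) v))) (at (snd C p))"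
    by (intro has_derivative_sum bounded_linear.has_derivative[where f="axis _"]
        linear_conv_bounded_linear[THEN iffD1] linearI)
      (auto simp: axis_def vec_eq_iff)
  have "(\<lambda>z. \<Sum>i\<in>UNIV. axis i (?h i z)) = snd C' \<circ> chart_inv C"
    by (auto simp: fun_eq_iff vec_eq_iff axis_def if_distrib[of "\<lambda>x. vec_nth x _"] cong: if_cong)
  from der[unfolded this] show ?thesis
    by (intro frechet_derivative_works[THEN iffD1] differentiableI)
qed

text \<open>The chain rule for the transition map, which is the chart independence demanded by
  \<open>is_form\<close>. It is stated for differentiable functions because it is also applied to
  real and imaginary parts.\<close>

lemma fun_diff_chart_change:
  assumes A: "complex_manifold A" "C \<in> A" "C' \<in> A" and p: "p \<in> fst C \<inter> fst C'"
    and f: "(f \<circ> chart_inv C') differentiable (at (snd C' p))"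
  shows "fun_diff f C' p (frechet_derivative (snd C' \<circ> chart_inv C) (at (snd C p)) v) = fun_diff f C p v"
proof -
  let ?T = "frechet_derivative (snd C' \<circ> chart_inv C) (at (snd C p))"
  have "(f \<circ> chart_inv C' has_derivative fun_diff f C' p) (at ((snd C' \<circ> chart_inv C) (snd C p)))"
    using f p chart_inv_chart[OF A(1,2), of p] unfolding fun_diff_def[abs_def]
    by (simp add: frechet_derivative_works)
  from diff_chain_at[OF chart_change_differentiable[OF A p] this]
  have "((f \<circ> chart_inv C') \<circ> (snd C' \<circ> chart_inv C) has_derivative fun_diff f C' p \<circ> ?T) (at (snd C p))" .
  then have "(f \<circ> chart_inv C has_derivative fun_diff f C' p \<circ> ?T) (at (snd C p))"
  proof (rule has_derivative_transform_within_open)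
    show "open (snd C ` (fst C' \<inter> fst C))"
      by (rule open_chart_image[OF A(1,2) complex_manifold_chart(1)[OF A(1,3)]])
    show "snd C p \<in> snd C ` (fst C' \<inter> fst C)" using p by blast
    fix z assume "z \<in> snd C ` (fst C' \<inter> fst C)"
    then show "((f \<circ> chart_inv C') \<circ> (snd C' \<circ> chart_inv C)) z = (f \<circ> chart_inv C) z"
      using chart_image[OF A(1,2)] chart_inv_chart[OF A(1,3)] by auto
  qed
  from fun_diff_eqI[OF this] show ?thesis by simp
qed

lemma re_im_part_differentiable:
  assumes "(f \<circ> chart_inv C) differentiable (at z)"
  shows "(re_part f \<circ> chart_inv C) differentiable (at z)" "(im_part f \<circ> chart_inv C) differentiable (at z)"
proof -
  obtain D where D: "(f \<circ> chart_inv C has_derivative D) (at z)"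
    using assms differentiable_def by blast
  show "(re_part f \<circ> chart_inv C) differentiable (at z)"
    using bounded_linear.has_derivative[OF bounded_linear_of_real_Re D]
    by (intro differentiableI) (simp add: re_part_def o_def)
  show "(im_part f \<circ> chart_inv C) differentiable (at z)"
    using bounded_linear.has_derivative[OF bounded_linear_i_Im D]
    by (intro differentiableI) (simp add: im_part_def o_def)
qed

text \<open>At p the branch evaluates \<open>Ln\<close> at f p / f p = 1, where its derivative is 1,
  wherever f p lies relative to the branch cut.\<close>

lemma log_branch_has_derivative:
  assumes f: "(f \<circ> chart_inv C has_derivative D) (at (snd C p))" and nz: "f p \<noteq> 0"
    and p: "chart_inv C (snd C p) = p"
  shows "(log_branch p f \<circ> chart_inv C has_derivative (\<lambda>v. D v / f p)) (at (snd C p))"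
proof -
  have "((\<lambda>z. (f \<circ> chart_inv C) z / f p) has_derivative (\<lambda>v. D v / f p)) (at (snd C p))"
    using bounded_linear.has_derivative[OF bounded_linear_divide f] .
  moreover have "(Ln has_derivative (\<lambda>h. h)) (at ((f \<circ> chart_inv C) (snd C p) / f p))"
    using has_field_derivative_Ln[of 1] nz p by (simp add: has_field_derivative_def mult_1[abs_def])
  ultimately have "((\<lambda>z. Ln ((f \<circ> chart_inv C) z / f p)) has_derivative (\<lambda>v. D v / f p)) (at (snd C p))"
    by (rule has_derivative_compose)
  then have "((\<lambda>z. Ln (f p) + Ln ((f \<circ> chart_inv C) z / f p)) has_derivative (\<lambda>v. 0 + D v / f p)) (at (snd C p))"
    by (intro has_derivative_add has_derivative_const)
  then show ?thesis by (simp add: log_branch_def o_def)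
qed

lemma holomorphic_fun_log_branch:
  assumes A: "complex_manifold A" and f: "holomorphic_fun A U f" "C \<in> A" "p \<in> U \<inter> fst C" and nz: "f p \<noteq> 0"
  shows "(log_branch p f \<circ> chart_inv C has_derivative (\<lambda>v. fun_diff f C p v / f p)) (at (snd C p))"
  using f(3) by (intro log_branch_has_derivative holomorphic_fun_has_derivative[OF f] nz chart_inv_chart[OF A f(2)]) auto

lemma re_part_log_branch: "f p \<noteq> 0 \<Longrightarrow> re_part (log_branch p f) p = of_real (ln (cmod (f p)))"
  by (simp add: re_part_def log_branch_def)

section \<open>Sections of the structure sheaf\<close>

lemma hol_sections_simps [simp]:
  "f \<in> carrier (hol_sections A U) \<longleftrightarrow> holomorphic_fun A U f \<and> (\<forall>x. x \<notin> U \<longrightarrow> f x = 0)"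
  "monoid.mult (hol_sections A U) = (+)" "one (hol_sections A U) = 0"
  by (simp_all add: hol_sections_def)

lemma hol_units_simps [simp]:
  "f \<in> carrier (hol_units A U) \<longleftrightarrow>
    holomorphic_fun A U f \<and> (\<forall>x\<in>U. f x \<noteq> 0) \<and> (\<forall>x. x \<notin> U \<longrightarrow> f x = 1)"
  "monoid.mult (hol_units A U) = (*)" "one (hol_units A U) = 1"
  by (simp_all add: hol_units_def)

lemma holomorphic_fun_add:
  "holomorphic_fun A U f \<Longrightarrow> holomorphic_fun A U g \<Longrightarrow> holomorphic_fun A U (f + g)"
  unfolding holomorphic_fun_def o_def plus_fun_def by (simp add: cholomorphic_on_add)

lemma holomorphic_fun_mult:
  "holomorphic_fun A U f \<Longrightarrow> holomorphic_fun A U g \<Longrightarrow> holomorphic_fun A U (f * g)"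
  unfolding holomorphic_fun_def o_def times_fun_def by (simp add: cholomorphic_on_mult)

lemma holomorphic_fun_const: "holomorphic_fun A U (\<lambda>_. c)"
  by (simp add: holomorphic_fun_def o_def cholomorphic_on_const)

lemma monoid_hol_sections: "monoid (hol_sections A U)"
  using holomorphic_fun_const[of A U 0]
  by (intro monoidI) (auto simp: holomorphic_fun_add zero_fun_def add.assoc fun_eq_iff)

lemma monoid_hol_units: "monoid (hol_units A U)"
  using holomorphic_fun_const[of A U 1]
  by (intro monoidI) (auto simp: holomorphic_fun_mult one_fun_def mult.assoc fun_eq_iff)

lemma holomorphic_fun_exp:
  assumes "holomorphic_fun A U f" shows "holomorphic_fun A U (exp \<circ> f)"
  unfolding holomorphic_fun_def
proof
  fix C assume "C \<in> A"
  from cholomorphic_on_compose[OF holomorphic_fun_chart[OF assms this], of exp exp]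
  show "cholomorphic_on (exp \<circ> f \<circ> chart_inv C) (snd C ` (U \<inter> fst C))"
    by (simp add: o_def DERIV_exp)
qed

lemma holomorphic_fun_cut:
  assumes A: "complex_manifold A" and V: "open V" "V \<subseteq> U" and f: "holomorphic_fun A U f"
  shows "holomorphic_fun A V (cut_fun e V f)"
  unfolding holomorphic_fun_def
proof
  fix C assume C: "C \<in> A"
  have "cholomorphic_on (f \<circ> chart_inv C) (snd C ` (V \<inter> fst C))"
    by (rule cholomorphic_on_subset[OF holomorphic_fun_chart[OF f C]]) (use V in blast)
  then show "cholomorphic_on (cut_fun e V f \<circ> chart_inv C) (snd C ` (V \<inter> fst C))"
    by (rule cholomorphic_on_cong[OF open_chart_image[OF A C V(1)], rotated])
      (use chart_image(1)[OF A C] in \<open>auto simp: cut_fun_def\<close>)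
qed

section \<open>Alternating expressions in lists\<close>

lemma asum_compose_left:
  assumes "\<tau> permutes {..<k}"
  shows "asum k (\<lambda>\<sigma>. F (\<tau> \<circ> \<sigma>)) = of_int (sign \<tau>) * asum k F"
proof -
  have "of_int (sign \<tau>) * asum k F =
    (\<Sum>\<sigma> | \<sigma> permutes {..<k}. of_int (sign \<tau>) * (of_int (sign (\<tau> \<circ> \<sigma>)) * F (\<tau> \<circ> \<sigma>)))"
    unfolding asum_def sum_distrib_left by (rule setum_permutations_compose_left[OF assms])
  also have "\<dots> = asum k (\<lambda>\<sigma>. F (\<tau> \<circ> \<sigma>))"
    unfolding asum_def
  proof (rule sum.cong[OF refl])
    fix \<sigma> assume "\<sigma> \<in> {\<sigma>. \<sigma> permutes {..<k}}"
    then have "(of_int (sign \<tau> * sign (\<tau> \<circ> \<sigma>)) :: 'a) = of_int (sign \<sigma>)"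
      using sign_compose_permutes[OF assms] sign_idempotent[of \<tau>]
      by (simp add: mult.assoc[symmetric])
    then show "of_int (sign \<tau>) * (of_int (sign (\<tau> \<circ> \<sigma>)) * F (\<tau> \<circ> \<sigma>)) = of_int (sign \<sigma>) * F (\<tau> \<circ> \<sigma>)"
      by (metis mult.assoc of_int_mult)
  qed
  finally show ?thesis ..
qed

text \<open>Values of forms at a point are compared in this group over the complex numbers, and
  whole maps in this group over forms; membership in the target is then automatic.\<close>

definition add_group :: "'a::ab_group_add monoid"
  where "add_group = \<lparr>carrier = UNIV, monoid.mult = (+), one = 0\<rparr>"

lemma add_group_simps [simp]:
  "carrier add_group = UNIV" "monoid.mult add_group = (+)" "one add_group = 0"
  by (simp_all add: add_group_def)

lemma comm_group_add_group: "comm_group (add_group :: 'a::ab_group_add monoid)"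
proof (rule comm_groupI)
  fix x :: 'a
  show "\<exists>y\<in>carrier add_group. y \<otimes>\<^bsub>add_group\<^esub> x = \<one>\<^bsub>add_group\<^esub>"
    by (rule bexI[of _ "- x"]) simp_all
qed (simp_all add: algebra_simps)

text \<open>Additivity without alternation; \<open>alternating_map_asum\<close> supplies the latter
  by antisymmetrising.\<close>

definition multiadditive :: "nat \<Rightarrow> ('a, 'b) monoid_scheme \<Rightarrow> ('a list \<Rightarrow> complex) \<Rightarrow> bool"
  where "multiadditive k G F \<longleftrightarrow>
    (\<forall>xs\<in>tuples k G. \<forall>i<k. \<forall>x\<in>carrier G. \<forall>y\<in>carrier G.
       F (xs[i := x \<otimes>\<^bsub>G\<^esub> y]) = F (xs[i := x]) + F (xs[i := y]))"

lemma multiadditiveI: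
  assumes "\<And>xs i x y. length xs = k \<Longrightarrow> set xs \<subseteq> carrier G \<Longrightarrow> i < k \<Longrightarrow> x \<in> carrier G \<Longrightarrow> y \<in> carrier G \<Longrightarrow>
    F (xs[i := x \<otimes>\<^bsub>G\<^esub> y]) = F (xs[i := x]) + F (xs[i := y])"
  shows "multiadditive k G F"
  unfolding multiadditive_def tuples_def using assms by blast

lemma multiadditiveD:
  assumes "multiadditive k G F" "length xs = k" "set xs \<subseteq> carrier G" "i < k" "x \<in> carrier G" "y \<in> carrier G"
  shows "F (xs[i := x \<otimes>\<^bsub>G\<^esub> y]) = F (xs[i := x]) + F (xs[i := y])"
  using assms unfolding multiadditive_def tuples_def by blast

lemma multiadditive_mult_left: "multiadditive k G F \<Longrightarrow> multiadditive k G (\<lambda>xs. c * F xs)"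
  by (intro multiadditiveI) (simp add: multiadditiveD distrib_left)

lemma multiadditive_sum:
  "(\<And>j. j \<in> J \<Longrightarrow> multiadditive k G (F j)) \<Longrightarrow> multiadditive k G (\<lambda>xs. \<Sum>j\<in>J. F j xs)"
  by (intro multiadditiveI, unfold sum.distrib[symmetric], intro sum.cong refl multiadditiveD)

lemma multiadditive_prod:
  assumes "\<And>i x y. i < k \<Longrightarrow> x \<in> carrier G \<Longrightarrow> y \<in> carrier G \<Longrightarrow> \<phi> i (x \<otimes>\<^bsub>G\<^esub> y) = \<phi> i x + \<phi> i y"
  shows "multiadditive k G (\<lambda>xs. \<Prod>i<k. \<phi> i (xs ! i))"
proof (rule multiadditiveI)
  fix xs i x y assume *: "length xs = k" "set xs \<subseteq> carrier G" "i < k" "x \<in> carrier G" "y \<in> carrier G"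
  have "(\<Prod>j<k. \<phi> j (xs[i := w] ! j)) = \<phi> i w * (\<Prod>j\<in>{..<k} - {i}. \<phi> j (xs ! j))" for w
    using * by (subst prod.remove[of _ i]) (auto intro!: prod.cong)
  then show "(\<Prod>j<k. \<phi> j (xs[i := x \<otimes>\<^bsub>G\<^esub> y] ! j)) =
    (\<Prod>j<k. \<phi> j (xs[i := x] ! j)) + (\<Prod>j<k. \<phi> j (xs[i := y] ! j))"
    using * by (simp add: assms distrib_right)
qed

lemma permute_list_update:
  assumes "\<sigma> permutes {..<length xs}" "i < length xs"
  shows "permute_list \<sigma> (xs[i := x]) = (permute_list \<sigma> xs)[inv_into UNIV \<sigma> i := x]"
proof (rule nth_equalityI)
  fix j assume "j < length (permute_list \<sigma> (xs[i := x]))"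
  then have j: "j < length xs" by simp
  then have "\<sigma> j < length xs" using permutes_in_image[OF assms(1)] by auto
  moreover have "\<sigma> j = i \<longleftrightarrow> inv_into UNIV \<sigma> i = j"
    using permutes_inverses[OF assms(1)] by metis
  ultimately show "permute_list \<sigma> (xs[i := x]) ! j = (permute_list \<sigma> xs)[inv_into UNIV \<sigma> i := x] ! j"
    using j assms by (auto simp: permute_list_nth nth_list_update)
qed simp

text \<open>Slot i of the argument is slot \<open>inv_into UNIV \<sigma> i\<close> of the permuted
  list, so additivity survives term by term. With two equal entries, the transposition of their
  positions shows the sum to be its own negative.\<close>

lemma alternating_map_asum:
  assumes F: "multiadditive k G F"
  shows "alternating_map k G add_group (\<lambda>xs. asum k (\<lambda>\<sigma>. F (permute_list \<sigma> xs)))"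
  unfolding alternating_map_def
proof (intro conjI ballI allI impI)
  fix xs i x y assume "xs \<in> tuples k G" and *: "i < k" "x \<in> carrier G" "y \<in> carrier G"
  then have xs: "length xs = k" "set xs \<subseteq> carrier G" by (auto simp: tuples_def)
  show "asum k (\<lambda>\<sigma>. F (permute_list \<sigma> (xs[i := x \<otimes>\<^bsub>G\<^esub> y]))) =
    asum k (\<lambda>\<sigma>. F (permute_list \<sigma> (xs[i := x]))) \<otimes>\<^bsub>add_group\<^esub>
    asum k (\<lambda>\<sigma>. F (permute_list \<sigma> (xs[i := y])))"
    unfolding add_group_simps asum_add[symmetric]
  proof (rule asum_cong)
    fix \<sigma> assume \<sigma>: "\<sigma> permutes {..<k}"
    then have "inv_into UNIV \<sigma> i < k"
      using permutes_in_image[OF permutes_inv[OF \<sigma>], of i] * by simp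
    then show "F (permute_list \<sigma> (xs[i := x \<otimes>\<^bsub>G\<^esub> y])) =
      F (permute_list \<sigma> (xs[i := x])) + F (permute_list \<sigma> (xs[i := y]))"
      using multiadditiveD[OF F, of "permute_list \<sigma> xs" "inv_into UNIV \<sigma> i" x y] * xs \<sigma>
      by (simp add: permute_list_update)
  qed
next
  fix xs i j assume "xs \<in> tuples k G" "i < j" "j < k" and eq: "xs ! i = xs ! j"
  then have *: "length xs = k" "i < k" "j < k" "i \<noteq> j" by (auto simp: tuples_def)
  let ?t = "Transposition.transpose i j"
  have t: "?t permutes {..<k}" using * by (intro permutes_swap_id) auto
  have "asum k (\<lambda>\<sigma>. F (permute_list (?t \<circ> \<sigma>) xs)) = - asum k (\<lambda>\<sigma>. F (permute_list \<sigma> xs))"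
    using asum_compose_left[OF t, of "\<lambda>\<sigma>. F (permute_list \<sigma> xs)"] * by (simp add: sign_swap_id)
  moreover have "permute_list (?t \<circ> \<sigma>) xs = permute_list \<sigma> xs" if "\<sigma> permutes {..<k}" for \<sigma>
  proof -
    have "permute_list ?t xs = xs"
      using * eq t by (intro nth_equalityI) (auto simp: permute_list_nth Transposition.transpose_def)
    then show ?thesis using that * by (simp add: permute_list_compose)
  qed
  ultimately have "asum k (\<lambda>\<sigma>. F (permute_list \<sigma> xs)) = - asum k (\<lambda>\<sigma>. F (permute_list \<sigma> xs))"
    by (simp cong: asum_cong)
  then show "asum k (\<lambda>\<sigma>. F (permute_list \<sigma> xs)) = \<one>\<^bsub>add_group\<^esub>"
    by (simp add: eq_neg_iff_add_eq_0)
qed simp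

lemma asum_permute_list:
  assumes "\<rho> permutes {..<k}" "length xs = k"
  shows "asum k (\<lambda>\<sigma>. F (permute_list \<sigma> (permute_list \<rho> xs))) =
    of_int (sign \<rho>) * asum k (\<lambda>\<sigma>. F (permute_list \<sigma> xs))"
  using asum_compose_left[OF assms(1), of "\<lambda>\<sigma>. F (permute_list \<sigma> xs)"] assms(2)
  by (simp add: permute_list_compose cong: asum_cong)

section \<open>Mixed determinants of lists of functions and vectors\<close>

definition lterm ::
    "nat \<Rightarrow> ('f \<Rightarrow> complex) \<Rightarrow> (nat \<Rightarrow> 'f \<Rightarrow> 'v \<Rightarrow> complex) \<Rightarrow> 'v list \<Rightarrow> 'f list \<Rightarrow> complex"
  where "lterm k x \<gamma> vs xs = x (xs ! 0) * detv k (\<lambda>i l. \<gamma> i (xs ! Suc i) (vs ! l))"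

text \<open>\<open>mix\<close> for lists. Leaving x and \<gamma> abstract lets the same lemmas serve
  holomorphic functions and, with ln |F| and dF / F in their place, logarithms of units.\<close>

definition lmix ::
    "nat \<Rightarrow> ('f \<Rightarrow> complex) \<Rightarrow> (nat \<Rightarrow> 'f \<Rightarrow> 'v \<Rightarrow> complex) \<Rightarrow> 'f list \<Rightarrow> 'v list \<Rightarrow> complex"
  where "lmix k x \<gamma> xs vs = mix k (\<lambda>r. x (xs ! r)) (\<lambda>i r l. \<gamma> i (xs ! r) (vs ! l))"

lemma lmix_asum:
  assumes "length xs = Suc k"
  shows "lmix k x \<gamma> xs vs = asum (Suc k) (\<lambda>\<sigma>. lterm k x \<gamma> vs (permute_list \<sigma> xs))"
  unfolding lmix_def mix_def lterm_def
  by (intro asum_cong arg_cong2[where f="(*)"] detv_cong) (use assms in \<open>auto simp: permute_list_nth\<close>)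

lemma alternating_map_lmix:
  assumes x: "\<And>f g. f \<in> carrier G \<Longrightarrow> g \<in> carrier G \<Longrightarrow> x (f \<otimes>\<^bsub>G\<^esub> g) = x f + x g"
    and \<gamma>: "\<And>i f g v. f \<in> carrier G \<Longrightarrow> g \<in> carrier G \<Longrightarrow> \<gamma> i (f \<otimes>\<^bsub>G\<^esub> g) v = \<gamma> i f v + \<gamma> i g v"
  shows "alternating_map (Suc k) G add_group (\<lambda>xs. lmix k x \<gamma> xs vs)"
proof -
  \<comment> \<open>The undifferentiated factor is made factor 0 of a product over all k + 1 slots,
    so that one lemma on products covers every slot.\<close>
  have "multiadditive (Suc k) G (\<lambda>xs. \<Prod>i<Suc k. case_nat x (\<lambda>i f. \<gamma> i f (vs ! \<tau> i)) i (xs ! i))" for \<tau>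
    using assms by (intro multiadditive_prod) (auto split: nat.split)
  then have "multiadditive (Suc k) G (\<lambda>xs. x (xs ! 0) * (\<Prod>i<k. \<gamma> i (xs ! Suc i) (vs ! \<tau> i)))" for \<tau>
    unfolding prod.lessThan_Suc_shift by simp
  then have "multiadditive (Suc k) G (lterm k x \<gamma> vs)"
    unfolding lterm_def[abs_def] detv_def asum_mult_left[symmetric]
    unfolding asum_def by (intro multiadditive_sum multiadditive_mult_left)
  from alternating_map_asum[OF this]
  show ?thesis
    unfolding alternating_map_def by (simp add: tuples_def lmix_asum)
qed

text \<open>In each Leibniz term exactly one row uses column l, namely the preimage of l under
  \<tau>. Isolating its factor exhibits the linear dependence on the l-th vector.\<close>

lemma detv_update:
  assumes "l < k" "length vs = k"
  shows "detv k (\<lambda>i m. g i (vs[l := v] ! m)) =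
    asum k (\<lambda>\<tau>. g (inv_into UNIV \<tau> l) v * (\<Prod>i\<in>{..<k} - {inv_into UNIV \<tau> l}. g i (vs ! \<tau> i)))"
  unfolding detv_def
proof (rule asum_cong)
  fix \<tau> assume \<tau>: "\<tau> permutes {..<k}"
  define i0 where "i0 = inv_into UNIV \<tau> l"
  have i0: "i0 < k"
    using permutes_in_image[OF permutes_inv[OF \<tau>], of l] assms by (simp add: i0_def)
  have \<tau>i: "\<tau> i = l \<longleftrightarrow> i = i0" for i
    using permutes_inv_eq[OF \<tau>, of l i] by (auto simp: i0_def)
  have "(\<Prod>i<k. g i (vs[l := v] ! \<tau> i)) = g i0 (vs[l := v] ! \<tau> i0) * (\<Prod>i\<in>{..<k} - {i0}. g i (vs[l := v] ! \<tau> i))"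
    using i0 by (intro prod.remove) auto
  also have "vs[l := v] ! \<tau> i0 = v"
    using \<tau>i[of i0] assms by simp
  also have "(\<Prod>i\<in>{..<k} - {i0}. g i (vs[l := v] ! \<tau> i)) = (\<Prod>i\<in>{..<k} - {i0}. g i (vs ! \<tau> i))"
    by (intro prod.cong refl) (simp add: \<tau>i[symmetric])
  finally show "(\<Prod>i<k. g i (vs[l := v] ! \<tau> i)) =
      g (inv_into UNIV \<tau> l) v * (\<Prod>i\<in>{..<k} - {inv_into UNIV \<tau> l}. g i (vs ! \<tau> i))"
    unfolding i0_def .
qed

lemma detv_repeated_column:
  assumes "l < k" "l' < k" "l \<noteq> l'" "\<And>i. G i l = G i l'"
  shows "detv k G = 0"
proof -
  let ?t = "Transposition.transpose l l'"
  have "?t permutes {..<k}" using assms by (intro permutes_swap_id) auto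
  from asum_compose_left[OF this, of "\<lambda>\<tau>. \<Prod>i<k. G i (\<tau> i)"]
  have "asum k (\<lambda>\<tau>. \<Prod>i<k. G i (?t (\<tau> i))) = - detv k G"
    using assms by (simp add: sign_swap_id detv_def)
  moreover have "G i (?t m) = G i m" for i m
    using assms by (simp add: Transposition.transpose_def)
  ultimately have "detv k G = - detv k G" by (simp add: detv_def)
  then show ?thesis by (simp add: eq_neg_iff_add_eq_0)
qed

lemma lmix_update:
  assumes "l < k" "length vs = k"
  shows "lmix k x \<gamma> xs (vs[l := v]) =
    asum (Suc k) (\<lambda>\<sigma>. asum k (\<lambda>\<tau>. x (xs ! \<sigma> 0) *
      (\<gamma> (inv_into UNIV \<tau> l) (xs ! \<sigma> (Suc (inv_into UNIV \<tau> l))) v * (\<Prod>i\<in>{..<k} - {inv_into UNIV \<tau> l}. \<gamma> i (xs ! \<sigma> (Suc i)) (vs ! \<tau> i)))))"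
  unfolding lmix_def mix_def asum_mult_left
  by (intro asum_cong arg_cong2[where f="(*)"] refl detv_update[OF assms, of "\<lambda>i. \<gamma> i (xs ! _ (Suc i))"])

lemma asum_permutes_cong2:
  assumes "\<And>\<sigma> \<tau>. \<sigma> permutes {..<Suc k} \<Longrightarrow> \<tau> permutes {..<k} \<Longrightarrow> F \<sigma> \<tau> = G \<sigma> \<tau>"
  shows "asum (Suc k) (\<lambda>\<sigma>. asum k (F \<sigma>)) = asum (Suc k) (\<lambda>\<sigma>. asum k (G \<sigma>))"
  by (intro asum_cong assms)

lemma permuted_nth_mem:
  assumes "\<sigma> permutes {..<Suc k}" "\<tau> permutes {..<k}" "l < k" "length xs = Suc k"
  shows "xs ! \<sigma> (Suc (inv_into UNIV \<tau> l)) \<in> set xs"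
  using permutes_in_image[OF permutes_inv[OF assms(2)], of l]
    permutes_in_image[OF assms(1), of "Suc (inv_into UNIV \<tau> l)"] assms(3,4) by simp

lemma lmix_add:
  assumes "l < k" "length vs = k" "length xs = Suc k"
    and "\<And>i f. f \<in> set xs \<Longrightarrow> \<gamma> i f (v + w) = \<gamma> i f v + \<gamma> i f w"
  shows "lmix k x \<gamma> xs (vs[l := v + w]) = lmix k x \<gamma> xs (vs[l := v]) + lmix k x \<gamma> xs (vs[l := w])"
  unfolding lmix_update[OF assms(1,2)] asum_add[symmetric]
  by (rule asum_permutes_cong2) (simp add: assms(4) permuted_nth_mem[OF _ _ assms(1,3)] algebra_simps)

lemma lmix_scale:
  assumes "l < k" "length vs = k" "length xs = Suc k"
    and "\<And>i f. f \<in> set xs \<Longrightarrow> \<gamma> i f w = c * \<gamma> i f v"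
  shows "lmix k x \<gamma> xs (vs[l := w]) = c * lmix k x \<gamma> xs (vs[l := v])"
  unfolding lmix_update[OF assms(1,2)] asum_mult_left[symmetric]
  by (rule asum_permutes_cong2) (simp add: assms(4) permuted_nth_mem[OF _ _ assms(1,3)])

lemma lmix_linear:
  assumes "l < k" "length vs = k" "length xs = Suc k"
    and "\<And>i f. f \<in> set xs \<Longrightarrow> linear (\<gamma> i f)"
  shows "linear (\<lambda>v. lmix k x \<gamma> xs (vs[l := v]))"
proof (rule linearI)
  show "lmix k x \<gamma> xs (vs[l := v + w]) = lmix k x \<gamma> xs (vs[l := v]) + lmix k x \<gamma> xs (vs[l := w])" for v w
    by (rule lmix_add[OF assms(1-3)]) (use assms(4) linear_add in blast)
  show "lmix k x \<gamma> xs (vs[l := r *\<^sub>R v]) = r *\<^sub>R lmix k x \<gamma> xs (vs[l := v])" for r v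
    unfolding scaleR_conv_of_real[of r "_ :: complex"]
    by (rule lmix_scale[OF assms(1-3)]) (use linear_cmul[OF assms(4)] in \<open>simp add: scaleR_conv_of_real\<close>)
qed

lemma lmix_repeated:
  assumes "l < l'" "l' < k" "vs ! l = vs ! l'"
  shows "lmix k x \<gamma> xs vs = 0"
proof -
  have "detv k (\<lambda>i m. \<gamma> i (xs ! \<sigma> (Suc i)) (vs ! m)) = 0" for \<sigma>
    by (rule detv_repeated_column[of l k l']) (use assms in auto)
  then show ?thesis by (simp add: lmix_def mix_def asum_def)
qed

lemma lmix_cong:
  assumes "length xs = Suc k" "length ys = Suc k" "length vs = k" "length ws = k"
    and "\<And>r. r < Suc k \<Longrightarrow> x (xs ! r) = y (ys ! r)"
    and "\<And>i r l. i < k \<Longrightarrow> r < Suc k \<Longrightarrow> l < k \<Longrightarrow> \<gamma> i (xs ! r) (vs ! l) = \<delta> i (ys ! r) (ws ! l)"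
  shows "lmix k x \<gamma> xs vs = lmix k y \<delta> ys ws"
  unfolding lmix_def by (rule mix_cong) (use assms in auto)

lemma lmix_permute_list:
  assumes "\<rho> permutes {..<Suc k}" "length xs = Suc k"
  shows "lmix k x \<gamma> (permute_list \<rho> xs) vs = of_int (sign \<rho>) * lmix k x \<gamma> xs vs"
  using asum_permute_list[OF assms, of "lterm k x \<gamma> vs"] assms(2) by (simp add: lmix_asum)

text \<open>Every term uses entry r exactly once, undifferentiated in slot 0 or as a row of the
  determinant, and both vanish. The case in view is a constant with real part 0.\<close>

lemma lmix_zero_row:
  assumes "r < Suc k" "length xs = Suc k" "x (xs ! r) = 0" "\<And>i v. \<gamma> i (xs ! r) v = 0"
  shows "lmix k x \<gamma> xs vs = 0"
proof -
  have "x (xs ! \<sigma> 0) * detv k (\<lambda>i l. \<gamma> i (xs ! \<sigma> (Suc i)) (vs ! l)) = 0" if \<sigma>: "\<sigma> permutes {..<Suc k}" for \<sigma>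
  proof (cases "inv_into UNIV \<sigma> r")
    case 0
    then have "\<sigma> 0 = r" using permutes_inverses[OF \<sigma>] by metis
    then show ?thesis using assms by simp
  next
    case (Suc i)
    then have "\<sigma> (Suc i) = r" using permutes_inverses[OF \<sigma>] by metis
    moreover have "i < k"
      using permutes_in_image[OF permutes_inv[OF \<sigma>], of r] assms Suc by simp
    ultimately have "(\<Prod>j<k. \<gamma> j (xs ! \<sigma> (Suc j)) (vs ! \<tau> j)) = 0" for \<tau>
      using assms(4) by (auto intro!: prod_zero)
    then show ?thesis
      by (simp only: detv_def asum_def mult_zero_right sum.neutral_const)
  qed
  then show ?thesis unfolding lmix_def mix_def asum_def by (intro sum.neutral) auto
qed

text \<open>The value is a polynomial in the values of x and \<gamma>. The instances are the classes
  of smooth and of holomorphic functions.\<close>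

lemma lmix_closed:
  assumes const: "\<And>c. P (\<lambda>_. c)"
    and add: "\<And>f g. P f \<Longrightarrow> P g \<Longrightarrow> P (\<lambda>z. f z + g z)"
    and mult: "\<And>f g. P f \<Longrightarrow> P g \<Longrightarrow> P (\<lambda>z. f z * g z)"
    and xs: "length xs = Suc k" "length vs = k"
    and x: "\<And>f. f \<in> set xs \<Longrightarrow> P (\<lambda>z. x z f)"
    and \<gamma>: "\<And>i f v. f \<in> set xs \<Longrightarrow> v \<in> set vs \<Longrightarrow> P (\<lambda>z. \<gamma> z i f v)"
  shows "P (\<lambda>z. lmix k (x z) (\<gamma> z) xs vs)"
proof -
  have sum: "P (\<lambda>z. \<Sum>i\<in>I. f i z)" if "\<And>i. i \<in> I \<Longrightarrow> P (f i)" for I :: "(nat \<Rightarrow> nat) set" and f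
    using that by (induction I rule: infinite_finite_induct) (simp_all add: const add)
  have prod: "P (\<lambda>z. \<Prod>i\<in>I. f i z)" if "\<And>i. i \<in> I \<Longrightarrow> P (f i)" for I :: "nat set" and f
    using that by (induction I rule: infinite_finite_induct) (simp_all add: const mult)
  have asum: "P (\<lambda>z. asum j (\<lambda>\<sigma>. f \<sigma> z))" if "\<And>\<sigma>. \<sigma> permutes {..<j} \<Longrightarrow> P (f \<sigma>)" for j f
    unfolding asum_def by (intro sum mult const that) simp
  show ?thesis
    unfolding lmix_def mix_def detv_def
  proof (intro asum mult prod x \<gamma>)
    fix \<sigma> assume \<sigma>: "\<sigma> permutes {..<Suc k}"
    then show "xs ! \<sigma> 0 \<in> set xs" using permutes_in_image[OF \<sigma>, of 0] xs by simp
    fix \<tau> i assume \<tau>: "\<tau> permutes {..<k}" and "i \<in> {..<k}"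
    then show "xs ! \<sigma> (Suc i) \<in> set xs" "vs ! \<tau> i \<in> set vs"
      using permutes_in_image[OF \<sigma>, of "Suc i"] permutes_in_image[OF \<tau>, of i] xs by simp_all
  qed
qed

section \<open>Twisted real numbers\<close>

text \<open>Division by 2 pi i exchanges the real and the imaginary axis, which gives the induction
  step. Membership questions become parity computations.\<close>

lemma twisted_reals_iff: "z \<in> twisted_reals m \<longleftrightarrow> (if even m then Im z = 0 else Re z = 0)"
proof (induction m arbitrary: z)
  case 0
  have "z \<in> range complex_of_real \<longleftrightarrow> Im z = 0"
    using complex_is_Real_iff unfolding Reals_def by blast
  then show ?case by (simp add: twisted_reals_def)
next
  case (Suc m)
  have "z \<in> twisted_reals (Suc m) \<longleftrightarrow> z / (2 * of_real pi * \<i>) \<in> twisted_reals m"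
    by (auto simp: twisted_reals_def image_iff divide_eq_eq mult_ac)
  also have "z / (2 * of_real pi * \<i>) = Complex (Im z / (2 * pi)) (- Re z / (2 * pi))"
    by (simp add: complex_eq_iff Re_divide Im_divide power2_eq_square)
  finally show ?case by (simp add: Suc.IH)
qed

lemma twisted_reals_parity: "even m = even n \<Longrightarrow> z \<in> twisted_reals m \<longleftrightarrow> z \<in> twisted_reals n"
  by (simp add: twisted_reals_iff)

lemma twisted_reals_zero [simp]: "0 \<in> twisted_reals m"
  by (simp add: twisted_reals_iff)

lemma twisted_reals_add: "z \<in> twisted_reals m \<Longrightarrow> w \<in> twisted_reals m \<Longrightarrow> z + w \<in> twisted_reals m"
  by (simp add: twisted_reals_iff split: if_splits)

lemma twisted_reals_mult:
  "z \<in> twisted_reals m \<Longrightarrow> w \<in> twisted_reals n \<Longrightarrow> z * w \<in> twisted_reals (m + n)"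
  by (auto simp: twisted_reals_iff split: if_splits)

lemma twisted_reals_sum: "(\<And>i. i \<in> I \<Longrightarrow> f i \<in> twisted_reals m) \<Longrightarrow> (\<Sum>i\<in>I. f i) \<in> twisted_reals m"
  by (induction I rule: infinite_finite_induct) (simp_all add: twisted_reals_add)

lemma twisted_reals_prod:
  "finite I \<Longrightarrow> (\<And>i. i \<in> I \<Longrightarrow> f i \<in> twisted_reals (d i)) \<Longrightarrow> (\<Prod>i\<in>I. f i) \<in> twisted_reals (\<Sum>i\<in>I. d i)"
  by (induction I rule: finite_induct) (simp_all add: twisted_reals_mult, simp add: twisted_reals_iff)

lemma twisted_reals_real_mult:
  assumes "Im c = 0" "z \<in> twisted_reals m" shows "c * z \<in> twisted_reals m"
  using twisted_reals_mult[of c 0 z m] assms by (simp add: twisted_reals_iff)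

lemma twisted_reals_asum:
  "(\<And>\<sigma>. \<sigma> permutes {..<k} \<Longrightarrow> F \<sigma> \<in> twisted_reals m) \<Longrightarrow> asum k F \<in> twisted_reals m"
  unfolding asum_def by (intro twisted_reals_sum twisted_reals_real_mult) auto

lemma two_pi_i_power_twisted: "(2 * of_real pi * \<i>) ^ m \<in> twisted_reals m"
  unfolding twisted_reals_def by (rule range_eqI[of _ _ 1]) simp

lemma lmix_twisted:
  assumes xs: "length xs = Suc k" "length vs = k"
    and x: "\<And>f. f \<in> set xs \<Longrightarrow> x f \<in> twisted_reals a"
    and \<gamma>: "\<And>i f v. f \<in> set xs \<Longrightarrow> \<gamma> i f v \<in> twisted_reals (b i)"
  shows "lmix k x \<gamma> xs vs \<in> twisted_reals (a + (\<Sum>i<k. b i))"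
  unfolding lmix_def mix_def detv_def
proof (rule twisted_reals_asum, intro twisted_reals_mult twisted_reals_asum)
  fix \<sigma> assume \<sigma>: "\<sigma> permutes {..<Suc k}"
  show "x (xs ! \<sigma> 0) \<in> twisted_reals a"
    using permutes_in_image[OF \<sigma>, of 0] xs by (intro x) simp
  fix \<tau> :: "nat \<Rightarrow> nat"
  show "(\<Prod>i<k. \<gamma> i (xs ! \<sigma> (Suc i)) (vs ! \<tau> i)) \<in> twisted_reals (\<Sum>i<k. b i)"
  proof (rule twisted_reals_prod)
    fix i assume "i \<in> {..<k}"
    then show "\<gamma> i (xs ! \<sigma> (Suc i)) (vs ! \<tau> i) \<in> twisted_reals (b i)"
      using permutes_in_image[OF \<sigma>, of "Suc i"] xs by (intro \<gamma>) simp
  qed simp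
qed

text \<open>There are k - q imaginary rows. The index a + k + q has the parity of a + (k - q) and
  avoids subtraction of natural numbers.\<close>

lemma lmix_re_im_twisted:
  assumes xs: "length xs = Suc k" "length vs = k"
    and x: "\<And>f. f \<in> set xs \<Longrightarrow> x f \<in> twisted_reals a"
    and \<alpha>: "\<And>f v. f \<in> set xs \<Longrightarrow> \<alpha> f v \<in> twisted_reals 0"
    and \<beta>: "\<And>f v. f \<in> set xs \<Longrightarrow> \<beta> f v \<in> twisted_reals 1"
    and q: "q \<le> k"
  shows "lmix k x (\<lambda>i. if i < q then \<alpha> else \<beta>) xs vs \<in> twisted_reals (a + k + q)"
proof -
  have "lmix k x (\<lambda>i. if i < q then \<alpha> else \<beta>) xs vs \<in>
    twisted_reals (a + (\<Sum>i<k. if i < q then 0 else 1))"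
    by (rule lmix_twisted[OF xs x]) (use \<alpha> \<beta> in \<open>auto\<close>)
  moreover have "(\<Sum>i<k. if i < q then 0 else 1) = k - q"
  proof -
    have "(\<Sum>i<k. if i < q then 0 else 1) = card {i \<in> {..<k}. \<not> i < q}"
      unfolding card_eq_sum by (rule sum.mono_neutral_cong_right) auto
    also have "{i \<in> {..<k}. \<not> i < q} = {q..<k}" by auto
    finally show ?thesis by simp
  qed
  ultimately show ?thesis
    using twisted_reals_parity[of "a + (k - q)" "a + k + q"] q by simp
qed

section \<open>Evaluation of forms\<close>

lemma sum_form_apply: "(\<Sum>j\<in>J. F j) C p vs = (\<Sum>j\<in>J. F j C p vs)"
  by (induction J rule: infinite_finite_induct) (simp_all add: zero_fun_def plus_fun_def)

lemma alt_sum_apply: "alt_sum F xs C p vs = asum (length xs) (\<lambda>\<sigma>. F (permute_list \<sigma> xs) C p vs)"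
  by (simp add: alt_sum_def sum_form_apply scale_form_def asum_def)

lemma wedge_d_apply:
  assumes "C \<in> A" "p \<in> U \<inter> fst C" "length vs = length gs"
  shows "wedge_d A U gs C p vs = detv (length gs) (\<lambda>i l. fun_diff (gs ! i) C p (vs ! l))"
  using assms by (simp add: wedge_d_def cut_form_def detv_def asum_def)

lemma wedge_d_zero:
  "\<not> (C \<in> A \<and> p \<in> U \<inter> fst C \<and> length vs = length gs) \<Longrightarrow> wedge_d A U gs C p vs = 0"
  unfolding wedge_d_def cut_form_def by (simp only: if_False)

text \<open>Multiplied by m!, this is the binomial coefficient m choose 2 j + 1 when 2 j + 1 \<le>
  m.\<close>

definition rcoef :: "nat \<Rightarrow> nat \<Rightarrow> complex"
  where "rcoef m j = 1 / (fact (2 * j + 1) * fact (m - 2 * j - 1))"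

lemma Im_rcoef [simp]: "Im (rcoef m j) = 0"
proof -
  have "rcoef m j = complex_of_real (1 / (fact (2 * j + 1) * fact (m - 2 * j - 1)))"
    by (simp add: rcoef_def)
  then show ?thesis by (simp only: Im_complex_of_real)
qed

text \<open>The value of \<open>r_tilde\<close> depends only on the values \<open>a f\<close> of \<open>Re f\<close> and the differentials \<open>\<alpha> f\<close> and
  \<open>\<beta> f\<close> of \<open>Re f\<close> and \<open>i Im f\<close> at the point. These make sense for \<open>log F\<close> without choosing a
  logarithm, and then they are additive in \<open>F\<close>.\<close>

definition rval ::
    "('f \<Rightarrow> complex) \<Rightarrow> ('f \<Rightarrow> 'v \<Rightarrow> complex) \<Rightarrow> ('f \<Rightarrow> 'v \<Rightarrow> complex) \<Rightarrow> 'f list \<Rightarrow> 'v list \<Rightarrow> complex"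
  where "rval a \<alpha> \<beta> xs vs = (\<Sum>j | 2 * j + 1 \<le> length xs.
    rcoef (length xs) j * lmix (length xs - 1) a (\<lambda>i. if i < 2 * j then \<alpha> else \<beta>) xs vs)"

lemma r_tilde_zero:
  assumes "fs \<noteq> []" "\<not> (C \<in> A \<and> p \<in> U \<inter> fst C \<and> Suc (length vs) = length fs)"
  shows "r_tilde A U fs C p vs = 0"
proof -
  have "wedge_d A U (map re_part (take q (tl gs)) @ map im_part (drop q (tl gs))) C p vs = 0"
    if "length gs = length fs" for gs and q :: nat
    using assms that by (intro wedge_d_zero) (auto simp: min_def)
  then show ?thesis
    by (simp add: r_tilde_def Let_def alt_sum_apply sum_form_apply scale_form_def fun_mult_def asum_def)
qed

lemma r_tilde_apply:
  assumes C: "C \<in> A" "p \<in> U \<inter> fst C" and len: "length fs = Suc k" "length vs = k"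
  shows "r_tilde A U fs C p vs =
    rval (\<lambda>f. re_part f p) (\<lambda>f. fun_diff (re_part f) C p) (\<lambda>f. fun_diff (im_part f) C p) fs vs"
proof -
  let ?\<gamma> = "\<lambda>j i f. fun_diff (if i < 2 * j then re_part f else im_part f) C p"
  have "r_tilde A U fs C p vs = (\<Sum>j | 2 * j + 1 \<le> length fs. rcoef (length fs) j *
    asum (Suc k) (\<lambda>\<sigma>. re_part (hd (permute_list \<sigma> fs)) p *
      wedge_d A U (map re_part (take (2 * j) (tl (permute_list \<sigma> fs))) @
        map im_part (drop (2 * j) (tl (permute_list \<sigma> fs)))) C p vs))"
    unfolding r_tilde_def Let_def alt_sum_apply sum_form_apply scale_form_def fun_mult_def asum_sum
      asum_mult_left rcoef_def len ..
  also have "\<dots> = (\<Sum>j | 2 * j + 1 \<le> length fs. rcoef (length fs) j *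
    lmix k (\<lambda>f. re_part f p) (\<lambda>i. if i < 2 * j then (\<lambda>f. fun_diff (re_part f) C p) else (\<lambda>f. fun_diff (im_part f) C p)) fs vs)"
  proof (intro sum.cong refl arg_cong2[where f="(*)"], unfold lmix_def mix_def, intro asum_cong arg_cong2[where f="(*)"])
    fix j \<sigma> assume \<sigma>: "\<sigma> permutes {..<Suc k}"
    have ne: "permute_list \<sigma> fs \<noteq> []" using len by (metis length_0_conv length_permute_list nat.distinct(1))
    then show "re_part (hd (permute_list \<sigma> fs)) p = re_part (fs ! \<sigma> 0) p"
      using \<sigma> len by (simp add: hd_conv_nth permute_list_nth)
    let ?gs = "map re_part (take (2 * j) (tl (permute_list \<sigma> fs))) @
        map im_part (drop (2 * j) (tl (permute_list \<sigma> fs)))"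
    have gs: "length ?gs = k" using len by (simp add: min_def)
    have "wedge_d A U ?gs C p vs = detv k (\<lambda>i l. fun_diff (?gs ! i) C p (vs ! l))"
      using wedge_d_apply[OF C, of vs ?gs] unfolding gs len(2) by simp
    \<comment> \<open>The first 2 j entries of the list are real parts, so the position in the list
      decides the kind of the row.\<close>
    also have "\<dots> = detv k (\<lambda>i l. (if i < 2 * j then (\<lambda>f. fun_diff (re_part f) C p) else (\<lambda>f. fun_diff (im_part f) C p))
        (fs ! \<sigma> (Suc i)) (vs ! l))"
      using \<sigma> len by (intro detv_cong) (auto simp: nth_append nth_tl permute_list_nth min_def)
    finally show "wedge_d A U ?gs C p vs = \<dots>" .
  qed
  finally show ?thesis by (simp add: rval_def len)
qed

section \<open>Groups of differential forms\<close>

lemma cut_form_eq_iff: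
  "cut_form A U k \<omega> = \<omega> \<longleftrightarrow>
    (\<forall>C p vs. \<not> (C \<in> A \<and> p \<in> U \<inter> fst C \<and> length vs = k) \<longrightarrow> \<omega> C p vs = 0)"
  unfolding cut_form_def fun_eq_iff by (metis (no_types, opaque_lifting))

lemma is_formI:
  assumes "\<And>C p vs. \<not> (C \<in> A \<and> p \<in> U \<inter> fst C \<and> length vs = k) \<Longrightarrow> \<omega> C p vs = 0"
    and "\<And>C p vs i. C \<in> A \<Longrightarrow> p \<in> U \<inter> fst C \<Longrightarrow> length vs = k \<Longrightarrow> i < k \<Longrightarrow>
      linear (\<lambda>v. \<omega> C p (vs[i := v]))"
    and "\<And>C p vs i j. C \<in> A \<Longrightarrow> p \<in> U \<inter> fst C \<Longrightarrow> length vs = k \<Longrightarrow> i < j \<Longrightarrow> j < k \<Longrightarrow>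
      vs ! i = vs ! j \<Longrightarrow> \<omega> C p vs = 0"
    and "\<And>C C' p vs. C \<in> A \<Longrightarrow> C' \<in> A \<Longrightarrow> p \<in> U \<inter> fst C \<inter> fst C' \<Longrightarrow> length vs = k \<Longrightarrow>
      \<omega> C' p (map (frechet_derivative (snd C' \<circ> chart_inv C) (at (snd C p))) vs) = \<omega> C p vs"
  shows "is_form A U k \<omega>"
  unfolding is_form_def cut_form_eq_iff using assms by blast

lemma is_formD:
  assumes "is_form A U k \<omega>"
  shows "\<not> (C \<in> A \<and> p \<in> U \<inter> fst C \<and> length vs = k) \<Longrightarrow> \<omega> C p vs = 0"
    and "C \<in> A \<Longrightarrow> p \<in> U \<inter> fst C \<Longrightarrow> length vs = k \<Longrightarrow> i < k \<Longrightarrow> linear (\<lambda>v. \<omega> C p (vs[i := v]))"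
    and "C \<in> A \<Longrightarrow> p \<in> U \<inter> fst C \<Longrightarrow> length vs = k \<Longrightarrow> i < j \<Longrightarrow> j < k \<Longrightarrow>
      vs ! i = vs ! j \<Longrightarrow> \<omega> C p vs = 0"
    and "C \<in> A \<Longrightarrow> C' \<in> A \<Longrightarrow> p \<in> U \<inter> fst C \<inter> fst C' \<Longrightarrow> length vs = k \<Longrightarrow>
      \<omega> C' p (map (frechet_derivative (snd C' \<circ> chart_inv C) (at (snd C p))) vs) = \<omega> C p vs"
  using assms unfolding is_form_def cut_form_eq_iff by blast+

lemma linear_cmult: "linear f \<Longrightarrow> linear (\<lambda>v. (c :: complex) * f v)"
  by (rule linearI) (simp_all add: linear_add linear_cmul algebra_simps)

lemma is_form_add:
  assumes "is_form A U k \<omega>" "is_form A U k \<eta>" shows "is_form A U k (\<omega> + \<eta>)"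
  by (rule is_formI)
    (simp_all add: plus_fun_def is_formD(1,3,4)[OF assms(1)] is_formD(1,3,4)[OF assms(2)]
      linear_compose_add[OF is_formD(2)[OF assms(1)] is_formD(2)[OF assms(2)]]
      del: de_Morgan_conj not_all)

lemma is_form_fun_mult:
  assumes "is_form A U k \<omega>" shows "is_form A U k (fun_mult f \<omega>)"
  by (rule is_formI)
    (simp_all add: fun_mult_def is_formD(1,3,4)[OF assms] linear_cmult[OF is_formD(2)[OF assms]]
      del: de_Morgan_conj not_all)

lemma scale_form_fun_mult: "scale_form c \<omega> = fun_mult (\<lambda>_. c) \<omega>"
  by (simp add: scale_form_def fun_mult_def)

lemma is_form_zero: "is_form A U k 0"
  by (rule is_formI) (simp_all add: zero_fun_def module_hom_zero linear_zero)


lemma smooth_forms_carrier: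
  "\<omega> \<in> carrier (smooth_forms A m k U) \<longleftrightarrow>
    is_form A U k \<omega> \<and> (\<forall>C p vs. \<omega> C p vs \<in> twisted_reals m) \<and>
    (\<forall>C\<in>A. \<forall>vs. length vs = k \<longrightarrow> smooth_on (\<lambda>z. \<omega> C (chart_inv C z) vs) (snd C ` (U \<inter> fst C)))"
  by (simp add: smooth_forms_def)

lemma smooth_forms_simps [simp]:
  "monoid.mult (smooth_forms A m k U) = (+)" "one (smooth_forms A m k U) = 0"
  by (simp_all add: smooth_forms_def)

lemma holomorphic_forms_carrier:
  "\<omega> \<in> carrier (holomorphic_forms A k U) \<longleftrightarrow>
    is_form A U k \<omega> \<and>
    (\<forall>C p vs i a. i < length vs \<longrightarrow> \<omega> C p (vs[i := a *s vs ! i]) = a * \<omega> C p vs) \<and>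
    (\<forall>C\<in>A. \<forall>vs. length vs = k \<longrightarrow> cholomorphic_on (\<lambda>z. \<omega> C (chart_inv C z) vs) (snd C ` (U \<inter> fst C)))"
  by (simp add: holomorphic_forms_def)

lemma holomorphic_forms_simps [simp]:
  "monoid.mult (holomorphic_forms A k U) = (+)" "one (holomorphic_forms A k U) = 0"
  by (simp_all add: holomorphic_forms_def)

lemma smooth_forms_fun_mult:
  assumes A: "complex_manifold A" "open U" and \<omega>: "\<omega> \<in> carrier (smooth_forms A m k U)"
    and f: "\<And>p. f p \<in> twisted_reals a" "\<And>C. C \<in> A \<Longrightarrow> smooth_on (f \<circ> chart_inv C) (snd C ` (U \<inter> fst C))"
  shows "fun_mult f \<omega> \<in> carrier (smooth_forms A (a + m) k U)"
  using \<omega> f open_chart_image[OF A(1) _ A(2)] unfolding smooth_forms_carrier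
  by (auto simp: is_form_fun_mult[unfolded fun_mult_def] fun_mult_def o_def intro!: twisted_reals_mult smooth_on_mult)

lemma smooth_forms_scale:
  assumes A: "complex_manifold A" "open U" and \<omega>: "\<omega> \<in> carrier (smooth_forms A m k U)"
    and c: "c \<in> twisted_reals a"
  shows "scale_form c \<omega> \<in> carrier (smooth_forms A (a + m) k U)"
  unfolding scale_form_fun_mult
  by (rule smooth_forms_fun_mult[OF A \<omega> c])
    (simp add: o_def smooth_on_const open_chart_image[OF A(1) _ A(2)])

lemma smooth_forms_real_scale:
  assumes "complex_manifold A" "open U" "\<omega> \<in> carrier (smooth_forms A m k U)" "Im c = 0"
  shows "scale_form c \<omega> \<in> carrier (smooth_forms A m k U)"
  using smooth_forms_scale[OF assms(1-3), of c 0] assms(4) by (simp add: twisted_reals_iff)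

lemma smooth_forms_zero: "complex_manifold A \<Longrightarrow> open U \<Longrightarrow> 0 \<in> carrier (smooth_forms A m k U)"
  unfolding smooth_forms_carrier
  by (simp add: is_form_zero smooth_on_const open_chart_image)

lemma smooth_forms_add:
  assumes "complex_manifold A" "open U" "\<omega> \<in> carrier (smooth_forms A m k U)" "\<eta> \<in> carrier (smooth_forms A m k U)"
  shows "\<omega> + \<eta> \<in> carrier (smooth_forms A m k U)"
  using assms unfolding smooth_forms_carrier
  by (auto simp: is_form_add twisted_reals_add smooth_on_add open_chart_image)

lemma smooth_forms_sum:
  assumes "complex_manifold A" "open U" "\<And>i. i \<in> I \<Longrightarrow> \<omega> i \<in> carrier (smooth_forms A m k U)"
  shows "(\<Sum>i\<in>I. \<omega> i) \<in> carrier (smooth_forms A m k U)"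
  using assms(3)
  by (induction I rule: infinite_finite_induct) (simp_all add: smooth_forms_zero smooth_forms_add assms(1,2))

lemma scale_form_minus_one: "scale_form (-1) \<omega> = - \<omega>"
  by (simp add: scale_form_def fun_eq_iff)

lemma comm_group_smooth_forms:
  assumes A: "complex_manifold A" "open U"
  shows "comm_group (smooth_forms A m k U)"
proof (rule comm_groupI)
  fix \<omega> assume "\<omega> \<in> carrier (smooth_forms A m k U)"
  from smooth_forms_real_scale[OF A this, of "-1"]
  show "\<exists>\<eta>\<in>carrier (smooth_forms A m k U). \<eta> \<otimes>\<^bsub>smooth_forms A m k U\<^esub> \<omega> = \<one>\<^bsub>smooth_forms A m k U\<^esub>"
    by (intro bexI[of _ "- \<omega>"]) (simp_all add: scale_form_minus_one)
qed (simp_all add: smooth_forms_zero smooth_forms_add A algebra_simps)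

lemma holomorphic_forms_fun_mult:
  assumes \<omega>: "\<omega> \<in> carrier (holomorphic_forms A k U)"
    and f: "\<And>C. C \<in> A \<Longrightarrow> cholomorphic_on (f \<circ> chart_inv C) (snd C ` (U \<inter> fst C))"
  shows "fun_mult f \<omega> \<in> carrier (holomorphic_forms A k U)"
  using \<omega> f unfolding holomorphic_forms_carrier
  by (auto simp: is_form_fun_mult[unfolded fun_mult_def] fun_mult_def o_def intro!: cholomorphic_on_mult)

lemma holomorphic_forms_scale:
  assumes "\<omega> \<in> carrier (holomorphic_forms A k U)"
  shows "scale_form c \<omega> \<in> carrier (holomorphic_forms A k U)"
  unfolding scale_form_fun_mult
  by (rule holomorphic_forms_fun_mult[OF assms]) (simp add: o_def cholomorphic_on_const)

lemma holomorphic_forms_zero: "0 \<in> carrier (holomorphic_forms A k U)"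
  unfolding holomorphic_forms_carrier by (simp add: is_form_zero cholomorphic_on_const)

lemma holomorphic_forms_add:
  "\<omega> \<in> carrier (holomorphic_forms A k U) \<Longrightarrow> \<eta> \<in> carrier (holomorphic_forms A k U) \<Longrightarrow>
    \<omega> + \<eta> \<in> carrier (holomorphic_forms A k U)"
  unfolding holomorphic_forms_carrier
  by (auto simp: is_form_add cholomorphic_on_add distrib_left)

lemma comm_group_holomorphic_forms: "comm_group (holomorphic_forms A k U)"
proof (rule comm_groupI)
  fix \<omega> assume "\<omega> \<in> carrier (holomorphic_forms A k U)"
  from holomorphic_forms_scale[OF this, of "-1"]
  show "\<exists>\<eta>\<in>carrier (holomorphic_forms A k U). \<eta> \<otimes>\<^bsub>holomorphic_forms A k U\<^esub> \<omega> = \<one>\<^bsub>holomorphic_forms A k U\<^esub>"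
    by (intro bexI[of _ "- \<omega>"]) (simp_all add: scale_form_minus_one)
qed (simp_all add: holomorphic_forms_zero holomorphic_forms_add algebra_simps)

text \<open>The list \<open>xs p\<close> may change with p, as branches of logarithms do. All
  conditions in \<open>is_form\<close> are imposed point by point, so the dependence on p is
  unconstrained.\<close>

lemma is_form_lmix:
  assumes len: "\<And>p. length (xs p) = Suc k"
    and lin: "\<And>C p i f. C \<in> A \<Longrightarrow> p \<in> U \<inter> fst C \<Longrightarrow> f \<in> set (xs p) \<Longrightarrow> linear (\<gamma> C p i f)"
    and change: "\<And>C C' p i f v. C \<in> A \<Longrightarrow> C' \<in> A \<Longrightarrow> p \<in> U \<inter> fst C \<inter> fst C' \<Longrightarrow> f \<in> set (xs p) \<Longrightarrow>
      \<gamma> C' p i f (frechet_derivative (snd C' \<circ> chart_inv C) (at (snd C p)) v) = \<gamma> C p i f v"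
  shows "is_form A U k (cut_form A U k (\<lambda>C p vs. lmix k (x p) (\<gamma> C p) (xs p) vs))"
proof (rule is_formI, goal_cases)
  case (1 C p vs)
  then show ?case unfolding cut_form_def by (simp only: if_False)
next
  case (2 C p vs i)
  then have "linear (\<lambda>v. lmix k (x p) (\<gamma> C p) (xs p) (vs[i := v]))"
    by (intro lmix_linear len lin) auto
  with 2 show ?case by (simp add: cut_form_def)
next
  case (3 C p vs i j)
  then show ?case by (simp add: cut_form_def lmix_repeated)
next
  case (4 C C' p vs)
  let ?T = "frechet_derivative (snd C' \<circ> chart_inv C) (at (snd C p))"
  have "lmix k (x p) (\<gamma> C' p) (xs p) (map ?T vs) = lmix k (x p) (\<gamma> C p) (xs p) vs"
    by (rule lmix_cong) (use 4 len change in simp_all)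
  with 4 show ?case by (simp add: cut_form_def)
qed

lemma is_form_sum: "(\<And>i. i \<in> I \<Longrightarrow> is_form A U k (\<omega> i)) \<Longrightarrow> is_form A U k (\<Sum>i\<in>I. \<omega> i)"
  by (induction I rule: infinite_finite_induct) (simp_all add: is_form_zero is_form_add)

lemma linear_fun_diff:
  "(f \<circ> chart_inv C) differentiable (at (snd C p)) \<Longrightarrow> linear (fun_diff f C p)"
  unfolding fun_diff_def[abs_def] by (rule linear_frechet_derivative)

lemma is_form_r_tilde:
  assumes A: "complex_manifold A" and len: "\<And>p. length (L p) = Suc k"
    and diff: "\<And>C p f. C \<in> A \<Longrightarrow> p \<in> U \<inter> fst C \<Longrightarrow> f \<in> set (L p) \<Longrightarrow>
      (f \<circ> chart_inv C) differentiable (at (snd C p))"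
  shows "is_form A U k (\<lambda>C p. r_tilde A U (L p) C p)"
proof -
  let ?\<gamma> = "\<lambda>j C p i. if i < 2 * j then (\<lambda>f. fun_diff (re_part f) C p) else (\<lambda>f. fun_diff (im_part f) C p)"
  have eq: "(\<lambda>C p. r_tilde A U (L p) C p) = (\<Sum>j | 2 * j + 1 \<le> Suc k. scale_form (rcoef (Suc k) j)
    (cut_form A U k (\<lambda>C p vs. lmix k (\<lambda>f. re_part f p) (?\<gamma> j C p) (L p) vs)))" (is "?l = ?r")
  proof (intro ext)
    fix C p vs
    show "?l C p vs = ?r C p vs"
    proof (cases "C \<in> A \<and> p \<in> U \<inter> fst C \<and> length vs = k")
      case True
      then show ?thesis
        using r_tilde_apply[of C A p U "L p" k vs]
        by (simp add: len sum_form_apply scale_form_def cut_form_def rval_def)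
    next
      case False
      then have "r_tilde A U (L p) C p vs = 0"
        using len[of p] by (intro r_tilde_zero) auto
      then show ?thesis
        using False unfolding sum_form_apply scale_form_def cut_form_def by (simp only: if_False mult_zero_right sum.neutral_const)
    qed
  qed
  show ?thesis
    unfolding eq scale_form_fun_mult
  proof (intro is_form_sum is_form_fun_mult is_form_lmix len)
    fix j C p i f
    assume "C \<in> A" "p \<in> U \<inter> fst C" "f \<in> set (L p)"
    then show "linear (?\<gamma> j C p i f)"
      using linear_fun_diff[OF re_im_part_differentiable(1)[OF diff]]
        linear_fun_diff[OF re_im_part_differentiable(2)[OF diff]] by simp
  next
    fix j C C' p i f v
    assume *: "C \<in> A" "C' \<in> A" "p \<in> U \<inter> fst C \<inter> fst C'" "f \<in> set (L p)"
    then have p: "p \<in> fst C \<inter> fst C'" by blast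
    have "(f \<circ> chart_inv C') differentiable (at (snd C' p))" using * by (intro diff) auto
    then show "?\<gamma> j C' p i f (frechet_derivative (snd C' \<circ> chart_inv C) (at (snd C p)) v) = ?\<gamma> j C p i f v"
      using fun_diff_chart_change[OF A *(1,2) p re_im_part_differentiable(1)]
        fun_diff_chart_change[OF A *(1,2) p re_im_part_differentiable(2)] by simp
  qed
qed

text \<open>With 2 j real differentials there remain k - 2 j imaginary ones, always of the parity of
  k. This is what the restriction to even numbers of real differentials achieves.\<close>

lemma rval_twisted:
  assumes "length xs = Suc k" "length vs = k"
    and "\<And>f. f \<in> set xs \<Longrightarrow> a f \<in> twisted_reals 0"
    and "\<And>f v. f \<in> set xs \<Longrightarrow> \<alpha> f v \<in> twisted_reals 0"
    and "\<And>f v. f \<in> set xs \<Longrightarrow> \<beta> f v \<in> twisted_reals 1"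
  shows "rval a \<alpha> \<beta> xs vs \<in> twisted_reals k"
  unfolding rval_def
proof (intro twisted_reals_sum twisted_reals_real_mult Im_rcoef)
  fix j assume "j \<in> {j. 2 * j + 1 \<le> length xs}"
  then have "2 * j \<le> k" using assms by simp
  from lmix_re_im_twisted[OF assms(1-5) this]
  show "lmix (length xs - 1) a (\<lambda>i. if i < 2 * j then \<alpha> else \<beta>) xs vs \<in> twisted_reals k"
    using twisted_reals_parity[of "0 + k + 2 * j" k] assms(1) by simp
qed

lemma rval_cong:
  assumes "length xs = Suc k" "length ys = Suc k" "length vs = k"
    and "\<And>r. r < Suc k \<Longrightarrow> a (xs ! r) = a' (ys ! r)"
    and "\<And>r v. r < Suc k \<Longrightarrow> \<alpha> (xs ! r) v = \<alpha>' (ys ! r) v"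
    and "\<And>r v. r < Suc k \<Longrightarrow> \<beta> (xs ! r) v = \<beta>' (ys ! r) v"
  shows "rval a \<alpha> \<beta> xs vs = rval a' \<alpha>' \<beta>' ys vs"
  unfolding rval_def assms(1,2)
  by (intro sum.cong arg_cong2[where f="(*)"] refl lmix_cong) (use assms in simp_all)

lemma rval_smooth_on:
  assumes W: "open W" and len: "length xs = Suc k" "length vs = k"
    and "\<And>f. f \<in> set xs \<Longrightarrow> smooth_on (\<lambda>z. a z f) W"
    and "\<And>f v. f \<in> set xs \<Longrightarrow> smooth_on (\<lambda>z. \<alpha> z f v) W"
    and "\<And>f v. f \<in> set xs \<Longrightarrow> smooth_on (\<lambda>z. \<beta> z f v) W"
  shows "smooth_on (\<lambda>z. rval (a z) (\<alpha> z) (\<beta> z) xs vs) W"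
proof -
  have "smooth_on (\<lambda>z. (if i < 2 * j then \<alpha> z else \<beta> z) f v) W" if "f \<in> set xs" for i j f v
    using assms(5,6) that by (cases "i < 2 * j") simp_all
  then have "smooth_on (\<lambda>z. lmix k (a z) (\<lambda>i. if i < 2 * j then \<alpha> z else \<beta> z) xs vs) W" for j
    by (intro lmix_closed[where P="\<lambda>g. smooth_on g W"] smooth_on_const smooth_on_add smooth_on_mult assms)
  then show ?thesis
    unfolding rval_def len by (intro smooth_on_sum smooth_on_mult smooth_on_const W) simp
qed

lemma rval_zero_row:
  assumes "r < length xs" "a (xs ! r) = 0" "\<And>v. \<alpha> (xs ! r) v = 0" "\<And>v. \<beta> (xs ! r) v = 0"
  shows "rval a \<alpha> \<beta> xs vs = 0"
proof -
  have "lmix (length xs - 1) a (\<lambda>i. if i < 2 * j then \<alpha> else \<beta>) xs vs = 0" for j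
    by (rule lmix_zero_row[of r]) (use assms in auto)
  then show ?thesis by (simp add: rval_def)
qed

lemma rval_permute_list:
  assumes "\<rho> permutes {..<Suc k}" "length xs = Suc k"
  shows "rval a \<alpha> \<beta> (permute_list \<rho> xs) vs = of_int (sign \<rho>) * rval a \<alpha> \<beta> xs vs"
  unfolding rval_def sum_distrib_left length_permute_list assms(2) diff_Suc_1
    lmix_permute_list[OF assms] by (intro sum.cong refl mult.left_commute)

lemma alternating_map_cong:
  assumes "monoid G" "\<And>xs. xs \<in> tuples k G \<Longrightarrow> F xs = F' xs" "alternating_map k G H F"
  shows "alternating_map k G H F'"
proof -
  interpret monoid G by fact
  show ?thesis
    using assms(3) unfolding alternating_map_def
    by (simp add: assms(2)[symmetric] tuples_update)
qed

lemma alternating_map_mult_left: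
  "alternating_map k G add_group F \<Longrightarrow> alternating_map k G add_group (\<lambda>xs. (c :: complex) * F xs)"
  unfolding alternating_map_def by (simp add: distrib_left)

lemma alternating_map_sum:
  assumes "\<And>j. j \<in> J \<Longrightarrow> alternating_map k G add_group (F j)"
  shows "alternating_map k G add_group (\<lambda>xs. \<Sum>j\<in>J. (F j xs :: complex))"
  using assms unfolding alternating_map_def by (simp add: sum.distrib)

lemma alternating_map_zero: "alternating_map k G add_group (\<lambda>xs. 0 :: complex)"
  unfolding alternating_map_def by simp

lemma alternating_map_rval:
  assumes G: "monoid G"
    and "\<And>f g. f \<in> carrier G \<Longrightarrow> g \<in> carrier G \<Longrightarrow> a (f \<otimes>\<^bsub>G\<^esub> g) = a f + a g"
    and "\<And>f g v. f \<in> carrier G \<Longrightarrow> g \<in> carrier G \<Longrightarrow> \<alpha> (f \<otimes>\<^bsub>G\<^esub> g) v = \<alpha> f v + \<alpha> g v"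
    and "\<And>f g v. f \<in> carrier G \<Longrightarrow> g \<in> carrier G \<Longrightarrow> \<beta> (f \<otimes>\<^bsub>G\<^esub> g) v = \<beta> f v + \<beta> g v"
  shows "alternating_map (Suc k) G add_group (\<lambda>xs. rval a \<alpha> \<beta> xs vs)"
proof -
  have "alternating_map (Suc k) G add_group (\<lambda>xs. \<Sum>j | 2 * j + 1 \<le> Suc k.
    rcoef (Suc k) j * lmix k a (\<lambda>i. if i < 2 * j then \<alpha> else \<beta>) xs vs)"
    by (intro alternating_map_sum alternating_map_mult_left alternating_map_lmix) (use assms in auto)
  then show ?thesis
    by (rule alternating_map_cong[OF G, rotated]) (simp add: rval_def tuples_def)
qed

section \<open>Real and imaginary differentials at a point, of functions and of logarithms\<close>

definition re_jet :: "('x, 'd::finite) chart \<Rightarrow> 'x \<Rightarrow> ('x \<Rightarrow> complex) \<Rightarrow> complex ^ 'd \<Rightarrow> complex"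
  where "re_jet C p f v = of_real (Re (fun_diff f C p v))"

definition im_jet :: "('x, 'd::finite) chart \<Rightarrow> 'x \<Rightarrow> ('x \<Rightarrow> complex) \<Rightarrow> complex ^ 'd \<Rightarrow> complex"
  where "im_jet C p f v = \<i> * of_real (Im (fun_diff f C p v))"

definition re_log_jet :: "('x, 'd::finite) chart \<Rightarrow> 'x \<Rightarrow> ('x \<Rightarrow> complex) \<Rightarrow> complex ^ 'd \<Rightarrow> complex"
  where "re_log_jet C p f v = of_real (Re (fun_diff f C p v / f p))"

definition im_log_jet :: "('x, 'd::finite) chart \<Rightarrow> 'x \<Rightarrow> ('x \<Rightarrow> complex) \<Rightarrow> complex ^ 'd \<Rightarrow> complex"
  where "im_log_jet C p f v = \<i> * of_real (Im (fun_diff f C p v / f p))"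

lemmas jet_defs = re_jet_def im_jet_def re_log_jet_def im_log_jet_def

lemma tuples_sectionD:
  assumes "fs \<in> tuples k (hol_sections A U)"
  shows "length fs = k" "f \<in> set fs \<Longrightarrow> holomorphic_fun A U f"
  using assms by (auto simp: tuples_def)

lemma tuples_unitD:
  assumes "fs \<in> tuples k (hol_units A U)"
  shows "length fs = k" "f \<in> set fs \<Longrightarrow> holomorphic_fun A U f" "f \<in> set fs \<Longrightarrow> p \<in> U \<Longrightarrow> f p \<noteq> 0"
  using assms by (auto simp: tuples_def)

lemma r_tilde_sections:
  assumes C: "C \<in> A" "p \<in> U \<inter> fst C" and fs: "fs \<in> tuples (Suc k) (hol_sections A U)" and vs: "length vs = k"
  shows "r_tilde A U fs C p vs = rval (\<lambda>f. re_part f p) (re_jet C p) (im_jet C p) fs vs"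
proof -
  have hol: "holomorphic_fun A U (fs ! r)" if "r < Suc k" for r
    using tuples_sectionD[OF fs] that by simp
  show ?thesis
    unfolding r_tilde_apply[OF C tuples_sectionD(1)[OF fs] vs]
    by (rule rval_cong[where k=k])
      (use vs tuples_sectionD(1)[OF fs] fun_diff_re_part[OF holomorphic_fun_has_derivative[OF hol C]]
        fun_diff_im_part[OF holomorphic_fun_has_derivative[OF hol C]] in \<open>simp_all add: jet_defs\<close>)
qed

text \<open>At p the chosen branch of log F has real part ln |F p| and differential dF / F. Branches
  that change from point to point are thus replaced by data defined on all of U.\<close>

lemma r_tilde_units:
  assumes A: "complex_manifold A" and C: "C \<in> A" "p \<in> U \<inter> fst C"
    and fs: "fs \<in> tuples (Suc k) (hol_units A U)" and vs: "length vs = k"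
  shows "of_logs (r_tilde A U) fs C p vs =
    rval (\<lambda>f. of_real (ln (cmod (f p)))) (re_log_jet C p) (im_log_jet C p) fs vs"
proof -
  have *: "holomorphic_fun A U (fs ! r)" "(fs ! r) p \<noteq> 0" if "r < Suc k" for r
    using tuples_unitD[OF fs] that C by auto
  note D = holomorphic_fun_log_branch[OF A *(1) C *(2)]
  show ?thesis
    unfolding of_logs_def
    by (subst r_tilde_apply[OF C _ vs], simp add: tuples_unitD(1)[OF fs], rule rval_cong[where k=k])
      (use vs tuples_unitD(1)[OF fs] fun_diff_re_part[OF D] fun_diff_im_part[OF D] 
        in \<open>simp_all add: jet_defs re_part_log_branch *(2)\<close>)
qed

lemma fun_diff_add:
  assumes "holomorphic_fun A U f" "holomorphic_fun A U g" "C \<in> A" "p \<in> U \<inter> fst C"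
  shows "fun_diff (f + g) C p v = fun_diff f C p v + fun_diff g C p v"
proof (rule fun_diff_eqI)
  show "(f + g \<circ> chart_inv C has_derivative (\<lambda>v. fun_diff f C p v + fun_diff g C p v)) (at (snd C p))"
    using has_derivative_add[OF holomorphic_fun_has_derivative[OF assms(1,3,4)] holomorphic_fun_has_derivative[OF assms(2,3,4)]]
    by (simp add: o_def plus_fun_def)
qed

lemma fun_diff_mult:
  assumes A: "complex_manifold A" and "holomorphic_fun A U f" "holomorphic_fun A U g" "C \<in> A" "p \<in> U \<inter> fst C"
  shows "fun_diff (f * g) C p v = f p * fun_diff g C p v + fun_diff f C p v * g p"
proof (rule fun_diff_eqI)
  have "chart_inv C (snd C p) = p" using chart_inv_chart[OF A assms(4)] assms(5) by blast
  then show "(f * g \<circ> chart_inv C has_derivative (\<lambda>v. f p * fun_diff g C p v + fun_diff f C p v * g p)) (at (snd C p))"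
    using has_derivative_mult[OF holomorphic_fun_has_derivative[OF assms(2,4,5)] holomorphic_fun_has_derivative[OF assms(3,4,5)]]
    by (simp add: o_def times_fun_def)
qed

lemma alternating_map_r_tilde:
  "alternating_map (Suc k) (hol_sections A U) add_group (\<lambda>fs. r_tilde A U fs C p vs)"
proof (cases "C \<in> A \<and> p \<in> U \<inter> fst C \<and> length vs = k")
  case True
  then have C: "C \<in> A" "p \<in> U \<inter> fst C" and vs: "length vs = k" by blast+
  have "alternating_map (Suc k) (hol_sections A U) add_group
    (\<lambda>fs. rval (\<lambda>f. re_part f p) (re_jet C p) (im_jet C p) fs vs)"
    by (rule alternating_map_rval[OF monoid_hol_sections])
      (simp_all add: re_part_def jet_defs fun_diff_add[OF _ _ C] algebra_simps)
  then show ?thesis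
    by (rule alternating_map_cong[OF monoid_hol_sections, rotated]) (simp add: r_tilde_sections[OF C _ vs])
next
  case False
  have "r_tilde A U fs C p vs = 0" if "length fs = Suc k" for fs
    using False that by (intro r_tilde_zero) auto
  then show ?thesis
    by (intro alternating_map_cong[OF monoid_hol_sections _ alternating_map_zero]) (simp add: tuples_def)
qed

text \<open>Both ln |F| and dF / F turn products into sums. The argument of F, additive only modulo
  2 pi, enters through its differential alone.\<close>

lemma alternating_map_of_logs_r_tilde:
  assumes A: "complex_manifold A"
  shows "alternating_map (Suc k) (hol_units A U) add_group (\<lambda>fs. of_logs (r_tilde A U) fs C p vs)"
proof (cases "C \<in> A \<and> p \<in> U \<inter> fst C \<and> length vs = k")
  case True
  then have C: "C \<in> A" "p \<in> U \<inter> fst C" and vs: "length vs = k" by blast+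
  have "alternating_map (Suc k) (hol_units A U) add_group
    (\<lambda>fs. rval (\<lambda>f. of_real (ln (cmod (f p)))) (re_log_jet C p) (im_log_jet C p) fs vs)"
  proof (rule alternating_map_rval[OF monoid_hol_units])
    fix f g assume fg: "f \<in> carrier (hol_units A U)" "g \<in> carrier (hol_units A U)"
    then have nz: "f p \<noteq> 0" "g p \<noteq> 0" and hol: "holomorphic_fun A U f" "holomorphic_fun A U g"
      using C by auto
    show "complex_of_real (ln (cmod ((f \<otimes>\<^bsub>hol_units A U\<^esub> g) p))) = of_real (ln (cmod (f p))) + of_real (ln (cmod (g p)))"
      using nz by (simp add: norm_mult ln_mult flip: of_real_add)
    fix v
    have "fun_diff (f * g) C p v / (f p * g p) = fun_diff f C p v / f p + fun_diff g C p v / g p"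
      using nz by (simp add: fun_diff_mult[OF A hol C] field_simps)
    then show "re_log_jet C p (f \<otimes>\<^bsub>hol_units A U\<^esub> g) v = re_log_jet C p f v + re_log_jet C p g v"
      "im_log_jet C p (f \<otimes>\<^bsub>hol_units A U\<^esub> g) v = im_log_jet C p f v + im_log_jet C p g v"
      by (simp_all add: jet_defs algebra_simps)
  qed
  then show ?thesis
    by (rule alternating_map_cong[OF monoid_hol_units, rotated]) (simp add: r_tilde_units[OF A C _ vs])
next
  case False
  have "r_tilde A U (map (log_branch p) fs) C p vs = 0" if "length fs = Suc k" for fs
    using False that by (intro r_tilde_zero) auto
  then show ?thesis
    by (intro alternating_map_cong[OF monoid_hol_units _ alternating_map_zero]) (simp add: tuples_def of_logs_def)
qed

lemma cholomorphic_on_fun_diff: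
  assumes A: "complex_manifold A" "open U" and f: "holomorphic_fun A U f" "C \<in> A"
  shows "cholomorphic_on (\<lambda>z. fun_diff f C (chart_inv C z) v) (snd C ` (U \<inter> fst C))"
proof -
  have W: "open (snd C ` (U \<inter> fst C))" by (rule open_chart_image[OF A(1) f(2) A(2)])
  from cholomorphic_on_deriv[OF holomorphic_fun_chart[OF f] W, of v]
  show ?thesis
    by (rule cholomorphic_on_cong[OF W, rotated])
      (simp add: fun_diff_def chart_image(2)[OF A(1) f(2), where U=U])
qed

lemma r_tilde_smooth_forms:
  fixes A :: "('x::{t2_space, second_countable_topology}, 'd::finite) chart set"
  assumes A: "complex_manifold A" "open U" and fs: "fs \<in> tuples (Suc k) (hol_sections A U)"
  shows "r_tilde A U fs \<in> carrier (smooth_forms A k k U)"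
  unfolding smooth_forms_carrier
proof (intro conjI allI ballI impI)
  note len = tuples_sectionD(1)[OF fs]
  have "is_form A U k (\<lambda>C p. r_tilde A U ((\<lambda>_. fs) p) C p)"
    using holomorphic_fun_has_derivative[OF tuples_sectionD(2)[OF fs]]
    by (intro is_form_r_tilde[OF A(1)] len) (blast intro: differentiableI)
  then show "is_form A U k (r_tilde A U fs)" by simp
  show "r_tilde A U fs C p vs \<in> twisted_reals k" for C p vs
  proof (cases "C \<in> A \<and> p \<in> U \<inter> fst C \<and> length vs = k")
    case True
    then have C: "C \<in> A" "p \<in> U \<inter> fst C" "length vs = k" by blast+
    show ?thesis
      unfolding r_tilde_sections[OF C(1,2) fs C(3)]
      by (rule rval_twisted[OF len C(3)]) (simp_all add: twisted_reals_iff jet_defs re_part_def)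
  next
    case False
    then have "r_tilde A U fs C p vs = 0" using len by (intro r_tilde_zero) auto
    then show ?thesis by simp
  qed
  fix C and vs :: "(complex ^ 'd) list" assume C: "C \<in> A" and vs: "length vs = k"
  have W: "open (snd C ` (U \<inter> fst C))" by (rule open_chart_image[OF A(1) C A(2)])
  have "smooth_on (\<lambda>z. rval (\<lambda>f. re_part f (chart_inv C z)) (re_jet C (chart_inv C z)) (im_jet C (chart_inv C z)) fs vs) (snd C ` (U \<inter> fst C))"
    using smooth_on_cholomorphic[OF W holomorphic_fun_chart[OF tuples_sectionD(2)[OF fs] C]]
      smooth_on_cholomorphic[OF W cholomorphic_on_fun_diff[OF A tuples_sectionD(2)[OF fs] C]]
    by (intro rval_smooth_on[OF W len vs]) (auto simp: re_part_def jet_defs o_def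
        intro!: smooth_on_bounded_linear[OF bounded_linear_of_real_Re W] smooth_on_bounded_linear[OF bounded_linear_i_Im W])
  then show "smooth_on (\<lambda>z. r_tilde A U fs C (chart_inv C z) vs) (snd C ` (U \<inter> fst C))"
    by (rule smooth_on_cong[OF W, rotated]) (simp only: r_tilde_sections[OF C chart_image(1)[OF A(1) C] fs vs])
qed

text \<open>The branch in \<open>of_logs\<close> changes with the point, so smoothness cannot be
  read off a single branch; it is read off the expression in ln |F| and dF / F given by
  \<open>r_tilde_units\<close>.\<close>

lemma of_logs_r_tilde_smooth_forms:
  fixes A :: "('x::{t2_space, second_countable_topology}, 'd::finite) chart set"
  assumes A: "complex_manifold A" "open U" and fs: "fs \<in> tuples (Suc k) (hol_units A U)"
  shows "of_logs (r_tilde A U) fs \<in> carrier (smooth_forms A k k U)"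
  unfolding smooth_forms_carrier
proof (intro conjI allI ballI impI)
  note len = tuples_unitD(1)[OF fs]
  have "is_form A U k (\<lambda>C p. r_tilde A U (map (log_branch p) fs) C p)"
  proof (rule is_form_r_tilde[OF A(1)])
    fix C p f assume C: "C \<in> A" "p \<in> U \<inter> fst C" and "f \<in> set (map (log_branch p) fs)"
    then obtain g where g: "g \<in> set fs" "f = log_branch p g" by auto
    have "g p \<noteq> 0" using tuples_unitD(3)[OF fs g(1)] C by blast
    from holomorphic_fun_log_branch[OF A(1) tuples_unitD(2)[OF fs g(1)] C this]
    show "(f \<circ> chart_inv C) differentiable (at (snd C p))" unfolding g by (rule differentiableI)
  qed (simp add: len)
  then show "is_form A U k (of_logs (r_tilde A U) fs)" by (simp add: of_logs_def)
  show "of_logs (r_tilde A U) fs C p vs \<in> twisted_reals k" for C p vs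
  proof (cases "C \<in> A \<and> p \<in> U \<inter> fst C \<and> length vs = k")
    case True
    then have C: "C \<in> A" "p \<in> U \<inter> fst C" "length vs = k" by blast+
    show ?thesis
      unfolding r_tilde_units[OF A(1) C(1,2) fs C(3)]
      by (rule rval_twisted[OF len C(3)]) (simp_all add: twisted_reals_iff jet_defs)
  next
    case False
    then have "r_tilde A U (map (log_branch p) fs) C p vs = 0" using len by (intro r_tilde_zero) auto
    then show ?thesis by (simp add: of_logs_def)
  qed
  fix C and vs :: "(complex ^ 'd) list" assume C: "C \<in> A" and vs: "length vs = k"
  let ?W = "snd C ` (U \<inter> fst C)"
  have W: "open ?W" by (rule open_chart_image[OF A(1) C A(2)])
  have nz: "(f \<circ> chart_inv C) z \<noteq> 0" if "f \<in> set fs" "z \<in> ?W" for f z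
    using tuples_unitD(3)[OF fs that(1)] chart_image(1)[OF A(1) C that(2)] by simp
  have div: "smooth_on (\<lambda>z. fun_diff f C (chart_inv C z) v / f (chart_inv C z)) ?W" if f: "f \<in> set fs" for f v
  proof -
    have "cholomorphic_on (\<lambda>z. fun_diff f C (chart_inv C z) v * inverse ((f \<circ> chart_inv C) z)) ?W"
      using tuples_unitD(2)[OF fs f] C nz[OF f]
      by (intro cholomorphic_on_mult cholomorphic_on_fun_diff[OF A] 
          cholomorphic_on_compose[of _ _ inverse, OF holomorphic_fun_chart DERIV_inverse])
    from smooth_on_cholomorphic[OF W this] show ?thesis by (simp add: divide_inverse)
  qed
  have "smooth_on (\<lambda>z. rval (\<lambda>f. of_real (ln (cmod (f (chart_inv C z))))) (re_log_jet C (chart_inv C z)) (im_log_jet C (chart_inv C z)) fs vs) ?W"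
  proof (rule rval_smooth_on[OF W len vs])
    fix f assume f: "f \<in> set fs"
    show "smooth_on (\<lambda>z. complex_of_real (ln (cmod (f (chart_inv C z))))) ?W"
      using smooth_on_ln_cmod[OF W holomorphic_fun_chart[OF tuples_unitD(2)[OF fs f] C] nz[OF f]] by simp
    show "smooth_on (\<lambda>z. re_log_jet C (chart_inv C z) f v) ?W" "smooth_on (\<lambda>z. im_log_jet C (chart_inv C z) f v) ?W" for v
      unfolding jet_defs
      by (intro smooth_on_bounded_linear[OF bounded_linear_of_real_Re W] smooth_on_bounded_linear[OF bounded_linear_i_Im W] div f)+
  qed
  then show "smooth_on (\<lambda>z. of_logs (r_tilde A U) fs C (chart_inv C z) vs) ?W"
    by (rule smooth_on_cong[OF W, rotated]) (simp only: r_tilde_units[OF A(1) C chart_image(1)[OF A(1) C] fs vs])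
qed

section \<open>The exterior derivative\<close>

text \<open>\<open>dop k g z\<close> is the exterior derivative at \<open>z\<close> of the \<open>k\<close>-form with coefficient functions
  \<open>\<lambda>z. g z us\<close>.\<close>

definition dop :: "nat \<Rightarrow> ('v::real_normed_vector \<Rightarrow> 'v list \<Rightarrow> complex) \<Rightarrow> 'v \<Rightarrow> 'v list \<Rightarrow> complex"
  where "dop k g z vs = (\<Sum>i\<le>k. (-1) ^ i * frechet_derivative (\<lambda>z. g z (del_nth i vs)) (at z) (vs ! i))"

text \<open>Differentiability of the coefficients travels with the value of the derivative, since
  \<open>frechet_derivative\<close> is linear only on differentiable functions.\<close>

definition has_dop ::
    "nat \<Rightarrow> ('v::real_normed_vector \<Rightarrow> 'v list \<Rightarrow> complex) \<Rightarrow> 'v \<Rightarrow> ('v list \<Rightarrow> complex) \<Rightarrow> bool"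
  where "has_dop k g z E \<longleftrightarrow>
    (\<forall>us. length us = k \<longrightarrow> (\<lambda>z. g z us) differentiable (at z)) \<and>
    (\<forall>vs. length vs = Suc k \<longrightarrow> dop k g z vs = E vs)"

lemma length_del_nth [simp]: "i < length vs \<Longrightarrow> length (del_nth i vs) = length vs - 1"
  by (simp add: del_nth_def)

lemma nth_del_nth: "j < length xs \<Longrightarrow> i < length xs - 1 \<Longrightarrow> del_nth j xs ! i = xs ! cyc j (Suc i)"
  by (auto simp: del_nth_def cyc_apply nth_append min_def)

lemma frechet_derivative_mult_left:
  fixes f :: "'v::real_normed_vector \<Rightarrow> complex"
  assumes "f differentiable (at z)"
  shows "frechet_derivative (\<lambda>z. c * f z) (at z) v = c * frechet_derivative f (at z) v"
proof -
  have "((\<lambda>z. c * f z) has_derivative (\<lambda>v. c * frechet_derivative f (at z) v)) (at z)"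
    using assms by (intro has_derivative_mult_right) (simp add: frechet_derivative_works[symmetric])
  from frechet_derivative_at[OF this] show ?thesis by metis
qed

lemma frechet_derivative_sum:
  fixes f :: "'i \<Rightarrow> 'v::real_normed_vector \<Rightarrow> complex"
  assumes "\<And>i. i \<in> I \<Longrightarrow> f i differentiable (at z)"
  shows "frechet_derivative (\<lambda>z. \<Sum>i\<in>I. f i z) (at z) v = (\<Sum>i\<in>I. frechet_derivative (f i) (at z) v)"
proof -
  have "((\<lambda>z. \<Sum>i\<in>I. f i z) has_derivative (\<lambda>v. \<Sum>i\<in>I. frechet_derivative (f i) (at z) v)) (at z)"
    using assms by (intro has_derivative_sum) (simp add: frechet_derivative_works[symmetric])
  from frechet_derivative_at[OF this] show ?thesis by metis
qed

lemma has_dop_mult_left: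
  fixes g :: "'v::real_normed_vector \<Rightarrow> 'v list \<Rightarrow> complex"
  assumes "has_dop k g z E"
  shows "has_dop k (\<lambda>z us. c * g z us) z (\<lambda>vs. c * E vs)"
  unfolding has_dop_def
proof (intro conjI allI impI)
  fix us :: "'v list" assume "length us = k"
  then show "(\<lambda>z. c * g z us) differentiable (at z)"
    using assms unfolding has_dop_def by (intro differentiable_mult differentiable_const) blast
next
  fix vs :: "'v list" assume vs: "length vs = Suc k"
  have "(\<lambda>z. g z (del_nth i vs)) differentiable (at z)" if "i \<le> k" for i
    using assms vs that unfolding has_dop_def by simp
  then have "dop k (\<lambda>z us. c * g z us) z vs = c * dop k g z vs"
    unfolding dop_def sum_distrib_left
    by (intro sum.cong refl) (simp add: frechet_derivative_mult_left)
  then show "dop k (\<lambda>z us. c * g z us) z vs = c * E vs"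
    using assms vs unfolding has_dop_def by simp
qed

lemma has_dop_sum:
  fixes g :: "'i \<Rightarrow> 'v::real_normed_vector \<Rightarrow> 'v list \<Rightarrow> complex"
  assumes I: "finite I" and g: "\<And>t. t \<in> I \<Longrightarrow> has_dop k (g t) z (E t)"
  shows "has_dop k (\<lambda>z us. \<Sum>t\<in>I. g t z us) z (\<lambda>vs. \<Sum>t\<in>I. E t vs)"
  unfolding has_dop_def
proof (intro conjI allI impI)
  fix us :: "'v list" assume "length us = k"
  then show "(\<lambda>z. \<Sum>t\<in>I. g t z us) differentiable (at z)"
    using g I unfolding has_dop_def by (intro differentiable_sum) auto
next
  fix vs :: "'v list" assume vs: "length vs = Suc k"
  have "(\<lambda>z. g t z (del_nth i vs)) differentiable (at z)" if "i \<le> k" "t \<in> I" for i t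
    using g[OF that(2)] vs that unfolding has_dop_def by simp
  then have "dop k (\<lambda>z us. \<Sum>t\<in>I. g t z us) z vs = (\<Sum>i\<le>k. \<Sum>t\<in>I. (-1) ^ i * frechet_derivative (\<lambda>z. g t z (del_nth i vs)) (at z) (vs ! i))"
    unfolding dop_def by (intro sum.cong refl) (simp add: frechet_derivative_sum sum_distrib_left)
  also have "\<dots> = (\<Sum>t\<in>I. dop k (g t) z vs)"
    unfolding dop_def by (rule sum.swap)
  also have "\<dots> = (\<Sum>t\<in>I. E t vs)"
    using g vs unfolding has_dop_def by (intro sum.cong refl) blast
  finally show "dop k (\<lambda>z us. \<Sum>t\<in>I. g t z us) z vs = (\<Sum>t\<in>I. E t vs)" .
qed

lemma has_dop_asum:
  assumes "\<And>\<sigma>. \<sigma> permutes {..<m} \<Longrightarrow> has_dop k (g \<sigma>) z (E \<sigma>)"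
  shows "has_dop k (\<lambda>z us. asum m (\<lambda>\<sigma>. g \<sigma> z us)) z (\<lambda>vs. asum m (\<lambda>\<sigma>. E \<sigma> vs))"
  unfolding asum_def by (intro has_dop_sum has_dop_mult_left assms) (auto simp: finite_permutations)

lemma has_dop_cong:
  fixes g :: "'v::real_normed_vector \<Rightarrow> 'v list \<Rightarrow> complex"
  assumes g: "has_dop k g z E" and W: "open W" "z \<in> W"
    and eq: "\<And>y us. y \<in> W \<Longrightarrow> length us = k \<Longrightarrow> g y us = g' y us"
  shows "has_dop k g' z E"
  unfolding has_dop_def
proof (intro conjI allI impI)
  fix us :: "'v list" assume us: "length us = k"
  then obtain D where "((\<lambda>z. g z us) has_derivative D) (at z)"
    using g unfolding has_dop_def differentiable_def by blast
  then have "((\<lambda>z. g' z us) has_derivative D) (at z)"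
    by (rule has_derivative_transform_within_open[OF _ W]) (rule eq[OF _ us])
  then show "(\<lambda>z. g' z us) differentiable (at z)" by (rule differentiableI)
next
  fix vs :: "'v list" assume vs: "length vs = Suc k"
  have "frechet_derivative (\<lambda>z. g z (del_nth i vs)) (at z) = frechet_derivative (\<lambda>z. g' z (del_nth i vs)) (at z)"
    if "i \<le> k" for i
    using that vs by (intro frechet_derivative_cong_open[OF W] eq) auto
  then have "dop k g' z vs = dop k g z vs"
    unfolding dop_def by (intro sum.cong refl) simp
  then show "dop k g' z vs = E vs"
    using g vs unfolding has_dop_def by simp
qed

text \<open>Expansion along the first row, where omitting the j-th vector is the index shift
  \<open>cyc j\<close>. The result has the shape of the sum that defines \<open>dop\<close>.\<close>

lemma detv_Suc_del_nth:
  assumes "length vs = Suc k"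
  shows "detv (Suc k) (\<lambda>i l. case_nat g G i (vs ! l)) =
    (\<Sum>j\<le>k. (-1) ^ j * (g (vs ! j) * detv k (\<lambda>i l. G i (del_nth j vs ! l))))"
  unfolding detv_Suc
  by (intro sum.cong refl arg_cong2[where f="(*)"] detv_cong) (use assms in \<open>auto simp: nth_del_nth\<close>)

text \<open>This is the identity \<open>d(h dG\<^sub>1 \<and> \<dots> \<and> dG\<^sub>k) = dh \<and> dG\<^sub>1 \<and> \<dots> \<and> dG\<^sub>k\<close>, where \<open>D i z v\<close> stands
  for the derivative of \<open>G\<^sub>i\<close> at \<open>z\<close> in direction \<open>v\<close>.\<close>

lemma has_dop_mult_detv:
  fixes h :: "'v::real_normed_vector \<Rightarrow> complex"
  assumes h: "(h has_derivative dh) (at z)"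
    and D: "\<And>i v. i < k \<Longrightarrow> ((\<lambda>z. D i z v) has_derivative DD i v) (at z)"
    and sym: "\<And>i v w. i < k \<Longrightarrow> DD i v w = DD i w v"
  shows "has_dop k (\<lambda>z us. h z * detv k (\<lambda>i l. D i z (us ! l))) z
    (\<lambda>vs. detv (Suc k) (\<lambda>i l. case_nat dh (\<lambda>i. D i z) i (vs ! l)))"
proof -
  \<comment> \<open>The derivative of the determinant by the product rule, one row at a
    time.\<close>
  let ?T = "\<lambda>us u. asum k (\<lambda>\<tau>. \<Sum>m<k. DD m (us ! \<tau> m) u * (\<Prod>i\<in>{..<k} - {m}. D i z (us ! \<tau> i)))"
  have der: "((\<lambda>z. h z * detv k (\<lambda>i l. D i z (us ! l))) has_derivative
      (\<lambda>u. h z * ?T us u + dh u * detv k (\<lambda>i l. D i z (us ! l)))) (at z)" for us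
    unfolding detv_def asum_def
    by (intro has_derivative_mult h has_derivative_sum has_derivative_mult_right has_derivative_prod D) auto
  show ?thesis
    unfolding has_dop_def
  proof (intro conjI allI impI)
    show "(\<lambda>z. h z * detv k (\<lambda>i l. D i z (us ! l))) differentiable (at z)" for us
      using der by (rule differentiableI)
    fix vs :: "'v list" assume vs: "length vs = Suc k"
    let ?H = "\<lambda>m a b. DD m (vs ! b) (vs ! a)"
    have "dop k (\<lambda>z us. h z * detv k (\<lambda>i l. D i z (us ! l))) z vs =
      (\<Sum>j\<le>k. (-1) ^ j * (h z * ?T (del_nth j vs) (vs ! j) + dh (vs ! j) * detv k (\<lambda>i l. D i z (del_nth j vs ! l))))"
      unfolding dop_def frechet_derivative_at[OF der, symmetric] ..
    also have "\<dots> = h z * (\<Sum>j\<le>k. (-1) ^ j * ?T (del_nth j vs) (vs ! j)) +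
       (\<Sum>j\<le>k. (-1) ^ j * (dh (vs ! j) * detv k (\<lambda>i l. D i z (del_nth j vs ! l))))"
      by (simp only: distrib_left sum.distrib sum_distrib_left mult.left_commute)
    \<comment> \<open>The differentiating vector takes slot 0, which merges the sums over j and
      \<tau> into one over permutations of k + 1 slots. The second derivative then takes the vectors
      in slots 0 and m + 1 and is symmetric in them.\<close>
    also have "(\<Sum>j\<le>k. (-1) ^ j * ?T (del_nth j vs) (vs ! j)) =
      asum (Suc k) (\<lambda>\<sigma>. \<Sum>m<k. ?H m (\<sigma> 0) (\<sigma> (Suc m)) * (\<Prod>i\<in>{..<k} - {m}. D i z (vs ! \<sigma> (Suc i))))"
      unfolding asum_Suc
    proof (intro sum.cong refl arg_cong2[where f="(*)"] asum_cong)
      fix j \<tau> m assume j: "j \<in> {..k}" and \<tau>: "\<tau> permutes {..<k}" and m: "m \<in> {..<k}"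
      have "del_nth j vs ! \<tau> i = vs ! (cyc j \<circ> lift_perm \<tau>) (Suc i)" if "i < k" for i
        using j vs permutes_in_image[OF \<tau>, of i] that by (simp add: nth_del_nth)
      then show "DD m (del_nth j vs ! \<tau> m) (vs ! j) = ?H m ((cyc j \<circ> lift_perm \<tau>) 0) ((cyc j \<circ> lift_perm \<tau>) (Suc m))"
        and "(\<Prod>i\<in>{..<k} - {m}. D i z (del_nth j vs ! \<tau> i)) = (\<Prod>i\<in>{..<k} - {m}. D i z (vs ! (cyc j \<circ> lift_perm \<tau>) (Suc i)))"
        using m by (auto intro!: prod.cong)
    qed
    also have "\<dots> = 0"
      by (rule asum_symmetric_eq_0[of k ?H "\<lambda>i r. D i z (vs ! r)"]) (rule sym)
    finally show "dop k (\<lambda>z us. h z * detv k (\<lambda>i l. D i z (us ! l))) z vs =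
      detv (Suc k) (\<lambda>i l. case_nat dh (\<lambda>i. D i z) i (vs ! l))"
      unfolding detv_Suc_del_nth[OF vs] by simp
  qed
qed

lemma ext_deriv_has_dop:
  assumes C: "C \<in> A" "p \<in> U \<inter> fst C" and vs: "length vs = Suc k"
    and E: "has_dop k (\<lambda>z us. \<omega> C (chart_inv C z) us) (snd C p) E"
  shows "ext_deriv A U k \<omega> C p vs = E vs"
  using assms unfolding ext_deriv_def cut_form_def has_dop_def dop_def by simp

lemma fun_diff_second_derivative:
  assumes A: "complex_manifold A" "open U" and f: "holomorphic_fun A U f" "C \<in> A" and p: "p \<in> U \<inter> fst C"
  shows "((\<lambda>z. fun_diff f C (chart_inv C z) v) has_derivative
      frechet_derivative (\<lambda>z. fun_diff f C (chart_inv C z) v) (at (snd C p))) (at (snd C p))"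
    and "frechet_derivative (\<lambda>z. fun_diff f C (chart_inv C z) v) (at (snd C p)) w =
      frechet_derivative (\<lambda>z. fun_diff f C (chart_inv C z) w) (at (snd C p)) v"
proof -
  let ?W = "snd C ` (U \<inter> fst C)"
  have W: "open ?W" and z: "snd C p \<in> ?W" using open_chart_image[OF A(1) f(2) A(2)] p by auto
  show "((\<lambda>z. fun_diff f C (chart_inv C z) v) has_derivative
      frechet_derivative (\<lambda>z. fun_diff f C (chart_inv C z) v) (at (snd C p))) (at (snd C p))"
    by (rule cholomorphic_on_has_derivative(1)[OF cholomorphic_on_fun_diff[OF A f] z])
  have eq: "frechet_derivative (\<lambda>z. fun_diff f C (chart_inv C z) v) (at (snd C p)) =
    frechet_derivative (\<lambda>z. frechet_derivative (f \<circ> chart_inv C) (at z) v) (at (snd C p))" for v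
    by (rule frechet_derivative_cong_open[OF W z]) (simp only: fun_diff_def chart_image(2)[OF A(1) f(2)])
  show "frechet_derivative (\<lambda>z. fun_diff f C (chart_inv C z) v) (at (snd C p)) w =
      frechet_derivative (\<lambda>z. fun_diff f C (chart_inv C z) w) (at (snd C p)) v"
    unfolding eq by (rule cholomorphic_on_deriv_commute[OF holomorphic_fun_chart[OF f] W z])
qed

text \<open>The first row is d(b a) = b da + a db, in the shape in which
  \<open>has_derivative_mult\<close> produces it.\<close>

lemma detv_case_add:
  "detv (Suc k) (\<lambda>i l. case_nat (\<lambda>v. b * g v + g' v * a) G i (vs ! l)) =
    b * detv (Suc k) (\<lambda>i l. case_nat g G i (vs ! l)) + a * detv (Suc k) (\<lambda>i l. case_nat g' G i (vs ! l))"
  unfolding detv_Suc by (simp add: sum_distrib_left algebra_simps sum.distrib)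

text \<open>The part of the product rule that differentiates the real part: one more real row stands
  in front, so q becomes q + 1. The inner alternation is absorbed by \<open>asum_lift_perm\<close>
  and leaves (k + 1)!.\<close>

lemma asum_lmix_first:
  assumes "length fs = Suc (Suc k)"
  shows "asum (Suc (Suc k)) (\<lambda>\<sigma>. asum (Suc k) (\<lambda>\<tau>. b (fs ! \<sigma> 0) *
      detv (Suc k) (\<lambda>i l. case_nat (\<alpha> (fs ! \<sigma> (Suc (\<tau> 0)))) (\<lambda>i. (if i < q then \<alpha> else \<beta>) (fs ! \<sigma> (Suc (\<tau> (Suc i))))) i (vs ! l)))) =
    fact (Suc k) * lmix (Suc k) b (\<lambda>i. if i < Suc q then \<alpha> else \<beta>) fs vs"
proof -
  let ?F = "\<lambda>\<rho>. b (fs ! \<rho> 0) * detv (Suc k) (\<lambda>i l. case_nat (\<alpha> (fs ! \<rho> 1)) (\<lambda>i. (if i < q then \<alpha> else \<beta>) (fs ! \<rho> (Suc (Suc i)))) i (vs ! l))"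
  have "asum (Suc (Suc k)) ?F = lmix (Suc k) b (\<lambda>i. if i < Suc q then \<alpha> else \<beta>) fs vs"
    unfolding lmix_def mix_def
    by (intro asum_cong arg_cong2[where f="(*)"] refl detv_cong) (auto split: nat.split)
  then show ?thesis
    using asum_lift_perm[of "Suc k" ?F] by (simp cong del: nat.case_cong_weak)
qed

text \<open>The part that differentiates the imaginary part: the undifferentiated real part sits in
  slot 1, so \<open>mix_swap\<close> gives the sign, and the new imaginary row leaves q unchanged by
  \<open>mix_case_last\<close>.\<close>

lemma asum_lmix_second:
  assumes "length fs = Suc (Suc k)" and q: "q < Suc k"
  shows "asum (Suc (Suc k)) (\<lambda>\<sigma>. asum (Suc k) (\<lambda>\<tau>. a (fs ! \<sigma> (Suc (\<tau> 0))) *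
      detv (Suc k) (\<lambda>i l. case_nat (\<beta> (fs ! \<sigma> 0)) (\<lambda>i. (if i < q then \<alpha> else \<beta>) (fs ! \<sigma> (Suc (\<tau> (Suc i))))) i (vs ! l)))) =
    - (fact (Suc k) * lmix (Suc k) a (\<lambda>i. if i < q then \<alpha> else \<beta>) fs vs)"
proof -
  let ?F = "\<lambda>\<rho>. a (fs ! \<rho> 1) * detv (Suc k) (\<lambda>i l. case_nat (\<beta> (fs ! \<rho> 0)) (\<lambda>i. (if i < q then \<alpha> else \<beta>) (fs ! \<rho> (Suc (Suc i)))) i (vs ! l))"
  let ?\<alpha> = "\<lambda>r l. \<alpha> (fs ! r) (vs ! l)" and ?\<beta> = "\<lambda>r l. \<beta> (fs ! r) (vs ! l)"
  have "asum (Suc (Suc k)) ?F = asum (Suc (Suc k)) (\<lambda>\<rho>. a (fs ! \<rho> 1) *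
     detv (Suc k) (case_nat (?\<beta> (\<rho> 0)) (\<lambda>i. (if i < q then ?\<alpha> else ?\<beta>) (\<rho> (Suc (Suc i))))))"
    by (intro asum_cong arg_cong2[where f="(*)"] refl detv_cong) (auto split: nat.split)
  also have "\<dots> = - mix (Suc k) (\<lambda>r. a (fs ! r)) (case_nat ?\<beta> (\<lambda>i. if i < q then ?\<alpha> else ?\<beta>))"
    by (rule mix_swap) simp
  also have "mix (Suc k) (\<lambda>r. a (fs ! r)) (case_nat ?\<beta> (\<lambda>i. if i < q then ?\<alpha> else ?\<beta>)) =
      mix (Suc k) (\<lambda>r. a (fs ! r)) (\<lambda>i. if i < q then ?\<alpha> else ?\<beta>)"
    by (rule mix_case_last[OF q])
  also have "\<dots> = lmix (Suc k) a (\<lambda>i. if i < q then \<alpha> else \<beta>) fs vs"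
    unfolding lmix_def by (intro mix_cong) auto
  finally show ?thesis
    using asum_lift_perm[of "Suc k" ?F] by (simp cong del: nat.case_cong_weak)
qed

section \<open>The homotopy on generators\<close>

lemma permute_list_tuples: "fs \<in> tuples k G \<Longrightarrow> permute_list \<sigma> fs \<in> tuples k G" if "\<sigma> permutes {..<k}"
  using that by (auto simp: tuples_def)

lemma tl_tuples: "fs \<in> tuples (Suc k) G \<Longrightarrow> tl fs \<in> tuples k G"
  by (cases fs) (auto simp: tuples_def)

lemma nth_tl_permute_list:
  assumes "\<sigma> permutes {..<Suc k}" "length fs = Suc k" "i < k"
  shows "tl (permute_list \<sigma> fs) ! i = fs ! \<sigma> (Suc i)"
  using assms by (simp add: nth_tl permute_list_nth)

lemma permute_list_nonempty: "length fs = Suc k \<Longrightarrow> permute_list \<sigma> fs \<noteq> []"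
  by (metis length_0_conv length_permute_list nat.distinct(1))

lemma hd_permute_list:
  assumes "\<sigma> permutes {..<Suc k}" "length fs = Suc k"
  shows "hd (permute_list \<sigma> fs) = fs ! \<sigma> 0"
  using assms permute_list_nonempty[OF assms(2)] by (simp add: hd_conv_nth permute_list_nth)

lemma s_gen_apply:
  assumes "k < n" "length fs = Suc k"
  shows "s_gen A n k U fs C p vs = (2 * of_real pi * \<i>) ^ (n - k - 1) *
    asum (Suc k) (\<lambda>\<sigma>. im_part (hd (permute_list \<sigma> fs)) p * r_tilde A U (tl (permute_list \<sigma> fs)) C p vs)"
  using assms by (simp add: s_gen_def scale_form_def alt_sum_apply fun_mult_def)

text \<open>Both alternations are opened, so that every summand is a function times a determinant of
  differentials, the shape to which \<open>has_dop_mult_detv\<close> applies. In degree k + 1 of the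
  complex the form has degree k.\<close>

lemma s_gen_expand:
  assumes k: "Suc k < n" and fs: "fs \<in> tuples (Suc (Suc k)) (hol_sections A U)"
    and C: "C \<in> A" "p \<in> U \<inter> fst C" and us: "length us = k"
  shows "s_gen A n (Suc k) U fs C p us = (2 * of_real pi * \<i>) ^ (n - Suc k - 1) *
    asum (Suc (Suc k)) (\<lambda>\<sigma>. \<Sum>j | 2 * j + 1 \<le> Suc k. rcoef (Suc k) j * asum (Suc k) (\<lambda>\<tau>.
      (im_part (fs ! \<sigma> 0) p * re_part (fs ! \<sigma> (Suc (\<tau> 0))) p) *
      detv k (\<lambda>i l. (if i < 2 * j then re_jet C p else im_jet C p) (fs ! \<sigma> (Suc (\<tau> (Suc i)))) (us ! l))))"
proof -
  have len: "length fs = Suc (Suc k)" using fs by (simp add: tuples_def)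
  have "im_part (hd (permute_list \<sigma> fs)) p * r_tilde A U (tl (permute_list \<sigma> fs)) C p us =
     (\<Sum>j | 2 * j + 1 \<le> Suc k. rcoef (Suc k) j * asum (Suc k) (\<lambda>\<tau>.
      (im_part (fs ! \<sigma> 0) p * re_part (fs ! \<sigma> (Suc (\<tau> 0))) p) *
      detv k (\<lambda>i l. (if i < 2 * j then re_jet C p else im_jet C p) (fs ! \<sigma> (Suc (\<tau> (Suc i)))) (us ! l))))"
    if \<sigma>: "\<sigma> permutes {..<Suc (Suc k)}" for \<sigma>
  proof -
    have tl: "tl (permute_list \<sigma> fs) \<in> tuples (Suc k) (hol_sections A U)"
      by (intro tl_tuples permute_list_tuples[OF \<sigma> fs])
    have "lmix k (\<lambda>f. re_part f p) (\<lambda>i. if i < 2 * j then re_jet C p else im_jet C p) (tl (permute_list \<sigma> fs)) us =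
      asum (Suc k) (\<lambda>\<tau>. re_part (fs ! \<sigma> (Suc (\<tau> 0))) p *
        detv k (\<lambda>i l. (if i < 2 * j then re_jet C p else im_jet C p) (fs ! \<sigma> (Suc (\<tau> (Suc i)))) (us ! l)))" for j
      unfolding lmix_def mix_def
    proof (intro asum_cong arg_cong2[where f="(*)"] detv_cong)
      fix \<tau> assume \<tau>: "\<tau> permutes {..<Suc k}"
      have *: "tl (permute_list \<sigma> fs) ! \<tau> i = fs ! \<sigma> (Suc (\<tau> i))" if "i < Suc k" for i
        using permutes_in_image[OF \<tau>, of i] that by (intro nth_tl_permute_list[OF \<sigma> len]) simp
      show "re_part (tl (permute_list \<sigma> fs) ! \<tau> 0) p = re_part (fs ! \<sigma> (Suc (\<tau> 0))) p"
        by (simp add: *)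
      show "(if i < 2 * j then re_jet C p else im_jet C p) (tl (permute_list \<sigma> fs) ! \<tau> (Suc i)) (us ! l) =
        (if i < 2 * j then re_jet C p else im_jet C p) (fs ! \<sigma> (Suc (\<tau> (Suc i)))) (us ! l)" if "i < k" for i l
        using that by (simp add: *)
    qed
    then show ?thesis
      unfolding r_tilde_sections[OF C tl us] rval_def tuples_sectionD(1)[OF tl] diff_Suc_1
        hd_permute_list[OF \<sigma> len] sum_distrib_left
      by (intro sum.cong refl) (simp only: asum_mult_left mult.left_commute mult.assoc)
  qed
  then show ?thesis
    unfolding s_gen_apply[OF k len] by (intro arg_cong2[where f="(*)"] refl asum_cong)
qed

lemma re_part_has_derivative:
  assumes "holomorphic_fun A U f" "C \<in> A" "p \<in> U \<inter> fst C"
  shows "((\<lambda>z. re_part f (chart_inv C z)) has_derivative re_jet C p f) (at (snd C p))"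
    and "((\<lambda>z. im_part f (chart_inv C z)) has_derivative im_jet C p f) (at (snd C p))"
  using bounded_linear.has_derivative[OF bounded_linear_of_real_Re holomorphic_fun_has_derivative[OF assms]]
    bounded_linear.has_derivative[OF bounded_linear_i_Im holomorphic_fun_has_derivative[OF assms]]
  by (simp_all add: re_part_def im_part_def re_jet_def[abs_def] im_jet_def[abs_def])

lemma ext_deriv_s_gen:
  fixes A :: "('x::{t2_space, second_countable_topology}, 'd::finite) chart set"
  assumes A: "complex_manifold A" "open U" and k: "Suc k < n" and fs: "fs \<in> tuples (Suc (Suc k)) (hol_sections A U)"
    and C: "C \<in> A" "p \<in> U \<inter> fst C" and vs: "length vs = Suc k"
  defines "N \<equiv> \<lambda>x q. lmix (Suc k) (\<lambda>f. x f p) (\<lambda>i. if i < q then re_jet C p else im_jet C p) fs vs"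
  shows "ext_deriv A U k (s_gen A n (Suc k) U fs) C p vs =
    (2 * of_real pi * \<i>) ^ (n - Suc k - 1) * (fact (Suc k) *
      (\<Sum>j | 2 * j + 1 \<le> Suc k. rcoef (Suc k) j * (N im_part (Suc (2 * j)) - N re_part (2 * j))))"
proof -
  let ?c = "(2 * of_real pi * \<i>) ^ (n - Suc k - 1) :: complex"
  let ?W = "snd C ` (U \<inter> fst C)"
  let ?jet = "\<lambda>j i q. if i < 2 * j then re_jet C q else im_jet C q"
  have W: "open ?W" and z: "snd C p \<in> ?W" using open_chart_image[OF A(1) C(1) A(2)] C by auto
  have pz: "chart_inv C (snd C p) = p" using chart_inv_chart[OF A(1) C(1)] C(2) by blast
  have len: "length fs = Suc (Suc k)" using fs by (simp add: tuples_def)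
  have hol: "holomorphic_fun A U (fs ! i)" if "i < Suc (Suc k)" for i
    using tuples_sectionD[OF fs] that by simp
  let ?g = "\<lambda>j \<sigma> \<tau> z us. (im_part (fs ! \<sigma> 0) (chart_inv C z) * re_part (fs ! \<sigma> (Suc (\<tau> 0))) (chart_inv C z)) *
      detv k (\<lambda>i l. ?jet j i (chart_inv C z) (fs ! \<sigma> (Suc (\<tau> (Suc i)))) (us ! l))"
  let ?E = "\<lambda>j \<sigma> \<tau> vs. detv (Suc k) (\<lambda>i l. case_nat
      (\<lambda>v. im_part (fs ! \<sigma> 0) p * re_jet C p (fs ! \<sigma> (Suc (\<tau> 0))) v + im_jet C p (fs ! \<sigma> 0) v * re_part (fs ! \<sigma> (Suc (\<tau> 0))) p)
      (\<lambda>i. ?jet j i p (fs ! \<sigma> (Suc (\<tau> (Suc i))))) i (vs ! l))"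
  have base: "has_dop k (?g j \<sigma> \<tau>) (snd C p) (?E j \<sigma> \<tau>)"
    if \<sigma>: "\<sigma> permutes {..<Suc (Suc k)}" and \<tau>: "\<tau> permutes {..<Suc k}" for j \<sigma> \<tau>
  proof -
    have \<sigma>\<tau>: "\<sigma> 0 < Suc (Suc k)" "\<And>i. i < Suc k \<Longrightarrow> \<sigma> (Suc (\<tau> i)) < Suc (Suc k)"
      using permutes_in_image[OF \<sigma>] permutes_in_image[OF \<tau>] by auto
    let ?h = "\<lambda>i v. frechet_derivative (\<lambda>z. fun_diff (fs ! \<sigma> (Suc (\<tau> (Suc i)))) C (chart_inv C z) v) (at (snd C p))"
    \<comment> \<open>Real and imaginary parts commute with differentiation, so the second
      derivatives of the parts inherit the symmetry of those of the holomorphic function.\<close>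
    define DD where "DD = (\<lambda>i v w. if i < 2 * j then complex_of_real (Re (?h i v w)) else \<i> * of_real (Im (?h i v w)))"
    have "has_dop k (?g j \<sigma> \<tau>) (snd C p) (\<lambda>vs. detv (Suc k) (\<lambda>i l. case_nat
      (\<lambda>v. im_part (fs ! \<sigma> 0) (chart_inv C (snd C p)) * re_jet C p (fs ! \<sigma> (Suc (\<tau> 0))) v + im_jet C p (fs ! \<sigma> 0) v * re_part (fs ! \<sigma> (Suc (\<tau> 0))) (chart_inv C (snd C p)))
      (\<lambda>i. ?jet j i (chart_inv C (snd C p)) (fs ! \<sigma> (Suc (\<tau> (Suc i))))) i (vs ! l)))"
    proof (rule has_dop_mult_detv[where D="\<lambda>i z v. ?jet j i (chart_inv C z) (fs ! \<sigma> (Suc (\<tau> (Suc i)))) v" and DD=DD])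
      show "((\<lambda>z. im_part (fs ! \<sigma> 0) (chart_inv C z) * re_part (fs ! \<sigma> (Suc (\<tau> 0))) (chart_inv C z)) has_derivative
        (\<lambda>v. im_part (fs ! \<sigma> 0) (chart_inv C (snd C p)) * re_jet C p (fs ! \<sigma> (Suc (\<tau> 0))) v +
          im_jet C p (fs ! \<sigma> 0) v * re_part (fs ! \<sigma> (Suc (\<tau> 0))) (chart_inv C (snd C p)))) (at (snd C p))"
        using \<sigma>\<tau> by (intro has_derivative_mult re_part_has_derivative[OF hol C]) auto
    next
      fix i v assume "i < k"
      then have f: "holomorphic_fun A U (fs ! \<sigma> (Suc (\<tau> (Suc i))))" using \<sigma>\<tau> by (intro hol) simp
      note D = fun_diff_second_derivative(1)[OF A f C, of v]
      show "((\<lambda>z. ?jet j i (chart_inv C z) (fs ! \<sigma> (Suc (\<tau> (Suc i)))) v) has_derivative DD i v) (at (snd C p))"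
        using bounded_linear.has_derivative[OF bounded_linear_of_real_Re D]
          bounded_linear.has_derivative[OF bounded_linear_i_Im D]
        by (cases "i < 2 * j") (simp_all add: DD_def re_jet_def im_jet_def)
      show "DD i v w = DD i w v" for w
        unfolding DD_def fun_diff_second_derivative(2)[OF A f C, of v w] ..
    qed
    then show ?thesis unfolding pz .
  qed
  have "has_dop k (\<lambda>z us. ?c * asum (Suc (Suc k)) (\<lambda>\<sigma>. \<Sum>j | 2 * j + 1 \<le> Suc k. rcoef (Suc k) j * asum (Suc k) (\<lambda>\<tau>. ?g j \<sigma> \<tau> z us)))
    (snd C p) (\<lambda>vs. ?c * asum (Suc (Suc k)) (\<lambda>\<sigma>. \<Sum>j | 2 * j + 1 \<le> Suc k. rcoef (Suc k) j * asum (Suc k) (\<lambda>\<tau>. ?E j \<sigma> \<tau> vs)))"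
  proof (intro has_dop_mult_left has_dop_asum has_dop_sum base)
    show "finite {j. 2 * j + 1 \<le> Suc k}" by (rule finite_subset[of _ "{..k}"]) auto
  qed
  then have "has_dop k (\<lambda>z us. s_gen A n (Suc k) U fs C (chart_inv C z) us) (snd C p)
    (\<lambda>vs. ?c * asum (Suc (Suc k)) (\<lambda>\<sigma>. \<Sum>j | 2 * j + 1 \<le> Suc k. rcoef (Suc k) j * asum (Suc k) (\<lambda>\<tau>. ?E j \<sigma> \<tau> vs)))"
    by (rule has_dop_cong[OF _ W z]) (simp only: s_gen_expand[OF k fs C(1) chart_image(1)[OF A(1) C(1)]])
  from ext_deriv_has_dop[where U=U and \<omega>="s_gen A n (Suc k) U fs", OF C vs this]
  have "ext_deriv A U k (s_gen A n (Suc k) U fs) C p vs =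
    ?c * asum (Suc (Suc k)) (\<lambda>\<sigma>. \<Sum>j | 2 * j + 1 \<le> Suc k. rcoef (Suc k) j * asum (Suc k) (\<lambda>\<tau>. ?E j \<sigma> \<tau> vs))" .
  also have "\<dots> = ?c * (\<Sum>j | 2 * j + 1 \<le> Suc k. rcoef (Suc k) j * asum (Suc (Suc k)) (\<lambda>\<sigma>. asum (Suc k) (\<lambda>\<tau>. ?E j \<sigma> \<tau> vs)))"
    by (simp only: asum_sum asum_mult_left)
  also have "(\<Sum>j | 2 * j + 1 \<le> Suc k. rcoef (Suc k) j * asum (Suc (Suc k)) (\<lambda>\<sigma>. asum (Suc k) (\<lambda>\<tau>. ?E j \<sigma> \<tau> vs))) =
    (\<Sum>j | 2 * j + 1 \<le> Suc k. rcoef (Suc k) j * (fact (Suc k) * (N im_part (Suc (2 * j)) - N re_part (2 * j))))"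
  proof (intro sum.cong refl arg_cong2[where f="(*)"])
    fix j assume "j \<in> {j. 2 * j + 1 \<le> Suc k}"
    then have j: "2 * j < Suc k" by simp
    show "asum (Suc (Suc k)) (\<lambda>\<sigma>. asum (Suc k) (\<lambda>\<tau>. ?E j \<sigma> \<tau> vs)) = fact (Suc k) * (N im_part (Suc (2 * j)) - N re_part (2 * j))"
      unfolding detv_case_add asum_add N_def
        asum_lmix_first[OF len, of "\<lambda>f. im_part f p" "re_jet C p" "2 * j" "im_jet C p" vs]
        asum_lmix_second[OF len j, of "\<lambda>f. re_part f p" "im_jet C p" "re_jet C p" vs]
      by (simp only: distrib_left mult_minus_right diff_conv_add_uminus)
  qed
  finally show ?thesis
    by (simp only: sum_distrib_left mult.left_commute)
qed

section \<open>Expansion of phi into real and imaginary parts\<close>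

lemma proj_twist_add: "proj_twist n (z + w) = proj_twist n z + proj_twist n w"
  by (simp add: proj_twist_def algebra_simps)

lemma proj_twist_zero [simp]: "proj_twist n 0 = 0"
  by (simp add: proj_twist_def)

lemma proj_twist_sum: "proj_twist n (\<Sum>i\<in>I. f i) = (\<Sum>i\<in>I. proj_twist n (f i))"
  by (induction I rule: infinite_finite_induct) (simp_all add: proj_twist_add)

lemma proj_twist_twisted:
  "z \<in> twisted_reals d \<Longrightarrow> proj_twist n z = (if even d = odd n then z else 0)"
  by (auto simp: proj_twist_def twisted_reals_iff complex_eq_iff split: if_splits)

text \<open>By \<open>mix_laplace\<close>, m! times the sum over the omitted index is the full
  alternating sum, to which the binomial expansion applies.\<close>

lemma omega_gen_lmix:
  assumes m: "m < n" and len: "length fs = Suc m"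
  shows "omega_gen A n m U fs = scale_form ((2 * of_real pi * \<i>) ^ (n - m - 1))
    (cut_form A U m (\<lambda>C p vs. lmix m (\<lambda>f. f p) (\<lambda>i f. fun_diff f C p) fs vs))"
proof (intro ext)
  fix C p vs
  have len': "length (del_nth j fs) = m" if "j \<le> m" for j
    using that len by simp
  show "omega_gen A n m U fs C p vs = scale_form ((2 * of_real pi * \<i>) ^ (n - m - 1))
    (cut_form A U m (\<lambda>C p vs. lmix m (\<lambda>f. f p) (\<lambda>i f. fun_diff f C p) fs vs)) C p vs"
  proof (cases "C \<in> A \<and> p \<in> U \<inter> fst C \<and> length vs = m")
    case True
    then have C: "C \<in> A" "p \<in> U \<inter> fst C" and vs: "length vs = m" by blast+
    have "(\<Sum>j\<le>m. (-1) ^ j * ((fs ! j) p * wedge_d A U (del_nth j fs) C p vs)) =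
      (\<Sum>j\<le>m. (-1) ^ j * ((fs ! j) p * detv m (\<lambda>i l. fun_diff (fs ! cyc j (Suc i)) C p (vs ! l))))"
    proof (intro sum.cong refl arg_cong2[where f="(*)"])
      fix j assume "j \<in> {..m}"
      then have j: "j \<le> m" by simp
      have "wedge_d A U (del_nth j fs) C p vs = detv m (\<lambda>i l. fun_diff (del_nth j fs ! i) C p (vs ! l))"
        using wedge_d_apply[OF C, of vs "del_nth j fs"] len'[OF j] vs by simp
      also have "\<dots> = detv m (\<lambda>i l. fun_diff (fs ! cyc j (Suc i)) C p (vs ! l))"
        using j len by (intro detv_cong) (simp add: nth_del_nth)
      finally show "wedge_d A U (del_nth j fs) C p vs = \<dots>" .
    qed
    then have "fact m * (\<Sum>j\<le>m. (-1) ^ j * ((fs ! j) p * wedge_d A U (del_nth j fs) C p vs)) =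
      lmix m (\<lambda>f. f p) (\<lambda>i f. fun_diff f C p) fs vs"
      unfolding lmix_def mix_laplace by simp
    then show ?thesis
      using m True by (simp add: omega_gen_def scale_form_def sum_form_apply fun_mult_def cut_form_def mult.assoc)
  next
    case False
    have "wedge_d A U (del_nth j fs) C p vs = 0" if "j \<le> m" for j
      using False len'[OF that] by (intro wedge_d_zero) auto
    then have "omega_gen A n m U fs C p vs = 0"
      using m by (simp add: omega_gen_def scale_form_def sum_form_apply fun_mult_def)
    then show ?thesis
      using False unfolding scale_form_def cut_form_def by (simp only: if_False mult_zero_right)
  qed
qed

lemma proj_omega_gen:
  assumes k: "k < n" and len: "length fs = Suc k" and vs: "length vs = k" and C: "C \<in> A" "p \<in> U \<inter> fst C"
  defines "N \<equiv> \<lambda>x q. lmix k (\<lambda>f. x f p) (\<lambda>i. if i < q then re_jet C p else im_jet C p) fs vs"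
  shows "proj_form n (omega_gen A n k U fs) C p vs = (2 * of_real pi * \<i>) ^ (n - k - 1) *
    (\<Sum>q\<le>k. of_nat (k choose q) * (if even q then N re_part q else N im_part q))"
proof -
  let ?c = "(2 * of_real pi * \<i>) ^ (n - k - 1) :: complex"
  \<comment> \<open>The twists have the parity of n - 1 + q for \<open>re_part\<close> and of n + q
    for \<open>im_part\<close>. The projection therefore keeps the former for even q and the latter
    for odd q.\<close>
  have tw: "?c * (of_nat (k choose q) * N re_part q) \<in> twisted_reals ((n - k - 1) + (0 + k + q))"
    "?c * (of_nat (k choose q) * N im_part q) \<in> twisted_reals ((n - k - 1) + (1 + k + q))" if "q \<le> k" for q
    unfolding N_def using that
    by (intro twisted_reals_mult[OF two_pi_i_power_twisted] twisted_reals_real_mult lmix_re_im_twisted[OF len vs];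
        simp add: twisted_reals_iff re_part_def im_part_def jet_defs)+
  have "lmix k (\<lambda>f. f p) (\<lambda>i f. fun_diff f C p) fs vs =
    lmix k (\<lambda>f. re_part f p + im_part f p) (\<lambda>i f v. re_jet C p f v + im_jet C p f v) fs vs"
    by (intro lmix_cong[OF len len vs vs]) (simp_all add: re_part_def im_part_def jet_defs complex_eq[symmetric])
  also have "\<dots> = (\<Sum>q\<le>k. of_nat (k choose q) * N re_part q) + (\<Sum>q\<le>k. of_nat (k choose q) * N im_part q)"
    unfolding lmix_def mix_add_left mix_binomial N_def
    by (intro arg_cong2[where f="(+)"] sum.cong refl arg_cong2[where f="(*)"] mix_cong) auto
  finally have "proj_form n (omega_gen A n k U fs) C p vs =
    (\<Sum>q\<le>k. proj_twist n (?c * (of_nat (k choose q) * N re_part q))) + (\<Sum>q\<le>k. proj_twist n (?c * (of_nat (k choose q) * N im_part q)))"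
    using C vs by (simp add: proj_form_def omega_gen_lmix[OF k len] scale_form_def cut_form_def distrib_left
        proj_twist_add proj_twist_sum sum_distrib_left)
  also have "\<dots> = (\<Sum>q\<le>k. ?c * (of_nat (k choose q) * (if even q then N re_part q else N im_part q)))"
    unfolding sum.distrib[symmetric]
  proof (intro sum.cong refl)
    fix q assume "q \<in> {..k}"
    then have q: "q \<le> k" by simp
    show "proj_twist n (?c * (of_nat (k choose q) * N re_part q)) + proj_twist n (?c * (of_nat (k choose q) * N im_part q)) =
      ?c * (of_nat (k choose q) * (if even q then N re_part q else N im_part q))"
      using proj_twist_twisted[OF tw(1)[OF q], of n] proj_twist_twisted[OF tw(2)[OF q], of n] k
      by (cases "even q"; cases "even n") (auto simp: even_diff_nat)
  qed
  finally show ?thesis by (simp add: sum_distrib_left)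
qed

lemma fact_rcoef: "2 * j + 1 \<le> k \<Longrightarrow> fact k * rcoef k j = of_nat (k choose (2 * j + 1))"
  by (simp add: rcoef_def binomial_fact)

text \<open>The coefficient of a (2 j) on the left is (k + 1 choose 2 j + 1) - (k choose 2 j + 1) =
  k choose 2 j; the terms in b already agree.\<close>

lemma homotopy_coefficients:
  fixes a b :: "nat \<Rightarrow> complex"
  shows "fact (Suc k) * (\<Sum>j | 2 * j + 1 \<le> Suc k. rcoef (Suc k) j * a (2 * j)) +
      fact k * (\<Sum>j | 2 * j + 1 \<le> k. rcoef k j * (b (Suc (2 * j)) - a (2 * j))) =
    (\<Sum>q\<le>k. of_nat (k choose q) * (if even q then a q else b q))"
proof -
  let ?I = "{j. 2 * j + 1 \<le> Suc k}" and ?J = "{j. 2 * j + 1 \<le> k}"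
  have fin: "finite ?I" "finite ?J" by (rule finite_subset[of _ "{..k}"]; auto)+
  have 1: "fact (Suc k) * (\<Sum>j\<in>?I. rcoef (Suc k) j * a (2 * j)) = (\<Sum>j\<in>?I. of_nat (Suc k choose (2 * j + 1)) * a (2 * j))"
    unfolding sum_distrib_left mult.assoc[symmetric] by (intro sum.cong refl) (simp only: fact_rcoef mem_Collect_eq)
  have 2: "fact k * (\<Sum>j\<in>?J. rcoef k j * (b (Suc (2 * j)) - a (2 * j))) =
    (\<Sum>j\<in>?J. of_nat (k choose (2 * j + 1)) * (b (Suc (2 * j)) - a (2 * j)))"
    unfolding sum_distrib_left mult.assoc[symmetric] by (intro sum.cong refl) (simp only: fact_rcoef mem_Collect_eq)
  \<comment> \<open>The index sets differ at most by the index with 2 j = k, where k choose k + 1 is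
    0.\<close>
  have 3: "(\<Sum>j\<in>?J. of_nat (k choose (2 * j + 1)) * a (2 * j)) = (\<Sum>j\<in>?I. of_nat (k choose (2 * j + 1)) * a (2 * j))"
    by (rule sum.mono_neutral_left[OF fin(1)]) (auto simp: binomial_eq_0)
  have even: "(\<Sum>j\<in>?I. of_nat (k choose (2 * j)) * a (2 * j)) = (\<Sum>q | q \<le> k \<and> even q. of_nat (k choose q) * a q)"
    by (rule sum.reindex_bij_witness[of _ "\<lambda>q. q div 2" "\<lambda>j. 2 * j"]) auto
  have odd: "(\<Sum>j\<in>?J. of_nat (k choose (2 * j + 1)) * b (Suc (2 * j))) = (\<Sum>q | q \<le> k \<and> odd q. of_nat (k choose q) * b q)"
    by (rule sum.reindex_bij_witness[of _ "\<lambda>q. q div 2" "\<lambda>j. 2 * j + 1"]) (auto elim!: oddE)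
  have "(\<Sum>q\<le>k. of_nat (k choose q) * (if even q then a q else b q)) =
    (\<Sum>q | q \<le> k \<and> even q. of_nat (k choose q) * a q) + (\<Sum>q | q \<le> k \<and> odd q. of_nat (k choose q) * b q)"
  proof -
    have "{..k} = {q. q \<le> k \<and> even q} \<union> {q. q \<le> k \<and> odd q}" by auto
    then have "(\<Sum>q\<le>k. of_nat (k choose q) * (if even q then a q else b q)) =
      (\<Sum>q | q \<le> k \<and> even q. of_nat (k choose q) * (if even q then a q else b q)) +
      (\<Sum>q | q \<le> k \<and> odd q. of_nat (k choose q) * (if even q then a q else b q))"
      by (simp only:) (rule sum.union_disjoint, auto)
    then show ?thesis by simp
  qed
  also have "\<dots> = (\<Sum>j\<in>?I. of_nat (Suc k choose (2 * j + 1)) * a (2 * j)) +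
     (\<Sum>j\<in>?J. of_nat (k choose (2 * j + 1)) * (b (Suc (2 * j)) - a (2 * j)))"
    unfolding even[symmetric] odd[symmetric]
  proof -
    have "(\<Sum>j\<in>?I. of_nat (Suc k choose (2 * j + 1)) * a (2 * j)) =
      (\<Sum>j\<in>?I. of_nat (k choose (2 * j)) * a (2 * j)) + (\<Sum>j\<in>?J. of_nat (k choose (2 * j + 1)) * a (2 * j))"
      unfolding 3 sum.distrib[symmetric] by (intro sum.cong refl) (simp add: distrib_right)
    then show "(\<Sum>j\<in>?I. of_nat (k choose (2 * j)) * a (2 * j)) + (\<Sum>j\<in>?J. of_nat (k choose (2 * j + 1)) * b (Suc (2 * j))) =
      (\<Sum>j\<in>?I. of_nat (Suc k choose (2 * j + 1)) * a (2 * j)) +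
      (\<Sum>j\<in>?J. of_nat (k choose (2 * j + 1)) * (b (Suc (2 * j)) - a (2 * j)))"
      by (simp only: right_diff_distrib sum_subtractf) simp
  qed
  finally show ?thesis unfolding 1 2 ..
qed

section \<open>The maps on the Lie-exponential complex\<close>

text \<open>Together with \<open>lie_rank\<close> this gives all degrees one description, so that
  sections and units can be treated at once.\<close>

definition lie_gens :: "('x::topological_space, 'd::finite) chart set \<Rightarrow> nat \<Rightarrow> nat \<Rightarrow> 'x set \<Rightarrow> ('x \<Rightarrow> complex) monoid"
  where "lie_gens A n k U = (if k < n then hol_sections A U else hol_units A U)"

definition lie_rank :: "nat \<Rightarrow> nat \<Rightarrow> nat"
  where "lie_rank n k = (if k < n then k + 1 else n)"

lemma lie_exp_eq: "lie_exp A n k U = ext_power (lie_rank n k) (lie_gens A n k U)"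
  by (simp add: lie_exp_def lie_rank_def lie_gens_def)

lemma s_map_eq:
  "s_map A n k U = ext_lift (lie_rank n k) (lie_gens A n k U) (smooth_forms A (n - 1) (k - 1) U) (s_gen A n k U)"
  by (simp add: s_map_def lie_rank_def lie_gens_def)

lemma lie_exp_res_eq:
  "lie_exp_res A n k U V = ext_lift (lie_rank n k) (lie_gens A n k U) (lie_exp A n k V)
     (\<lambda>fs. ext_wedge (lie_gens A n k V) (map (cut_fun (if k < n then 0 else 1) V) fs))"
  by (simp add: lie_exp_res_def lie_rank_def lie_gens_def)

lemma monoid_lie_gens: "monoid (lie_gens A n k U)"
  by (simp add: lie_gens_def monoid_hol_sections monoid_hol_units)

lemma alternating_map_forms:
  fixes F :: "'a list \<Rightarrow> ('x, 'd) form"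
  assumes "monoid.mult H = (+)" "one H = 0" "\<And>fs. fs \<in> tuples k G \<Longrightarrow> F fs \<in> carrier H"
    and "\<And>C p vs. alternating_map k G add_group (\<lambda>fs. F fs C p vs)"
  shows "alternating_map k G H F"
  unfolding alternating_map_def
proof (intro conjI ballI allI impI)
  fix xs i x y assume "xs \<in> tuples k G" "i < k" "x \<in> carrier G" "y \<in> carrier G"
  then show "F (xs[i := x \<otimes>\<^bsub>G\<^esub> y]) = F (xs[i := x]) \<otimes>\<^bsub>H\<^esub> F (xs[i := y])"
    using alternating_mapD(2)[OF assms(4)] by (simp add: assms(1) fun_eq_iff)
next
  fix xs i j assume "xs \<in> tuples k G" "i < j" "j < k" "xs ! i = xs ! j"
  then show "F xs = \<one>\<^bsub>H\<^esub>"
    using alternating_mapD(3)[OF assms(4)] by (simp add: assms(2) fun_eq_iff)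
qed (rule assms(3))

text \<open>Additivity in slot 0 comes from x, in the other slots from R. Antisymmetrised, this is
  the shape of \<open>s_gen\<close> below degree n.\<close>

lemma multiadditive_Cons:
  assumes x: "\<And>f g. f \<in> carrier G \<Longrightarrow> g \<in> carrier G \<Longrightarrow> x (f \<otimes>\<^bsub>G\<^esub> g) = x f + x g"
    and R: "alternating_map k G add_group R"
  shows "multiadditive (Suc k) G (\<lambda>gs. x (hd gs) * R (tl gs))"
proof (rule multiadditiveI)
  fix xs i f g assume *: "length xs = Suc k" "set xs \<subseteq> carrier G" "i < Suc k" "f \<in> carrier G" "g \<in> carrier G"
  then obtain y ys where xs: "xs = y # ys" by (cases xs) auto
  show "x (hd (xs[i := f \<otimes>\<^bsub>G\<^esub> g])) * R (tl (xs[i := f \<otimes>\<^bsub>G\<^esub> g])) =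
    x (hd (xs[i := f])) * R (tl (xs[i := f])) + x (hd (xs[i := g])) * R (tl (xs[i := g]))"
  proof (cases i)
    case 0
    then show ?thesis using * x by (simp add: xs distrib_right)
  next
    case (Suc j)
    have "ys \<in> tuples k G" using * by (simp add: xs tuples_def)
    from alternating_mapD(2)[OF R this, of j f g] show ?thesis
      using * Suc by (simp add: xs distrib_left)
  qed
qed

text \<open>Pullback along a homomorphism; the instances are restriction of sections or units and
  the exponential map.\<close>

lemma alternating_map_map:
  assumes "\<And>x. x \<in> carrier G \<Longrightarrow> \<phi> x \<in> carrier G'"
    and "\<And>x y. x \<in> carrier G \<Longrightarrow> y \<in> carrier G \<Longrightarrow> \<phi> (x \<otimes>\<^bsub>G\<^esub> y) = \<phi> x \<otimes>\<^bsub>G'\<^esub> \<phi> y"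
    and F: "alternating_map k G' H F"
  shows "alternating_map k G H (\<lambda>xs. F (map \<phi> xs))"
proof -
  have "map \<phi> xs \<in> tuples k G'" if "xs \<in> tuples k G" for xs
    using that assms(1) by (auto simp: tuples_def)
  then show ?thesis
    using alternating_mapD[OF F] assms(1,2)
    unfolding alternating_map_def by (auto simp: map_update tuples_def)
qed

text \<open>With c the constant 2 pi i this makes the differential well defined before its last
  step.\<close>

lemma alternating_map_Cons:
  assumes c: "c \<in> carrier G" and F: "alternating_map (Suc k) G H F"
  shows "alternating_map k G H (\<lambda>xs. F (c # xs))"
  unfolding alternating_map_def
proof (intro conjI ballI allI impI)
  have t: "c # xs \<in> tuples (Suc k) G" if "xs \<in> tuples k G" for xs
    using that c by (auto simp: tuples_def)
  fix xs assume xs: "xs \<in> tuples k G"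
  show "F (c # xs) \<in> carrier H" by (rule alternating_mapD(1)[OF F t[OF xs]])
  show "F (c # xs[i := x \<otimes>\<^bsub>G\<^esub> y]) = F (c # xs[i := x]) \<otimes>\<^bsub>H\<^esub> F (c # xs[i := y])"
    if "i < k" "x \<in> carrier G" "y \<in> carrier G" for i x y
    using alternating_mapD(2)[OF F t[OF xs], of "Suc i" x y] that by simp
  show "F (c # xs) = \<one>\<^bsub>H\<^esub>" if "i < j" "j < k" "xs ! i = xs ! j" for i j
    using alternating_mapD(3)[OF F t[OF xs], of "Suc i" "Suc j"] that by simp
qed

lemma s_gen_smooth_forms:
  fixes A :: "('x::{t2_space, second_countable_topology}, 'd::finite) chart set"
  assumes A: "complex_manifold A" "open U" and k: "1 \<le> k" "k \<le> n"
    and fs: "fs \<in> tuples (lie_rank n k) (lie_gens A n k U)"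
  shows "s_gen A n k U fs \<in> carrier (smooth_forms A (n - 1) (k - 1) U)"
proof (cases "k < n")
  case True
  obtain k' where k': "k = Suc k'" using k by (cases k) auto
  have fs': "fs \<in> tuples (Suc k) (hol_sections A U)"
    using fs True by (simp add: lie_rank_def lie_gens_def)
  have len: "length fs = Suc k" using fs' by (simp add: tuples_def)
  have "fun_mult (im_part (hd (permute_list \<sigma> fs))) (r_tilde A U (tl (permute_list \<sigma> fs)))
    \<in> carrier (smooth_forms A (1 + k') k' U)" if \<sigma>: "\<sigma> permutes {..<Suc k}" for \<sigma>
  proof (rule smooth_forms_fun_mult[OF A])
    have t: "permute_list \<sigma> fs \<in> tuples (Suc k) (hol_sections A U)"
      by (rule permute_list_tuples[OF \<sigma> fs'])
    then show "r_tilde A U (tl (permute_list \<sigma> fs)) \<in> carrier (smooth_forms A k' k' U)"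
      unfolding k' by (intro r_tilde_smooth_forms[OF A] tl_tuples)
    have "permute_list \<sigma> fs \<noteq> []" by (rule permute_list_nonempty[OF len])
    then have hol: "holomorphic_fun A U (hd (permute_list \<sigma> fs))"
      by (intro tuples_sectionD(2)[OF t]) simp
    show "im_part (hd (permute_list \<sigma> fs)) p \<in> twisted_reals 1" for p
      by (simp add: im_part_def twisted_reals_iff)
    fix C assume C: "C \<in> A"
    have W: "open (snd C ` (U \<inter> fst C))" by (rule open_chart_image[OF A(1) C A(2)])
    from smooth_on_bounded_linear[OF bounded_linear_i_Im W smooth_on_cholomorphic[OF W holomorphic_fun_chart[OF hol C]]]
    show "smooth_on (im_part (hd (permute_list \<sigma> fs)) \<circ> chart_inv C) (snd C ` (U \<inter> fst C))"
      by (simp add: im_part_def o_def)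
  qed
  then have "s_gen A n k U fs \<in> carrier (smooth_forms A ((n - k - 1) + (1 + k')) k' U)"
    using True unfolding s_gen_def if_P[OF True] alt_sum_def len
    by (intro smooth_forms_scale[OF A] smooth_forms_sum[OF A] smooth_forms_real_scale[OF A] two_pi_i_power_twisted) auto
  \<comment> \<open>The twists add up: n - k - 1 from the power of 2 pi i, 1 from the imaginary
    part, k - 1 from \<open>r_tilde\<close>.\<close>
  moreover have "(n - k - 1) + (1 + k') = n - 1" "k' = k - 1" using True k' by simp_all
  ultimately show ?thesis by (simp only:)
next
  case False
  then have n: "k = n" "n = Suc (n - 1)" using k by auto
  then have "fs \<in> tuples (Suc (n - 1)) (hol_units A U)"
    using fs by (simp add: lie_rank_def lie_gens_def)
  from of_logs_r_tilde_smooth_forms[OF A this] show ?thesis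
    unfolding s_gen_def n(1) by (simp add: smooth_forms_real_scale[OF A])
qed

lemma s_gen_alternating_map:
  fixes A :: "('x::{t2_space, second_countable_topology}, 'd::finite) chart set"
  assumes A: "complex_manifold A" "open U" and k: "1 \<le> k" "k \<le> n"
  shows "alternating_map (lie_rank n k) (lie_gens A n k U) (smooth_forms A (n - 1) (k - 1) U) (s_gen A n k U)"
proof (rule alternating_map_forms[OF _ _ s_gen_smooth_forms[OF A k]])
  fix C p vs
  show "alternating_map (lie_rank n k) (lie_gens A n k U) add_group (\<lambda>fs. s_gen A n k U fs C p vs)"
  proof (cases "k < n")
    case True
    obtain k' where k': "k = Suc k'" using k by (cases k) auto
    have "multiadditive (Suc k) (hol_sections A U) (\<lambda>gs. im_part (hd gs) p * r_tilde A U (tl gs) C p vs)"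
      unfolding k' by (intro multiadditive_Cons alternating_map_r_tilde) (simp add: im_part_def algebra_simps)
    then have "alternating_map (Suc k) (hol_sections A U) add_group (\<lambda>fs. (2 * of_real pi * \<i>) ^ (n - k - 1) *
      asum (Suc k) (\<lambda>\<sigma>. im_part (hd (permute_list \<sigma> fs)) p * r_tilde A U (tl (permute_list \<sigma> fs)) C p vs))"
      by (intro alternating_map_mult_left alternating_map_asum)
    then have "alternating_map (Suc k) (hol_sections A U) add_group (\<lambda>fs. s_gen A n k U fs C p vs)"
      by (rule alternating_map_cong[OF monoid_hol_sections, rotated]) (simp add: s_gen_apply[OF True] tuples_def)
    then show ?thesis using True by (simp add: lie_rank_def lie_gens_def)
  next
    case False
    then have n: "k = n" "n = Suc (n - 1)" using k by auto
    have "alternating_map (Suc (n - 1)) (hol_units A U) add_group (\<lambda>fs. fact n * of_logs (r_tilde A U) fs C p vs)"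
      by (intro alternating_map_mult_left alternating_map_of_logs_r_tilde[OF A(1)])
    then show ?thesis
      using n by (simp add: lie_rank_def lie_gens_def s_gen_def scale_form_def)
  qed
qed simp_all

lemma s_map:
  fixes A :: "('x::{t2_space, second_countable_topology}, 'd::finite) chart set"
  assumes A: "complex_manifold A" "open U" and k: "1 \<le> k" "k \<le> n"
  shows s_map_hom: "s_map A n k U \<in> hom (lie_exp A n k U) (smooth_forms A (n - 1) (k - 1) U)"
    and s_map_wedge: "fs \<in> tuples (lie_rank n k) (lie_gens A n k U) \<Longrightarrow>
      s_map A n k U (ext_wedge (lie_gens A n k U) fs) = s_gen A n k U fs"
  unfolding s_map_eq lie_exp_eq
  by (intro ext_lift_hom ext_lift_wedge monoid_lie_gens comm_group_smooth_forms[OF A] s_gen_alternating_map[OF A k]; assumption)+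

section \<open>Restriction\<close>

lemma fun_diff_cong:
  assumes A: "complex_manifold A" "C \<in> A" and N: "open N" "p \<in> N \<inter> fst C"
    and eq: "\<And>x. x \<in> N \<Longrightarrow> f x = g x"
  shows "fun_diff f C p v = fun_diff g C p v"
proof -
  have "frechet_derivative (f \<circ> chart_inv C) (at (snd C p)) = frechet_derivative (g \<circ> chart_inv C) (at (snd C p))"
    by (rule frechet_derivative_cong_open[OF open_chart_image[OF A N(1)]])
      (use N(2) chart_image(1)[OF A] in \<open>auto intro: eq\<close>)
  then show ?thesis by (simp add: fun_diff_def)
qed

lemma r_tilde_cong:
  assumes A: "complex_manifold A" and V: "open V" "V \<subseteq> U" and C: "C \<in> A" "p \<in> V \<inter> fst C"
    and len: "length fs = Suc k" "length gs = Suc k" "length vs = k"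
    and eq: "\<And>r x. r < Suc k \<Longrightarrow> x \<in> V \<Longrightarrow> (fs ! r) x = (gs ! r) x"
  shows "r_tilde A V fs C p vs = r_tilde A U gs C p vs"
proof -
  have p: "p \<in> U \<inter> fst C" "p \<in> V" using V C by auto
  show ?thesis
    unfolding r_tilde_apply[OF C len(1,3)] r_tilde_apply[OF C(1) p(1) len(2,3)]
  proof (rule rval_cong[OF len])
    fix r assume r: "r < Suc k"
    show "re_part (fs ! r) p = re_part (gs ! r) p"
      by (simp only: re_part_def eq[OF r p(2)])
    show "fun_diff (re_part (fs ! r)) C p v = fun_diff (re_part (gs ! r)) C p v" for v
      by (rule fun_diff_cong[OF A C(1) V(1) C(2)]) (simp only: re_part_def eq[OF r])
    show "fun_diff (im_part (fs ! r)) C p v = fun_diff (im_part (gs ! r)) C p v" for v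
      by (rule fun_diff_cong[OF A C(1) V(1) C(2)]) (simp only: im_part_def eq[OF r])
  qed
qed

lemma cut_fun_simps [simp]:
  "x \<in> V \<Longrightarrow> cut_fun e V f x = f x" "x \<notin> V \<Longrightarrow> cut_fun e V f x = e"
  by (simp_all add: cut_fun_def)

lemma cut_fun_lie_gens:
  assumes A: "complex_manifold A" and V: "open V" "V \<subseteq> U" and f: "f \<in> carrier (lie_gens A n k U)"
  shows "cut_fun (if k < n then 0 else 1) V f \<in> carrier (lie_gens A n k V)"
proof (cases "k < n")
  case True
  then show ?thesis using f by (simp add: lie_gens_def holomorphic_fun_cut[OF A V])
next
  case False
  then show ?thesis using f V(2) by (auto simp: lie_gens_def holomorphic_fun_cut[OF A V])
qed

lemma cut_fun_lie_gens_mult: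
  "cut_fun (if k < n then 0 else 1) V (f \<otimes>\<^bsub>lie_gens A n k U\<^esub> g) =
    cut_fun (if k < n then 0 else 1) V f \<otimes>\<^bsub>lie_gens A n k V\<^esub> cut_fun (if k < n then 0 else 1) V g"
  by (cases "k < n") (simp_all add: lie_gens_def cut_fun_def fun_eq_iff)

lemma map_cut_fun_tuples:
  assumes A: "complex_manifold A" and V: "open V" "V \<subseteq> U" and fs: "fs \<in> tuples m (lie_gens A n k U)"
  shows "map (cut_fun (if k < n then 0 else 1) V) fs \<in> tuples m (lie_gens A n k V)"
proof -
  have "set (map (cut_fun (if k < n then 0 else 1) V) fs) \<subseteq> carrier (lie_gens A n k V)"
  proof
    fix g assume "g \<in> set (map (cut_fun (if k < n then 0 else 1) V) fs)"
    then obtain f where f: "f \<in> set fs" "g = cut_fun (if k < n then 0 else 1) V f" by auto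
    then have "f \<in> carrier (lie_gens A n k U)" using fs unfolding tuples_def by blast
    then show "g \<in> carrier (lie_gens A n k V)" unfolding f(2) by (rule cut_fun_lie_gens[OF A V])
  qed
  then show ?thesis using fs unfolding tuples_def by simp
qed

lemma s_gen_restrict:
  fixes A :: "('x::{t2_space, second_countable_topology}, 'd::finite) chart set"
  assumes A: "complex_manifold A" and V: "open V" "V \<subseteq> U" and k: "1 \<le> k" "k \<le> n"
    and fs: "fs \<in> tuples (lie_rank n k) (lie_gens A n k U)"
  shows "s_gen A n k V (map (cut_fun (if k < n then 0 else 1) V) fs) = cut_form A V (k - 1) (s_gen A n k U fs)"
proof (intro ext)
  fix C p and vs :: "(complex ^ 'd) list"
  let ?e = "if k < n then 0 else 1 :: complex"
  have gs: "map (cut_fun ?e V) fs \<in> tuples (lie_rank n k) (lie_gens A n k V)"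
    by (rule map_cut_fun_tuples[OF A V fs])
  have cut: "cut_fun e V f x = f x" if "x \<in> V" for f x and e :: complex
    using that by (simp add: cut_fun_def)
  show "s_gen A n k V (map (cut_fun ?e V) fs) C p vs = cut_form A V (k - 1) (s_gen A n k U fs) C p vs"
  proof (cases "C \<in> A \<and> p \<in> V \<inter> fst C \<and> length vs = k - 1")
    case False
    \<comment> \<open>At meaningless arguments both sides take the default value 0.\<close>
    have "is_form A V (k - 1) (s_gen A n k V (map (cut_fun ?e V) fs))"
      using s_gen_smooth_forms[OF A V(1) k gs] unfolding smooth_forms_carrier by blast
    from is_formD(1)[OF this False] show ?thesis
      using False unfolding cut_form_def by (simp only: if_False)
  next
    case True
    then have C: "C \<in> A" "p \<in> V \<inter> fst C" and vs: "length vs = k - 1" and p: "p \<in> V" by blast+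
    have "s_gen A n k V (map (cut_fun ?e V) fs) C p vs = s_gen A n k U fs C p vs"
    proof (cases "k < n")
      case lt: True
      obtain k' where k': "k = Suc k'" using k by (cases k) auto
      have len: "length fs = Suc k" using fs lt by (simp add: lie_rank_def tuples_def)
      have len': "length (map (cut_fun ?e V) fs) = Suc k" using len by simp
      show ?thesis
        unfolding s_gen_apply[OF lt len] s_gen_apply[OF lt len']
      proof (intro arg_cong2[where f="(*)"] refl asum_cong)
        fix \<sigma> assume \<sigma>: "\<sigma> permutes {..<Suc k}"
        have ne: "permute_list \<sigma> fs \<noteq> []" by (rule permute_list_nonempty[OF len])
        have pm: "permute_list \<sigma> (map (cut_fun ?e V) fs) = map (cut_fun ?e V) (permute_list \<sigma> fs)"
          using \<sigma> len by (intro permute_list_map) simp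
        show "im_part (hd (permute_list \<sigma> (map (cut_fun ?e V) fs))) p = im_part (hd (permute_list \<sigma> fs)) p"
          unfolding pm using ne by (simp add: hd_map im_part_def cut[OF p])
        show "r_tilde A V (tl (permute_list \<sigma> (map (cut_fun ?e V) fs))) C p vs = r_tilde A U (tl (permute_list \<sigma> fs)) C p vs"
          unfolding pm map_tl[symmetric]
          by (rule r_tilde_cong[OF A V C, of _ k']) (use len k' vs in \<open>simp_all add: cut\<close>)
      qed
    next
      case False
      then have n: "k = n" "n = Suc (n - 1)" using k by auto
      have len: "length fs = Suc (n - 1)" using fs n by (simp add: lie_rank_def tuples_def)
      have "r_tilde A V (map (log_branch p) (map (cut_fun ?e V) fs)) C p vs = r_tilde A U (map (log_branch p) fs) C p vs"
        by (rule r_tilde_cong[OF A V C, of _ "n - 1"]) (use len n vs in \<open>simp_all add: cut p log_branch_def\<close>)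
      then show ?thesis using False by (simp add: s_gen_def scale_form_def of_logs_def)
    qed
    with True show ?thesis by (simp add: cut_form_def)
  qed
qed

text \<open>For compatibility with restriction, both composites are viewed as homomorphisms into the
  additive group of all forms and compared on wedges, where the claim is
  \<open>s_gen_restrict\<close>.\<close>

lemma presheaf_hom_s_map:
  fixes A :: "('x::{t2_space, second_countable_topology}, 'd::finite) chart set"
  assumes A: "complex_manifold A" and k: "1 \<le> k" "k \<le> n"
  shows "presheaf_hom (lie_exp A n k) (lie_exp_res A n k)
    (smooth_forms A (n - 1) (k - 1)) (\<lambda>U V. cut_form A V (k - 1)) (s_map A n k)"
  unfolding presheaf_hom_def
proof (intro conjI allI impI ballI)
  fix U :: "'x set" assume "open U"
  then show "s_map A n k U \<in> hom (lie_exp A n k U) (smooth_forms A (n - 1) (k - 1) U)"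
    by (rule s_map_hom[OF A _ k])
next
  fix U V :: "'x set" and \<xi> assume "open U \<and> open V \<and> V \<subseteq> U" and \<xi>: "\<xi> \<in> carrier (lie_exp A n k U)"
  then have U: "open U" and V: "open V" "V \<subseteq> U" by auto
  let ?\<phi> = "cut_fun (if k < n then 0 else 1) V :: ('x \<Rightarrow> complex) \<Rightarrow> _"
  have wedge: "alternating_map (lie_rank n k) (lie_gens A n k U) (lie_exp A n k V)
    (\<lambda>fs. ext_wedge (lie_gens A n k V) (map ?\<phi> fs))"
    unfolding lie_exp_eq
  proof (rule alternating_map_map[where G'="lie_gens A n k V" and \<phi>="?\<phi>" and F="ext_wedge (lie_gens A n k V)"])
    show "?\<phi> f \<in> carrier (lie_gens A n k V)" if "f \<in> carrier (lie_gens A n k U)" for f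
      by (rule cut_fun_lie_gens[OF A V that])
    show "?\<phi> (f \<otimes>\<^bsub>lie_gens A n k U\<^esub> g) = ?\<phi> f \<otimes>\<^bsub>lie_gens A n k V\<^esub> ?\<phi> g" for f g
      by (rule cut_fun_lie_gens_mult)
  qed (rule alternating_map_ext_wedge[OF monoid_lie_gens])
  have grp: "comm_group (lie_exp A n k V)"
    unfolding lie_exp_eq by (rule comm_group_ext_power[OF monoid_lie_gens])
  note res = ext_lift[OF monoid_lie_gens grp wedge, folded lie_exp_res_eq]
  have g: "(\<lambda>\<xi>. s_map A n k V (lie_exp_res A n k U V \<xi>)) \<in> hom (lie_exp A n k U) add_group"
  proof (rule homI)
    fix \<xi> \<eta> assume "\<xi> \<in> carrier (lie_exp A n k U)" "\<eta> \<in> carrier (lie_exp A n k U)"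
    then show "s_map A n k V (lie_exp_res A n k U V (\<xi> \<otimes>\<^bsub>lie_exp A n k U\<^esub> \<eta>)) =
      s_map A n k V (lie_exp_res A n k U V \<xi>) \<otimes>\<^bsub>add_group\<^esub> s_map A n k V (lie_exp_res A n k U V \<eta>)"
      using hom_mult[OF s_map_hom[OF A V(1) k]] hom_in_carrier[OF res(1)[folded lie_exp_eq]]
      by (simp only: hom_mult[OF res(1)[folded lie_exp_eq]] smooth_forms_simps add_group_simps)
  qed simp
  have h: "(\<lambda>\<xi>. cut_form A V (k - 1) (s_map A n k U \<xi>)) \<in> hom (lie_exp A n k U) add_group"
  proof (rule homI)
    fix \<xi> \<eta> assume "\<xi> \<in> carrier (lie_exp A n k U)" "\<eta> \<in> carrier (lie_exp A n k U)"
    then have "s_map A n k U (\<xi> \<otimes>\<^bsub>lie_exp A n k U\<^esub> \<eta>) = s_map A n k U \<xi> + s_map A n k U \<eta>"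
      by (simp only: hom_mult[OF s_map_hom[OF A U k]] smooth_forms_simps)
    then show "cut_form A V (k - 1) (s_map A n k U (\<xi> \<otimes>\<^bsub>lie_exp A n k U\<^esub> \<eta>)) =
      cut_form A V (k - 1) (s_map A n k U \<xi>) \<otimes>\<^bsub>add_group\<^esub> cut_form A V (k - 1) (s_map A n k U \<eta>)"
      by (simp add: cut_form_def fun_eq_iff)
  qed simp
  show "s_map A n k V (lie_exp_res A n k U V \<xi>) = cut_form A V (k - 1) (s_map A n k U \<xi>)"
  proof (rule ext_power_hom_eq[OF monoid_lie_gens comm_group.axioms(2)[OF comm_group_add_group]
        g[unfolded lie_exp_eq] h[unfolded lie_exp_eq] _ \<xi>[unfolded lie_exp_eq]])
    fix fs assume fs: "fs \<in> tuples (lie_rank n k) (lie_gens A n k U)"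
    have "map ?\<phi> fs \<in> tuples (lie_rank n k) (lie_gens A n k V)"
      by (rule map_cut_fun_tuples[OF A V fs])
    then show "s_map A n k V (lie_exp_res A n k U V (ext_wedge (lie_gens A n k U) fs)) =
      cut_form A V (k - 1) (s_map A n k U (ext_wedge (lie_gens A n k U) fs))"
      by (simp only: res(2)[OF fs] s_map_wedge[OF A V(1) k] s_map_wedge[OF A U k fs] s_gen_restrict[OF A V k fs])
  qed
qed

section \<open>The holomorphic comparison map\<close>

text \<open>Landing in the target group is part of being alternating, on which the value of
  \<open>ext_lift\<close> in \<open>omega_map\<close> rests. Holomorphy of the coefficients comes
  from the derivatives of holomorphic functions being holomorphic.\<close>

lemma omega_gen_holomorphic_forms:
  fixes A :: "('x::{t2_space, second_countable_topology}, 'd::finite) chart set"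
  assumes A: "complex_manifold A" "open U" and k: "k < n" and fs: "fs \<in> tuples (Suc k) (hol_sections A U)"
  shows "omega_gen A n k U fs \<in> carrier (holomorphic_forms A k U)"
proof -
  let ?\<omega> = "cut_form A U k (\<lambda>C p vs. lmix k (\<lambda>f. f p) (\<lambda>i f. fun_diff f C p) fs vs)"
  note len = tuples_sectionD(1)[OF fs] and hol = tuples_sectionD(2)[OF fs]
  have form: "is_form A U k ?\<omega>"
  proof (rule is_form_lmix[where xs="\<lambda>_. fs" and x="\<lambda>p f. f p" and \<gamma>="\<lambda>C p i f. fun_diff f C p"])
    show "length fs = Suc k" by (rule len)
    show "linear (fun_diff f C p)" if "C \<in> A" "p \<in> U \<inter> fst C" "f \<in> set fs" for C p f
      by (rule linear_fun_diff[OF differentiableI[OF holomorphic_fun_has_derivative[OF hol[OF that(3)] that(1,2)]]])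
    show "fun_diff f C' p (frechet_derivative (snd C' \<circ> chart_inv C) (at (snd C p)) v) = fun_diff f C p v"
      if "C \<in> A" "C' \<in> A" "p \<in> U \<inter> fst C \<inter> fst C'" "f \<in> set fs" for C C' p f v
    proof (rule fun_diff_chart_change[OF A(1) that(1,2)])
      show "p \<in> fst C \<inter> fst C'" using that(3) by blast
      have "p \<in> U \<inter> fst C'" using that(3) by blast
      from differentiableI[OF holomorphic_fun_has_derivative[OF hol[OF that(4)] that(2) this]]
      show "(f \<circ> chart_inv C') differentiable (at (snd C' p))" .
    qed
  qed
  have "?\<omega> \<in> carrier (holomorphic_forms A k U)"
    unfolding holomorphic_forms_carrier
  proof (intro conjI allI ballI impI form)
    fix C p i a and vs :: "(complex ^ 'd) list" assume i: "i < length vs"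
    show "?\<omega> C p (vs[i := a *s vs ! i]) = a * ?\<omega> C p vs"
    proof (cases "C \<in> A \<and> p \<in> U \<inter> fst C \<and> length vs = k")
      case True
      then have C: "C \<in> A" "p \<in> U \<inter> fst C" and vs: "length vs = k" by blast+
      have "lmix k (\<lambda>f. f p) (\<lambda>i f. fun_diff f C p) fs (vs[i := a *s vs ! i]) =
        a * lmix k (\<lambda>f. f p) (\<lambda>i f. fun_diff f C p) fs (vs[i := vs ! i])"
        using i vs by (intro lmix_scale len fun_diff_scale[OF hol C]) auto
      then show ?thesis using True by (simp add: cut_form_def)
    next
      case False
      then show ?thesis unfolding cut_form_def length_list_update by (simp only: if_False mult_zero_right)
    qed
  next
    fix C and vs :: "(complex ^ 'd) list" assume C: "C \<in> A" and vs: "length vs = k"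
    let ?W = "snd C ` (U \<inter> fst C)"
    have W: "open ?W" by (rule open_chart_image[OF A(1) C A(2)])
    have "cholomorphic_on (\<lambda>z. lmix k (\<lambda>f. f (chart_inv C z)) (\<lambda>i f. fun_diff f C (chart_inv C z)) fs vs) ?W"
    proof (rule lmix_closed[where P="\<lambda>g. cholomorphic_on g ?W"])
      show "cholomorphic_on (\<lambda>z. f (chart_inv C z)) ?W" if "f \<in> set fs" for f
        using holomorphic_fun_chart[OF hol[OF that] C] by (simp add: o_def)
      show "cholomorphic_on (\<lambda>z. fun_diff f C (chart_inv C z) v) ?W" if "f \<in> set fs" for f v
        by (rule cholomorphic_on_fun_diff[OF A hol[OF that] C])
    qed (rule cholomorphic_on_const cholomorphic_on_add cholomorphic_on_mult len vs; assumption?)+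
    then show "cholomorphic_on (\<lambda>z. ?\<omega> C (chart_inv C z) vs) ?W"
    proof (rule cholomorphic_on_cong[OF W, rotated])
      fix z assume "z \<in> ?W"
      from chart_image(1)[OF A(1) C this] show "lmix k (\<lambda>f. f (chart_inv C z)) (\<lambda>i f. fun_diff f C (chart_inv C z)) fs vs = ?\<omega> C (chart_inv C z) vs"
        using C vs by (simp add: cut_form_def)
    qed
  qed
  then show ?thesis
    unfolding omega_gen_lmix[OF k len] by (rule holomorphic_forms_scale)
qed

lemma omega_gen_alternating_map:
  fixes A :: "('x::{t2_space, second_countable_topology}, 'd::finite) chart set"
  assumes A: "complex_manifold A" "open U" and k: "k < n"
  shows "alternating_map (Suc k) (hol_sections A U) (holomorphic_forms A k U) (omega_gen A n k U)"
proof (rule alternating_map_forms[OF _ _ omega_gen_holomorphic_forms[OF A k]])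
  fix C p and vs :: "(complex ^ 'd) list"
  show "alternating_map (Suc k) (hol_sections A U) add_group (\<lambda>fs. omega_gen A n k U fs C p vs)"
  proof (cases "C \<in> A \<and> p \<in> U \<inter> fst C \<and> length vs = k")
    case True
    then have C: "C \<in> A" "p \<in> U \<inter> fst C" and vs: "length vs = k" by blast+
    have "alternating_map (Suc k) (hol_sections A U) add_group
      (\<lambda>fs. (2 * of_real pi * \<i>) ^ (n - k - 1) * lmix k (\<lambda>f. f p) (\<lambda>i f. fun_diff f C p) fs vs)"
    proof (intro alternating_map_mult_left alternating_map_lmix)
      fix f g assume "f \<in> carrier (hol_sections A U)" "g \<in> carrier (hol_sections A U)"
      then show "fun_diff (f \<otimes>\<^bsub>hol_sections A U\<^esub> g) C p v = fun_diff f C p v + fun_diff g C p v" for v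
        by (simp add: fun_diff_add[OF _ _ C])
    qed simp
    then show ?thesis
      by (rule alternating_map_cong[OF monoid_hol_sections, rotated])
        (use True in \<open>simp add: omega_gen_lmix[OF k] tuples_def scale_form_def cut_form_def\<close>)
  next
    case False
    have "omega_gen A n k U fs C p vs = 0" if "length fs = Suc k" for fs
      unfolding omega_gen_lmix[OF k that] scale_form_def cut_form_def
      using False by (simp only: if_False mult_zero_right)
    then show ?thesis
      by (intro alternating_map_cong[OF monoid_hol_sections _ alternating_map_zero]) (simp add: tuples_def)
  qed
qed simp_all

lemma omega_map:
  fixes A :: "('x::{t2_space, second_countable_topology}, 'd::finite) chart set"
  assumes A: "complex_manifold A" "open U" and k: "k < n"
  shows omega_map_hom: "omega_map A n k U \<in> hom (ext_power (Suc k) (hol_sections A U)) (holomorphic_forms A k U)"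
    and omega_map_wedge: "fs \<in> tuples (Suc k) (hol_sections A U) \<Longrightarrow>
      omega_map A n k U (ext_wedge (hol_sections A U) fs) = omega_gen A n k U fs"
  using ext_lift[OF monoid_hol_sections comm_group_holomorphic_forms omega_gen_alternating_map[OF A k]] k
  by (simp_all add: omega_map_def)

section \<open>The differential of the Lie-exponential complex\<close>

text \<open>Prepending a constant and applying exp, which turns sums into products, both pull
  alternating maps back to alternating maps.\<close>

lemma lie_exp_diff:
  fixes A :: "('x::{t2_space, second_countable_topology}, 'd::finite) chart set"
  assumes A: "complex_manifold A" "open U" and k: "k < n"
  defines "D \<equiv> \<lambda>fs. if k + 1 < n then cut_fun 0 U (\<lambda>_. 2 * of_real pi * \<i>) # fs else map (\<lambda>f. exp \<circ> f) fs"
  shows lie_exp_diff_hom: "lie_exp_diff A n k U \<in> hom (ext_power (Suc k) (hol_sections A U)) (lie_exp A n (k + 1) U)"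
    and lie_exp_diff_wedge: "fs \<in> tuples (Suc k) (hol_sections A U) \<Longrightarrow>
      lie_exp_diff A n k U (ext_wedge (hol_sections A U) fs) = ext_wedge (lie_gens A n (k + 1) U) (D fs)"
proof -
  have c: "cut_fun 0 U (\<lambda>_. 2 * of_real pi * \<i>) \<in> carrier (hol_sections A U)"
  proof -
    have "holomorphic_fun A U (cut_fun 0 U (\<lambda>_. 2 * of_real pi * \<i>))"
      by (rule holomorphic_fun_cut[OF A subset_refl holomorphic_fun_const])
    then show ?thesis by simp
  qed
  have "alternating_map (Suc k) (hol_sections A U) (lie_exp A n (k + 1) U) (\<lambda>fs. ext_wedge (lie_gens A n (k + 1) U) (D fs))"
  proof (cases "k + 1 < n")
    case True
    from alternating_map_Cons[OF c alternating_map_ext_wedge[OF monoid_hol_sections]] show ?thesis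
      using True by (simp add: D_def lie_exp_eq lie_rank_def lie_gens_def)
  next
    case False
    \<comment> \<open>In the last step the rank does not grow: source and target are exterior powers
      of the same rank n = k + 1.\<close>
    with k have n: "n = Suc k" by simp
    have "alternating_map (Suc k) (hol_sections A U) (ext_power (Suc k) (hol_units A U))
      (\<lambda>fs. ext_wedge (hol_units A U) (map (\<lambda>f. exp \<circ> f) fs))"
    proof (rule alternating_map_map[where G'="hol_units A U" and \<phi>="\<lambda>f. exp \<circ> f" and F="ext_wedge (hol_units A U)"])
      show "exp \<circ> f \<in> carrier (hol_units A U)" if "f \<in> carrier (hol_sections A U)" for f :: "'x \<Rightarrow> complex"
        using that by (simp add: holomorphic_fun_exp)
      show "exp \<circ> (f \<otimes>\<^bsub>hol_sections A U\<^esub> g) = (exp \<circ> f) \<otimes>\<^bsub>hol_units A U\<^esub> (exp \<circ> g)" for f g :: "'x \<Rightarrow> complex"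
        by (simp add: fun_eq_iff exp_add)
    qed (rule alternating_map_ext_wedge[OF monoid_hol_units])
    then show ?thesis by (simp add: n D_def lie_exp_eq lie_rank_def lie_gens_def)
  qed
  moreover have "comm_group (lie_exp A n (k + 1) U)"
    unfolding lie_exp_eq by (rule comm_group_ext_power[OF monoid_lie_gens])
  moreover have "lie_exp_diff A n k U = ext_lift (Suc k) (hol_sections A U) (lie_exp A n (k + 1) U)
    (\<lambda>fs. ext_wedge (lie_gens A n (k + 1) U) (D fs))"
    unfolding lie_exp_diff_def D_def lie_gens_def by (simp cong: if_cong) 
  ultimately show "lie_exp_diff A n k U \<in> hom (ext_power (Suc k) (hol_sections A U)) (lie_exp A n (k + 1) U)"
    and "fs \<in> tuples (Suc k) (hol_sections A U) \<Longrightarrow>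
      lie_exp_diff A n k U (ext_wedge (hol_sections A U) fs) = ext_wedge (lie_gens A n (k + 1) U) (D fs)"
    using ext_lift[OF monoid_hol_sections] by simp_all
qed

section \<open>The homotopy identity\<close>

text \<open>For F = exp f one has ln |F| = Re f and dF / F = df, so the logarithms of the exp f may
  be replaced by the f themselves. Thanks to the factor n! the value has the shape found in
  \<open>s_gen_Cons_const\<close>, with exponent n - k - 1 = 0, which unites the two cases of the
  differential.\<close>

lemma s_gen_exp:
  fixes A :: "('x::{t2_space, second_countable_topology}, 'd::finite) chart set"
  assumes A: "complex_manifold A" and fs: "fs \<in> tuples (Suc k) (hol_sections A U)"
    and C: "C \<in> A" "p \<in> U \<inter> fst C" and vs: "length vs = k"
  shows "s_gen A (Suc k) (Suc k) U (map (\<lambda>f. exp \<circ> f) fs) C p vs =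
    fact (Suc k) * rval (\<lambda>f. re_part f p) (re_jet C p) (im_jet C p) fs vs"
proof -
  note len = tuples_sectionD(1)[OF fs]
  have hol: "holomorphic_fun A U (fs ! r)" if "r < Suc k" for r
    using tuples_sectionD(2)[OF fs] len that by simp
  have "set (map (\<lambda>f. exp \<circ> f) fs) \<subseteq> carrier (hol_units A U)"
    using fs by (auto simp: tuples_def holomorphic_fun_exp)
  then have fs': "map (\<lambda>f. exp \<circ> f) fs \<in> tuples (Suc k) (hol_units A U)"
    using len by (simp add: tuples_def)
  have exp: "fun_diff (exp \<circ> fs ! r) C p v / (exp \<circ> fs ! r) p = fun_diff (fs ! r) C p v" if r: "r < Suc k" for r v
  proof -
    have pz: "chart_inv C (snd C p) = p" using chart_inv_chart[OF A C(1)] C(2) by blast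
    have "(exp has_derivative (*) (exp ((fs ! r) p))) (at ((fs ! r \<circ> chart_inv C) (snd C p)))"
      using DERIV_exp[of "(fs ! r) p"] by (simp add: has_field_derivative_def pz)
    from has_derivative_compose[OF holomorphic_fun_has_derivative[OF hol[OF r] C] this]
    have "(exp \<circ> fs ! r \<circ> chart_inv C has_derivative (\<lambda>v. exp ((fs ! r) p) * fun_diff (fs ! r) C p v)) (at (snd C p))"
      by (simp add: o_def)
    from fun_diff_eqI[OF this] show ?thesis by simp
  qed
  have "s_gen A (Suc k) (Suc k) U (map (\<lambda>f. exp \<circ> f) fs) C p vs =
    fact (Suc k) * of_logs (r_tilde A U) (map (\<lambda>f. exp \<circ> f) fs) C p vs"
    by (simp add: s_gen_def scale_form_def)
  also have "of_logs (r_tilde A U) (map (\<lambda>f. exp \<circ> f) fs) C p vs =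
    rval (\<lambda>f. re_part f p) (re_jet C p) (im_jet C p) fs vs"
    unfolding r_tilde_units[OF A C fs' vs]
  proof (rule rval_cong)
    fix r assume r: "r < Suc k"
    then have nth: "map (\<lambda>f. exp \<circ> f) fs ! r = exp \<circ> fs ! r" using len by simp
    show "complex_of_real (ln (cmod ((map (\<lambda>f. exp \<circ> f) fs ! r) p))) = re_part (fs ! r) p"
      unfolding nth by (simp add: re_part_def)
    show "re_log_jet C p (map (\<lambda>f. exp \<circ> f) fs ! r) v = re_jet C p (fs ! r) v" for v
      unfolding nth jet_defs exp[OF r] ..
    show "im_log_jet C p (map (\<lambda>f. exp \<circ> f) fs ! r) v = im_jet C p (fs ! r) v" for v
      unfolding nth jet_defs exp[OF r] ..
  qed (simp_all add: len vs)
  finally show ?thesis .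
qed

lemma fun_diff_const:
  assumes A: "complex_manifold A" "C \<in> A" and U: "open U" "p \<in> U \<inter> fst C"
  shows "fun_diff (cut_fun e U (\<lambda>_. c)) C p v = 0"
proof -
  have "fun_diff (cut_fun e U (\<lambda>_. c)) C p v = fun_diff (\<lambda>_. c) C p v"
    by (rule fun_diff_cong[OF A U]) simp
  then show ?thesis by (simp add: fun_diff_def o_def)
qed

text \<open>Only the terms with the constant \<open>2 \<pi> i\<close> in the first place survive, since the real part and
  the differential of this constant vanish.\<close>

lemma s_gen_Cons_const:
  fixes A :: "('x::{t2_space, second_countable_topology}, 'd::finite) chart set"
  assumes A: "complex_manifold A" "open U" and k: "Suc k < n" and fs: "fs \<in> tuples (Suc k) (hol_sections A U)"
    and C: "C \<in> A" "p \<in> U \<inter> fst C" and vs: "length vs = k"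
  shows "s_gen A n (Suc k) U (cut_fun 0 U (\<lambda>_. 2 * of_real pi * \<i>) # fs) C p vs =
    (2 * of_real pi * \<i>) ^ (n - k - 1) * (fact (Suc k) * rval (\<lambda>f. re_part f p) (re_jet C p) (im_jet C p) fs vs)"
proof -
  let ?c = "cut_fun 0 U (\<lambda>_. 2 * of_real pi * \<i>) :: 'x \<Rightarrow> complex"
  let ?xs = "?c # fs"
  let ?r = "rval (\<lambda>f. re_part f p) (re_jet C p) (im_jet C p) fs vs"
  let ?R = "\<lambda>gs. r_tilde A U gs C p vs"
  let ?F = "\<lambda>\<sigma>. im_part (hd (permute_list \<sigma> ?xs)) p * ?R (tl (permute_list \<sigma> ?xs))"
  have "holomorphic_fun A U ?c"
    by (rule holomorphic_fun_cut[OF A subset_refl holomorphic_fun_const])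
  then have xs: "?xs \<in> tuples (Suc (Suc k)) (hol_sections A U)"
    using fs by (simp add: tuples_def)
  note len = tuples_sectionD(1)[OF fs]
  have len': "length ?xs = Suc (Suc k)" using len by simp
  \<comment> \<open>The index j names the entry in front; the constant is entry 0, so it stands in
    front exactly for j = 0.\<close>
  have "asum (Suc k) (\<lambda>\<rho>. ?F (cyc j \<circ> lift_perm \<rho>)) =
    (if j = 0 then 2 * of_real pi * \<i> * (fact (Suc k) * ?r) else 0)"
    if j: "j \<le> Suc k" for j
  proof -
    have \<sigma>: "cyc j \<circ> lift_perm \<rho> permutes {..<Suc (Suc k)}" if "\<rho> permutes {..<Suc k}" for \<rho>
      using that j by (intro permutes_compose lift_perm_permutes cyc_permutes) auto
    show ?thesis
    proof (cases "j = 0")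
      case True
      have "?F (cyc j \<circ> lift_perm \<rho>) =
        2 * of_real pi * \<i> * (of_int (sign \<rho>) * ?r)"
        if \<rho>: "\<rho> permutes {..<Suc k}" for \<rho>
      proof -
        have "tl (permute_list (cyc j \<circ> lift_perm \<rho>) ?xs) = permute_list \<rho> fs"
        proof (rule nth_equalityI)
          fix i assume "i < length (tl (permute_list (cyc j \<circ> lift_perm \<rho>) ?xs))"
          then have "i < Suc k" using len by simp
          then show "tl (permute_list (cyc j \<circ> lift_perm \<rho>) ?xs) ! i = permute_list \<rho> fs ! i"
            unfolding nth_tl_permute_list[OF \<sigma>[OF \<rho>] len' \<open>i < Suc k\<close>]
            using \<rho> len by (simp add: True permute_list_nth)
        qed (simp add: len)
        moreover have "im_part (hd (permute_list (cyc j \<circ> lift_perm \<rho>) ?xs)) p = 2 * of_real pi * \<i>"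
          unfolding hd_permute_list[OF \<sigma>[OF \<rho>] len'] using C by (simp add: True im_part_def)
        moreover have "?R (permute_list \<rho> fs) = of_int (sign \<rho>) * ?r"
          unfolding r_tilde_sections[OF C permute_list_tuples[OF \<rho> fs] vs] by (rule rval_permute_list[OF \<rho> len])
        ultimately show ?thesis by simp
      qed
      then have "asum (Suc k) (\<lambda>\<rho>. ?F (cyc j \<circ> lift_perm \<rho>)) =
        2 * of_real pi * \<i> * asum (Suc k) (\<lambda>\<rho>. of_int (sign \<rho>) * ?r)"
        unfolding asum_mult_left[symmetric] by (rule asum_cong)
      then show ?thesis
        using True by (simp only: asum_def sum_of_int_sign_square simp_thms if_True)
    next
      case False
      have "?R (tl (permute_list (cyc j \<circ> lift_perm \<rho>) ?xs)) = 0" if \<rho>: "\<rho> permutes {..<Suc k}" for \<rho>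
      proof -
        let ?gs = "tl (permute_list (cyc j \<circ> lift_perm \<rho>) ?xs)"
        have gs: "?gs \<in> tuples (Suc k) (hol_sections A U)"
          by (intro tl_tuples permute_list_tuples[OF \<sigma>[OF \<rho>] xs])
        \<comment> \<open>For j > 0 the constant stands in the tail, at the position that \<rho>
          sends to 0, because \<open>cyc j 1\<close> is 0.\<close>
        define i where "i = inv_into UNIV \<rho> 0"
        have i: "\<rho> i = 0" "i < Suc k"
          unfolding i_def using permutes_inverses(1)[OF \<rho>, of 0] permutes_in_image[OF permutes_inv[OF \<rho>], of 0]
          by simp_all
        then have gsi: "?gs ! i = ?c"
          using False by (simp only: nth_tl_permute_list[OF \<sigma>[OF \<rho>] len']) (simp add: cyc_apply)
        show ?thesis
          unfolding r_tilde_sections[OF C gs vs]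
          by (rule rval_zero_row[of i])
            (use i C len in \<open>simp_all add: gsi re_part_def jet_defs fun_diff_const[OF A(1) C(1) A(2) C(2)]\<close>)
      qed
      then show ?thesis using False by (simp add: asum_def)
    qed
  qed
  then have "asum (Suc (Suc k)) ?F =
    (\<Sum>j\<le>Suc k. if j = 0 then 2 * of_real pi * \<i> * (fact (Suc k) * ?r) else 0)"
    unfolding asum_Suc[of "Suc k"] by (intro sum.cong refl) simp
  also have "\<dots> = 2 * of_real pi * \<i> * (fact (Suc k) * ?r)"
    by (simp only: sum.delta[OF finite_atMost]) simp
  \<comment> \<open>The factor 2 pi i from the constant makes up for the smaller twist in degree k +
    1.\<close>
  moreover have "n - k - 1 = Suc (n - Suc k - 1)" using k by simp
  ultimately show ?thesis
    unfolding s_gen_apply[OF k len'] by (simp only: power_Suc mult.assoc mult.left_commute)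
qed

text \<open>At a chart, a point and k vectors all three terms are combinations of the same numbers
  \<open>N x q\<close>, so the identity of forms is the numerical identity
  \<open>homotopy_coefficients\<close>. At other arguments every term is 0.\<close>

lemma homotopy_on_generators:
  fixes A :: "('x::{t2_space, second_countable_topology}, 'd::finite) chart set"
  assumes A: "complex_manifold A" "open U" and k: "1 \<le> k" "k < n" and fs: "fs \<in> tuples (Suc k) (hol_sections A U)"
  defines "D \<equiv> \<lambda>fs. if k + 1 < n then cut_fun 0 U (\<lambda>_. 2 * of_real pi * \<i>) # fs else map (\<lambda>f. exp \<circ> f) fs"
  assumes D: "D fs \<in> tuples (lie_rank n (k + 1)) (lie_gens A n (k + 1) U)"
  shows "s_gen A n (k + 1) U (D fs) + ext_deriv A U (k - 1) (s_gen A n k U fs) = proj_form n (omega_gen A n k U fs)"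
proof (intro ext)
  fix C p and vs :: "(complex ^ 'd) list"
  note len = tuples_sectionD(1)[OF fs]
  obtain k' where k': "k = Suc k'" using k by (cases k) auto
  show "(s_gen A n (k + 1) U (D fs) + ext_deriv A U (k - 1) (s_gen A n k U fs)) C p vs = proj_form n (omega_gen A n k U fs) C p vs"
  proof (cases "C \<in> A \<and> p \<in> U \<inter> fst C \<and> length vs = k")
    case False
    have "is_form A U (k + 1 - 1) (s_gen A n (k + 1) U (D fs))"
      using s_gen_smooth_forms[OF A _ _ D] k unfolding smooth_forms_carrier by auto
    then have "s_gen A n (k + 1) U (D fs) C p vs = 0"
      by (rule is_formD(1)) (use False in simp)
    moreover have "ext_deriv A U (k - 1) (s_gen A n k U fs) C p vs = 0"
      using False unfolding ext_deriv_def cut_form_def k' diff_Suc_1 by (simp only: if_False)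
    moreover have "omega_gen A n k U fs C p vs = 0"
      using False unfolding omega_gen_lmix[OF k(2) len] scale_form_def cut_form_def
      by (simp only: if_False mult_zero_right)
    ultimately show ?thesis by (simp add: proj_form_def)
  next
    case True
    then have C: "C \<in> A" "p \<in> U \<inter> fst C" and vs: "length vs = k" by blast+
    let ?c = "(2 * of_real pi * \<i>) ^ (n - k - 1) :: complex"
    define N where "N = (\<lambda>x q. lmix k (\<lambda>f. x f p) (\<lambda>i. if i < q then re_jet C p else im_jet C p) fs vs)"
    have "s_gen A n (k + 1) U (D fs) C p vs = ?c * (fact (Suc k) * rval (\<lambda>f. re_part f p) (re_jet C p) (im_jet C p) fs vs)"
    proof (cases "k + 1 < n")
      case True
      then show ?thesis using s_gen_Cons_const[OF A _ fs C vs, of n] by (simp add: D_def)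
    next
      case False
      with k have "n = Suc k" by simp
      then show ?thesis using s_gen_exp[OF A(1) fs C vs] by (simp add: D_def)
    qed
    also have "rval (\<lambda>f. re_part f p) (re_jet C p) (im_jet C p) fs vs =
      (\<Sum>j | 2 * j + 1 \<le> Suc k. rcoef (Suc k) j * N re_part (2 * j))"
      by (simp add: rval_def N_def len)
    finally have s: "s_gen A n (k + 1) U (D fs) C p vs =
      ?c * (fact (Suc k) * (\<Sum>j | 2 * j + 1 \<le> Suc k. rcoef (Suc k) j * N re_part (2 * j)))" .
    have d: "ext_deriv A U (k - 1) (s_gen A n k U fs) C p vs =
      ?c * (fact k * (\<Sum>j | 2 * j + 1 \<le> k. rcoef k j * (N im_part (Suc (2 * j)) - N re_part (2 * j))))"
      using ext_deriv_s_gen[OF A k(2)[unfolded k'] fs[unfolded k'] C vs[unfolded k']]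
      unfolding N_def k' diff_Suc_1 .
    have "(s_gen A n (k + 1) U (D fs) + ext_deriv A U (k - 1) (s_gen A n k U fs)) C p vs =
      ?c * (\<Sum>q\<le>k. of_nat (k choose q) * (if even q then N re_part q else N im_part q))"
      unfolding homotopy_coefficients[symmetric] plus_fun_def s d distrib_left ..
    also have "\<dots> = proj_form n (omega_gen A n k U fs) C p vs"
      unfolding N_def by (rule proj_omega_gen[OF k(2) len vs C, symmetric])
    finally show ?thesis .
  qed
qed

text \<open>The derivative of a sum splits when both coefficients are differentiable; this is where
  the smooth target of \<open>s_map\<close> enters the homotopy.\<close>

lemma ext_deriv_add:
  fixes A :: "('x::{t2_space, second_countable_topology}, 'd::finite) chart set"
  assumes A: "complex_manifold A" and \<omega>: "\<omega> \<in> carrier (smooth_forms A m k U)" and \<eta>: "\<eta> \<in> carrier (smooth_forms A m k U)"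
  shows "ext_deriv A U k (\<omega> + \<eta>) = ext_deriv A U k \<omega> + ext_deriv A U k \<eta>"
proof (intro ext)
  fix C p and vs :: "(complex ^ 'd) list"
  show "ext_deriv A U k (\<omega> + \<eta>) C p vs = (ext_deriv A U k \<omega> + ext_deriv A U k \<eta>) C p vs"
  proof (cases "C \<in> A \<and> p \<in> U \<inter> fst C \<and> length vs = Suc k")
    case False
    then show ?thesis unfolding ext_deriv_def cut_form_def plus_fun_def by (simp only: if_False add_0_left)
  next
    case True
    have diff: "(\<lambda>z. \<theta> C (chart_inv C z) us) differentiable (at (snd C p))"
      if "\<theta> \<in> carrier (smooth_forms A m k U)" "length us = k" for \<theta> :: "('x, 'd) form" and us
    proof -
      have "smooth_on (\<lambda>z. \<theta> C (chart_inv C z) us) (snd C ` (U \<inter> fst C))"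
        using that True unfolding smooth_forms_carrier by blast
      then show ?thesis by (rule smooth_on_differentiable) (use True in blast)
    qed
    have "frechet_derivative (\<lambda>z. \<omega> C (chart_inv C z) us + \<eta> C (chart_inv C z) us) (at (snd C p)) v =
      frechet_derivative (\<lambda>z. \<omega> C (chart_inv C z) us) (at (snd C p)) v +
      frechet_derivative (\<lambda>z. \<eta> C (chart_inv C z) us) (at (snd C p)) v" if "length us = k" for us v
      by (rule fun_cong[OF frechet_derivative_at[OF has_derivative_add[OF
              frechet_derivative_works[THEN iffD1, OF diff[OF \<omega> that]]
              frechet_derivative_works[THEN iffD1, OF diff[OF \<eta> that]]]], symmetric])
    with True show ?thesis
      by (simp add: ext_deriv_def cut_form_def plus_fun_def distrib_left sum.distrib)
  qed
qed

lemma proj_form_add: "proj_form n (\<omega> + \<eta>) = proj_form n \<omega> + proj_form n \<eta>"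
  by (simp add: proj_form_def plus_fun_def proj_twist_add)

text \<open>Both sides are additive in \<xi>, so it is enough to compare them on wedges, where each
  of the maps involved has its prescribed value.\<close>

lemma homotopy:
  fixes A :: "('x::{t2_space, second_countable_topology}, 'd::finite) chart set"
  assumes A: "complex_manifold A" "open U" and k: "1 \<le> k" "k < n" and \<xi>: "\<xi> \<in> carrier (lie_exp A n k U)"
  shows "s_map A n (k + 1) U (lie_exp_diff A n k U \<xi>) + ext_deriv A U (k - 1) (s_map A n k U \<xi>) = phi_map A n k U \<xi>"
proof -
  let ?D = "\<lambda>fs. if k + 1 < n then cut_fun 0 U (\<lambda>_. 2 * of_real pi * \<i>) # fs else map (\<lambda>f. exp \<circ> f) fs"
  let ?E = "ext_power (Suc k) (hol_sections A U)"
  have E: "lie_exp A n k U = ?E" using k by (simp add: lie_exp_def)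
  have k1: "1 \<le> k + 1" "k + 1 \<le> n" "k \<le> n" using k by auto
  note diff = lie_exp_diff[OF A k(2)] and s1 = s_map[OF A k1(1,2)] and s0 = s_map[OF A k(1) k1(3), unfolded E]
    and om = omega_map[OF A k(2)]
  have gens: "lie_gens A n k U = hol_sections A U" "lie_rank n k = Suc k"
    using k by (simp_all add: lie_gens_def lie_rank_def)
  have g: "(\<lambda>\<xi>. s_map A n (k + 1) U (lie_exp_diff A n k U \<xi>) + ext_deriv A U (k - 1) (s_map A n k U \<xi>)) \<in> hom ?E add_group"
  proof (rule homI)
    fix \<xi> \<eta> assume *: "\<xi> \<in> carrier ?E" "\<eta> \<in> carrier ?E"
    have 1: "s_map A n (k + 1) U (lie_exp_diff A n k U (\<xi> \<otimes>\<^bsub>?E\<^esub> \<eta>)) =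
      s_map A n (k + 1) U (lie_exp_diff A n k U \<xi>) + s_map A n (k + 1) U (lie_exp_diff A n k U \<eta>)"
      unfolding hom_mult[OF diff(1) *]
      using hom_mult[OF s1(1) hom_in_carrier[OF diff(1) *(1)] hom_in_carrier[OF diff(1) *(2)]]
      by (simp only: smooth_forms_simps)
    have 2: "ext_deriv A U (k - 1) (s_map A n k U (\<xi> \<otimes>\<^bsub>?E\<^esub> \<eta>)) =
      ext_deriv A U (k - 1) (s_map A n k U \<xi>) + ext_deriv A U (k - 1) (s_map A n k U \<eta>)"
      unfolding hom_mult[OF s0(1) *] smooth_forms_simps
      by (rule ext_deriv_add[OF A(1) hom_in_carrier[OF s0(1) *(1)] hom_in_carrier[OF s0(1) *(2)]])
    show "s_map A n (k + 1) U (lie_exp_diff A n k U (\<xi> \<otimes>\<^bsub>?E\<^esub> \<eta>)) + ext_deriv A U (k - 1) (s_map A n k U (\<xi> \<otimes>\<^bsub>?E\<^esub> \<eta>)) =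
      (s_map A n (k + 1) U (lie_exp_diff A n k U \<xi>) + ext_deriv A U (k - 1) (s_map A n k U \<xi>)) \<otimes>\<^bsub>add_group\<^esub>
      (s_map A n (k + 1) U (lie_exp_diff A n k U \<eta>) + ext_deriv A U (k - 1) (s_map A n k U \<eta>))"
      unfolding 1 2 add_group_simps by (simp only: ac_simps)
  qed simp
  have h: "phi_map A n k U \<in> hom ?E add_group"
  proof (rule homI)
    fix \<xi> \<eta> assume *: "\<xi> \<in> carrier ?E" "\<eta> \<in> carrier ?E"
    show "phi_map A n k U (\<xi> \<otimes>\<^bsub>?E\<^esub> \<eta>) = phi_map A n k U \<xi> \<otimes>\<^bsub>add_group\<^esub> phi_map A n k U \<eta>"
      unfolding phi_map_def hom_mult[OF om(1) *] holomorphic_forms_simps add_group_simps by (rule proj_form_add)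
  qed simp
  show ?thesis
  proof (rule ext_power_hom_eq[OF monoid_hol_sections comm_group.axioms(2)[OF comm_group_add_group] g h _ \<xi>[unfolded E]])
    fix fs assume fs: "fs \<in> tuples (Suc k) (hol_sections A U)"
    \<comment> \<open>The transformed entries must be sections or units before \<open>s_map\<close>
      can be evaluated on their wedge.\<close>
    have D: "?D fs \<in> tuples (lie_rank n (k + 1)) (lie_gens A n (k + 1) U)"
    proof (cases "k + 1 < n")
      case True
      then show ?thesis
        using fs holomorphic_fun_cut[OF A subset_refl holomorphic_fun_const, of 0 "2 * of_real pi * \<i>"]
        by (simp add: lie_rank_def lie_gens_def tuples_def)
    next
      case False
      then show ?thesis
        using fs k by (auto simp: lie_rank_def lie_gens_def tuples_def holomorphic_fun_exp)
    qed
    show "s_map A n (k + 1) U (lie_exp_diff A n k U (ext_wedge (hol_sections A U) fs)) +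
        ext_deriv A U (k - 1) (s_map A n k U (ext_wedge (hol_sections A U) fs)) =
      phi_map A n k U (ext_wedge (hol_sections A U) fs)"
      unfolding diff(2)[OF fs] s1(2)[OF D] s0(2)[unfolded gens, OF fs] phi_map_def om(2)[OF fs]
      by (rule homotopy_on_generators[OF A k fs D])
  qed
qed

theorem theorem5p2:
  fixes A :: "('x::{t2_space, second_countable_topology}, 'd::finite) chart set"
    and n :: nat
  assumes "complex_manifold A"
    and "n \<ge> 1"
  shows "(\<forall>k\<in>{1..n}.
            presheaf_hom (lie_exp A n k) (lie_exp_res A n k)
              (smooth_forms A (n - 1) (k - 1)) (\<lambda>U V. cut_form A V (k - 1))
              (s_map A n k)) \<and>
         (\<forall>k\<in>{1..n - 1}. \<forall>U. open U \<longrightarrow>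
            (\<forall>\<xi>\<in>carrier (lie_exp A n k U).
               s_map A n (k + 1) U (lie_exp_diff A n k U \<xi>)
                 + ext_deriv A U (k - 1) (s_map A n k U \<xi>)
               = phi_map A n k U \<xi>))"
proof (intro conjI ballI allI impI)
  fix k assume "k \<in> {1..n}"
  then show "presheaf_hom (lie_exp A n k) (lie_exp_res A n k)
      (smooth_forms A (n - 1) (k - 1)) (\<lambda>U V. cut_form A V (k - 1)) (s_map A n k)"
    by (intro presheaf_hom_s_map[OF assms(1)]) auto
next
  fix k U \<xi> assume k: "k \<in> {1..n - 1}" and U: "open U" and \<xi>: "\<xi> \<in> carrier (lie_exp A n k U)"
  have "1 \<le> k" "k < n" using k assms(2) by auto
  then show "s_map A n (k + 1) U (lie_exp_diff A n k U \<xi>) + ext_deriv A U (k - 1) (s_map A n k U \<xi>) = phi_map A n k U \<xi>"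
    by (rule homotopy[OF assms(1) U _ _ \<xi>])
qed

end
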